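(* For every $n\ge0$, $-\dfrac{3}{\phi}<\varepsilon(n)<\dfrac{2}{\phi}$. Consequently, for every $n\ge1$: if $q_n>n$, then $$1-\frac4\phi<q_n-n\phi<\frac2\phi,$$ and if $q_n<n$, then $$-2-\frac4\phi<q_n-\frac n\phi<4+\frac1\phi.$$
   Context: $\mathbb N=\{0,1,2,\dots\}$ and $\phi=(1+\sqrt5)/2$. The greedy queens sequence $(q_n)_{n\ge0}$ is defined by $q_0=0$ and, for $n\ge1$, $q_n$ is the least $y\in\mathbb N$ such that for all $0\le i<n$: $y\ne q_i$, $y-n\ne q_i-i$, and $y+n\ne q_i+i$. Define $U(n)=\#\{1\le i\le n: q_i>i\}$ and $\varepsilon(n)=U(n)-n/\phi$ for $n\ge 0$. *)

theory Defs
  imports Complex_Main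
begin

definition phi :: real where
  "phi = (1 + sqrt 5) / 2"

text \<open>Diagonals are compared in \<^typ>\<open>int\<close>, where subtraction is not truncated.
  The side condition leaves only finitely many \<open>y\<close> excluded, so the minimum exists;
  for \<open>n = 0\<close> it is vacuous, so \<open>queens_0\<close> holds without a separate clause.\<close>

fun queens :: "nat \<Rightarrow> nat" where
  "queens n = (LEAST y. \<forall>i\<in>{0..<n}.
      y \<noteq> queens i \<and>
      int y - int n \<noteq> int (queens i) - int i \<and>
      y + n \<noteq> queens i + i)"

declare queens.simps [simp del]

lemma queens_0: "queens 0 = 0"
  by (subst queens.simps) simp

definition upper_count :: "nat \<Rightarrow> nat" where
  "upper_count n = card {i \<in> {1..n}. queens i > i}"

definition upper_dev :: "nat \<Rightarrow> real" where
  "upper_dev n = real (upper_count n) - real n / phi"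

end

theory Submission
  imports Defs
begin

text \<open>
  Write \<open>U n\<close> for \<^const>\<open>upper_count\<close> \<open>n\<close> and \<open>L n = n - U n\<close>, and call a queen, or its column,
  upper or lower according to its side of the main diagonal.

  Above the diagonal the greedy rule is rigid. When column \<open>n\<close> is reached, the diagonals
  \<open>0, \<dots>, U (n - 1)\<close> are all taken and the next one is free of attacks, so an upper queen stands in row
  \<open>n + U n\<close> (\<open>queens_upper\<close>). What has to be understood is where the lower queens stand.

  They use up the rows that the upper queens leave over and the diagonals \<open>1, 2, 3, \<dots>\<close>, and they
  take both very nearly in increasing order. Two facts make this precise. With \<open>j = L n\<close>, the lag
  \<open>n - (2 * j + U j)\<close> is between \<open>-3\<close> and \<open>2\<close> (\<open>lag_bounds\<close>); and a lower queen in column \<open>n\<close> stands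
  in a row between \<open>U n - 2\<close> and \<open>U n + 4\<close> (\<open>lower_queen_near_upper_count\<close>). The first fact says
  \<open>U n = j + U j + lag n\<close> and \<open>n = 2 * j + U j + lag n\<close>, whence
  \<open>upper_dev n = (upper_dev j + lag n) / phi\<^sup>2\<close>. This is a contraction, the interval from \<open>-3 / phi\<close> to
  \<open>2 / phi\<close> is invariant under it for every lag between \<open>-3\<close> and \<open>2\<close>, and induction on \<open>n\<close> gives the
  bounds on the deviation. The bounds on the queens follow, because
  \<open>queens n - n * phi = upper_dev n\<close> for an upper queen and
  \<open>queens n - n / phi = upper_dev n + (queens n - U n)\<close> for a lower one.

  Both facts are statements about a window of bounded size, and they hold because the process is
  self-similar. Cut the rows \<open>1, 2, \<dots>\<close> into consecutive blocks, one for each column \<open>j\<close>: one row if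
  column \<open>j\<close> is lower, two if it is upper, the second being the row of its queen. Rows that are not a
  second one are exactly the rows left for lower queens. The column \<open>p\<close> whose block contains row \<open>n\<close> is the
  parent of \<open>n\<close>. The cells of column \<open>n\<close> that are in doubt lie within a few rows of row \<open>p\<close>. Whether these
  rows are already taken by upper queens is a matter of their positions in their own blocks; and since
  \<open>n + p\<close> is \<open>2 * p + U p\<close> or one less, the upper queens on the antidiagonals in question belong to
  columns within distance 4 of \<open>p\<close>. So the decision in column \<open>n\<close> depends on the recent lower queens and on
  what happens near \<open>p\<close>, a smaller number.

  It turns out that finitely many labels, here called letters, suffice: the letter of a column
  determines the letters of the rows in its block, which are again columns, and every letter
  determines the positions of the recent lower queens inside the window. The tables below list 1919
  letters with their boards, their children, the letters that may follow them, and what can be said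
  about the neighbours of a column that carries them. Since two columns with the same letter behave
  alike, it is enough to run the greedy rule once for each letter and each letter that may follow it
  (\<open>letters_ok\<close>). Strong induction then shows that the board of every column from column 13 on is the
  one listed for its letter (\<open>typed_and_on_track\<close>, whose step is \<open>on_track_Suc\<close>), and the two facts above
  are read off the boards.
\<close>

section \<open>The greedy rule and the upper queens\<close>

text \<open>Diagonals are compared by sums, which avoids truncated subtraction.\<close>

definition attacked :: "nat \<Rightarrow> nat \<Rightarrow> bool" where
  "attacked n y \<longleftrightarrow> (\<exists>i<n. y = queens i \<or> y + i = queens i + n \<or> y + n = queens i + i)"

lemma queens_eq_Least: "queens n = (LEAST y. \<not> attacked n y)"
proof -
  have "int y - int n \<noteq> int x - int i \<longleftrightarrow> y + i \<noteq> x + n" for x y i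
    by linarith
  then show ?thesis
    by (subst queens.simps) (simp add: attacked_def Ball_def)
qed

lemma not_attacked_queens: "\<not> attacked n (queens n)"
proof -
  \<comment> \<open>A row beyond the reach of every line through an earlier queen.\<close>
  define y where "y = Suc (n + (\<Sum>i<n. queens i + i))"
  have "queens i + i < y" if "i < n" for i
  proof -
    have "queens i + i \<le> (\<Sum>i<n. queens i + i)"
      using that by (intro member_le_sum) auto
    then show ?thesis unfolding y_def by simp
  qed
  moreover have "n + (queens i + i) < y" if "i < n" for i
    using member_le_sum[of i "{..<n}" "\<lambda>i. queens i + i"] that unfolding y_def by simp
  ultimately have "\<not> attacked n y"
    unfolding attacked_def by fastforce
  then show ?thesis
    unfolding queens_eq_Least by (rule LeastI)
qed

lemma attacked_below_queens: "y < queens n \<Longrightarrow> attacked n y"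
  unfolding queens_eq_Least using not_less_Least by blast

lemma queens_eqI: "\<not> attacked n y \<Longrightarrow> (\<And>z. z < y \<Longrightarrow> attacked n z) \<Longrightarrow> queens n = y"
  by (metis attacked_below_queens not_attacked_queens nat_neq_iff)

lemma upper_count_0 [simp]: "upper_count 0 = 0"
  by (simp add: upper_count_def)

lemma upper_count_Suc:
  "upper_count (Suc n) = upper_count n + (if queens (Suc n) > Suc n then 1 else 0)"
proof -
  have "{i \<in> {1..Suc n}. queens i > i} =
      (if queens (Suc n) > Suc n then insert (Suc n) {i \<in> {1..n}. queens i > i}
       else {i \<in> {1..n}. queens i > i})"
    by (auto simp: le_Suc_eq)
  then show ?thesis
    by (simp add: upper_count_def)
qed

lemma upper_count_mono: "m \<le> n \<Longrightarrow> upper_count m \<le> upper_count n"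
  by (rule lift_Suc_mono_le) (simp_all add: upper_count_Suc)

text \<open>The count grows in steps of one, so it takes every value up to the last. Hence every
  diagonal number up to \<open>U m\<close> is realised by an upper queen.\<close>

lemma upper_count_attained:
  assumes "1 \<le> d" "d \<le> upper_count m"
  obtains i where "1 \<le> i" "i \<le> m" "queens i > i" "upper_count i = d"
proof -
  have "\<exists>i. 1 \<le> i \<and> i \<le> m \<and> queens i > i \<and> upper_count i = d"
    using assms
  proof (induction m)
    case 0
    then show ?case by simp
  next
    case (Suc m)
    show ?case
    proof (cases "d \<le> upper_count m")
      case True
      then show ?thesis using Suc by (meson le_SucI)
    next
      case False
      then have "queens (Suc m) > Suc m" "upper_count (Suc m) = d"
        using Suc.prems by (auto simp: upper_count_Suc split: if_splits)
      then show ?thesis by (intro exI[of _ "Suc m"]) simp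
    qed
  qed
  then show ?thesis using that by blast
qed

text \<open>By induction the upper queens before column \<open>n\<close> occupy the diagonals \<open>1, \<dots>, v\<close> with
  \<open>v = U (n - 1)\<close>, and the queen of column 0 occupies diagonal 0. So rows \<open>n, \<dots>, n + v\<close> are
  attacked. Row \<open>n + v + 1\<close> is not: it lies above all earlier queens, on a new diagonal and on a new
  antidiagonal.\<close>

lemma queens_upper_or_lower:
  assumes "1 \<le> n"
  shows "queens n < n \<or> queens n > n \<and> queens n = n + upper_count n"
  using assms
proof (induction n rule: less_induct)
  case (less n)
  define v where "v = upper_count (n - 1)"
  have n: "n = Suc (n - 1)" using less.prems by simp
  have below: "queens i < i \<or> queens i = i + upper_count i" "upper_count i \<le> v"
    if "i < n" "1 \<le> i" for i
    using less.IH[OF that] upper_count_mono[of i "n - 1"] that unfolding v_def by auto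
  have "\<not> attacked n (n + v + 1)"
  proof
    assume "attacked n (n + v + 1)"
    then obtain i where i: "i < n" "n + v + 1 = queens i \<or> n + v + 1 + i = queens i + n \<or> n + v + 1 + n = queens i + i"
      unfolding attacked_def by blast
    show False
    proof (cases "i = 0")
      case True
      then show False using i by (auto simp: queens_0)
    next
      case False
      then show False using below[of i] i by auto
    qed
  qed
  then have "queens n \<le> n + v + 1"
    using attacked_below_queens not_le by blast
  moreover have "attacked n (n + d)" if "d \<le> v" for d
  proof (cases "d = 0")
    case True
    then show ?thesis unfolding attacked_def
      using less.prems by (intro exI[of _ 0]) (simp add: queens_0)
  next
    case False
    then have "1 \<le> d" "d \<le> upper_count (n - 1)" using that unfolding v_def by simp_all
    then obtain i where "1 \<le> i" "i \<le> n - 1" "queens i > i" "upper_count i = d"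
      by (rule upper_count_attained)
    then show ?thesis
      using less.IH[of i] less.prems unfolding attacked_def by (intro exI[of _ i]) auto
  qed
  then have "queens n \<noteq> n + d" if "d \<le> v" for d
    using that not_attacked_queens by metis
  then have "queens n < n \<or> queens n > n + v"
    by (metis le_add_diff_inverse linorder_not_less nat_add_left_cancel_le)
  ultimately consider "queens n < n" | "queens n = n + v + 1" by linarith
  then show ?case
  proof cases
    case 2
    then have "upper_count n = v + 1"
      using upper_count_Suc[of "n - 1"] n unfolding v_def by simp
    then show ?thesis using 2 by simp
  qed simp
qed

lemma queens_upper: "queens n > n \<Longrightarrow> queens n = n + upper_count n"
  using queens_upper_or_lower[of n] by (cases "n = 0") (auto simp: queens_0)

lemma queens_neq: "1 \<le> n \<Longrightarrow> queens n \<noteq> n"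
  using queens_upper_or_lower by fastforce

section \<open>Cells below the main diagonal\<close>

text \<open>Row, diagonal and antidiagonal of the lower queens in columns before \<open>n\<close>. For upper queens no
  such restriction is made: below the main diagonal, an upper queen can only attack columns to
  its right.\<close>

definition lower_row :: "nat \<Rightarrow> nat \<Rightarrow> bool" where
  "lower_row n y \<longleftrightarrow> (\<exists>i<n. queens i < i \<and> queens i = y)"

definition lower_diag :: "nat \<Rightarrow> nat \<Rightarrow> bool" where
  "lower_diag n d \<longleftrightarrow> (\<exists>i<n. queens i < i \<and> i - queens i = d)"

definition lower_anti :: "nat \<Rightarrow> nat \<Rightarrow> bool" where
  "lower_anti n s \<longleftrightarrow> (\<exists>i<n. queens i < i \<and> i + queens i = s)"

definition upper_row :: "nat \<Rightarrow> bool" where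
  "upper_row y \<longleftrightarrow> (\<exists>j. queens j > j \<and> queens j = y)"

definition upper_anti :: "nat \<Rightarrow> bool" where
  "upper_anti s \<longleftrightarrow> (\<exists>j. queens j > j \<and> j + queens j = s)"

lemma attacked_0: "0 < n \<Longrightarrow> attacked n 0"
  unfolding attacked_def by (intro exI[of _ 0]) (simp add: queens_0)

text \<open>The diagonals of upper queens stay above the main diagonal, so only their rows and antidiagonals
  matter here; the lines of the queen in column 0 contain no cell in question.\<close>

lemma attacked_iff:
  assumes "0 < y" "y < n"
  shows "attacked n y \<longleftrightarrow> lower_row n y \<or> upper_row y \<or> lower_diag n (n - y) \<or>
    lower_anti n (n + y) \<or> upper_anti (n + y)"
proof
  assume "attacked n y"
  then obtain i where i: "i < n" "y = queens i \<or> y + i = queens i + n \<or> y + n = queens i + i"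
    unfolding attacked_def by blast
  have "i \<noteq> 0"
  proof
    assume "i = 0"
    with i assms show False by (simp add: queens_0)
  qed
  then consider "queens i < i" | "queens i > i" using queens_neq[of i] by linarith
  then show "lower_row n y \<or> upper_row y \<or> lower_diag n (n - y) \<or>
    lower_anti n (n + y) \<or> upper_anti (n + y)"
  proof cases
    case 1
    from i(2) show ?thesis
    proof (elim disjE)
      assume "y = queens i"
      then have "lower_row n y" unfolding lower_row_def using 1 i(1) by blast
      then show ?thesis by blast
    next
      assume "y + i = queens i + n"
      then have "i - queens i = n - y" using 1 assms by linarith
      then have "lower_diag n (n - y)" unfolding lower_diag_def using 1 i(1) by blast
      then show ?thesis by blast
    next
      assume "y + n = queens i + i"
      then have "lower_anti n (n + y)" unfolding lower_anti_def using 1 i(1) by (metis add.commute)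
      then show ?thesis by blast
    qed
  next
    case 2
    from i(2) show ?thesis
    proof (elim disjE)
      assume "y = queens i"
      then show ?thesis unfolding upper_row_def using 2 by blast
    next
      assume "y + i = queens i + n"
      then show ?thesis using 2 assms by linarith
    next
      assume "y + n = queens i + i"
      then have "upper_anti (n + y)" unfolding upper_anti_def using 2 by (metis add.commute)
      then show ?thesis by blast
    qed
  qed
next
  have a: "attacked n y" if "i < n" "y = queens i \<or> y + i = queens i + n \<or> y + n = queens i + i" for i
    unfolding attacked_def using that by blast
  assume "lower_row n y \<or> upper_row y \<or> lower_diag n (n - y) \<or>
    lower_anti n (n + y) \<or> upper_anti (n + y)"
  then show "attacked n y"
  proof (elim disjE)
    assume "lower_row n y"
    then show ?thesis unfolding lower_row_def using a by blast
  next
    assume "upper_row y"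
    then show ?thesis unfolding upper_row_def using a assms by (metis less_trans)
  next
    assume "lower_diag n (n - y)"
    then obtain i where "i < n" "queens i < i" "i - queens i = n - y"
      unfolding lower_diag_def by blast
    then show ?thesis using a[of i] assms by linarith
  next
    assume "lower_anti n (n + y)"
    then show ?thesis unfolding lower_anti_def using a by (metis add.commute)
  next
    assume "upper_anti (n + y)"
    then obtain j where "queens j > j" "j + queens j = n + y"
      unfolding upper_anti_def by blast
    then show ?thesis using a[of j] assms by linarith
  qed
qed

lemma lower_row_Suc: "lower_row (Suc n) y \<longleftrightarrow> lower_row n y \<or> queens n < n \<and> queens n = y"
  unfolding lower_row_def by (auto simp: less_Suc_eq)

lemma lower_diag_Suc: "lower_diag (Suc n) d \<longleftrightarrow> lower_diag n d \<or> queens n < n \<and> n - queens n = d"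
  unfolding lower_diag_def by (auto simp: less_Suc_eq)

lemma lower_anti_Suc: "lower_anti (Suc n) s \<longleftrightarrow> lower_anti n s \<or> queens n < n \<and> n + queens n = s"
  unfolding lower_anti_def by (auto simp: less_Suc_eq)

lemma queens_gt_if_all_attacked:
  assumes "1 \<le> n" "\<And>y. y < n \<Longrightarrow> attacked n y"
  shows "queens n > n"
proof -
  have "\<not> queens n < n" using assms(2) not_attacked_queens by blast
  then show ?thesis using queens_neq[OF assms(1)] by linarith
qed

text \<open>Distinct lower queens lie on distinct diagonals, so counting diagonals counts lower queens.\<close>

lemma card_lower_diag: "card {d. lower_diag (Suc n) d} + upper_count n = n"
proof -
  let ?L = "{i \<in> {1..n}. queens i < i}"
  have "inj_on (\<lambda>i. i - queens i) ?L"
  proof (rule inj_onI)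
    fix i j assume ij: "i \<in> ?L" "j \<in> ?L" "i - queens i = j - queens j"
    have clash: False if "a < b" "queens b + a = queens a + b" for a b
      using that not_attacked_queens[of b] unfolding attacked_def by blast
    have "queens j + i = queens i + j" using ij by auto
    then show "i = j" using clash[of i j] clash[of j i] by (cases i j rule: linorder_cases) simp_all
  qed
  then have "card ((\<lambda>i. i - queens i) ` ?L) = card ?L" by (rule card_image)
  moreover have "{d. lower_diag (Suc n) d} = (\<lambda>i. i - queens i) ` ?L"
  proof -
    have "lower_diag (Suc n) d \<longleftrightarrow> (\<exists>i\<in>?L. i - queens i = d)" for d
    proof -
      have "i < Suc n \<and> queens i < i \<longleftrightarrow> i \<in> ?L" for i by auto
      then show ?thesis unfolding lower_diag_def by blast
    qed
    then have "d \<in> {d. lower_diag (Suc n) d} \<longleftrightarrow> d \<in> (\<lambda>i. i - queens i) ` ?L" for d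
      unfolding mem_Collect_eq image_iff by (simp only: eq_commute[of d])
    then show ?thesis by (rule set_eqI)
  qed
  moreover have "card ?L + upper_count n = n"
  proof -
    have "queens i < i \<or> queens i > i" if "i \<in> {1..n}" for i
      using queens_neq[of i] that by auto
    then have "{1..n} = ?L \<union> {i \<in> {1..n}. queens i > i}" by blast
    then have "card {1..n} = card (?L \<union> {i \<in> {1..n}. queens i > i})" by (rule arg_cong)
    also have "\<dots> = card ?L + upper_count n"
      unfolding upper_count_def by (subst card_Un_disjoint) auto
    finally show ?thesis by simp
  qed
  ultimately show ?thesis by simp
qed

section \<open>The parent of a row\<close>

text \<open>The last row of the block of column \<open>j\<close>. For an upper column this is the row of its queen.\<close>

definition row_end :: "nat \<Rightarrow> nat" where
  "row_end j = j + upper_count j"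

text \<open>For an upper column this is the antidiagonal of its queen; consecutive values differ by two or
  three, so the antidiagonals come in blocks like the rows.\<close>

definition anti_end :: "nat \<Rightarrow> nat" where
  "anti_end j = j + row_end j"

definition parent :: "nat \<Rightarrow> nat" where
  "parent n = (LEAST j. n \<le> row_end j)"

lemma row_end_0 [simp]: "row_end 0 = 0"
  by (simp add: row_end_def)

lemma row_end_Suc: "row_end (Suc j) = (if queens (Suc j) > Suc j then row_end j + 2 else row_end j + 1)"
  by (simp add: row_end_def upper_count_Suc)

lemma anti_end_Suc: "anti_end (Suc j) = (if queens (Suc j) > Suc j then anti_end j + 3 else anti_end j + 2)"
  by (simp add: anti_end_def row_end_Suc)

lemma row_end_less: "i < j \<Longrightarrow> row_end i < row_end j"
  using upper_count_mono[of i j] by (simp add: row_end_def)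

lemma anti_end_less: "i < j \<Longrightarrow> anti_end i < anti_end j"
  using row_end_less[of i j] by (simp add: anti_end_def)

lemma parent_bounds:
  assumes "1 \<le> n"
  shows "1 \<le> parent n" "n \<le> row_end (parent n)" "row_end (parent n - 1) < n"
proof -
  show le: "n \<le> row_end (parent n)"
    unfolding parent_def by (rule LeastI[of _ n]) (simp add: row_end_def)
  then show 1: "1 \<le> parent n"
    using assms by (cases "parent n") auto
  show "row_end (parent n - 1) < n"
    using not_less_Least[of "parent n - 1" "\<lambda>j. n \<le> row_end j"] 1
    unfolding parent_def[symmetric] by simp
qed

lemma parent_eqI:
  assumes "n \<le> row_end j" "row_end (j - 1) < n" "1 \<le> j"
  shows "parent n = j"
proof (rule antisym)
  have n: "1 \<le> n" using assms by simp
  show "parent n \<le> j"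
    unfolding parent_def using assms(1) by (rule Least_le)
  show "j \<le> parent n"
  proof (rule ccontr)
    assume "\<not> j \<le> parent n"
    then have "parent n = j - 1 \<or> parent n < j - 1" by linarith
    then have "row_end (parent n) \<le> row_end (j - 1)"
      using row_end_less[of "parent n" "j - 1"] by auto
    then show False using parent_bounds(2)[OF n] assms(2) by linarith
  qed
qed

lemma queens_1: "queens (Suc 0) = 2"
proof (rule queens_eqI)
  show "\<not> attacked (Suc 0) 2" by (simp add: attacked_def queens_0)
  show "attacked (Suc 0) z" if "z < 2" for z
    using that by (auto simp: attacked_def queens_0)
qed

lemma upper_count_1: "upper_count (Suc 0) = 1"
  using upper_count_Suc[of 0] by (simp add: queens_1)

text \<open>Column 1 is upper and so is the parent of rows 1 and 2. Its own row is the only fixed point.\<close>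

lemma parent_less: "2 \<le> n \<Longrightarrow> parent n < n"
proof -
  assume n: "2 \<le> n"
  have "1 \<le> upper_count (n - 1)" using upper_count_mono[of 1 "n - 1"] n by (simp add: upper_count_1)
  then have "n \<le> row_end (n - 1)" using n by (simp add: row_end_def)
  then have "parent n \<le> n - 1" unfolding parent_def by (rule Least_le)
  then show "parent n < n" using n by simp
qed

lemma parent_Suc:
  assumes "1 \<le> n"
  shows "parent (Suc n) = (if n < row_end (parent n) then parent n else Suc (parent n))"
proof -
  note p = parent_bounds[OF assms]
  show ?thesis
  proof (cases "n < row_end (parent n)")
    case True
    then show ?thesis using p by (intro trans[OF parent_eqI[of "Suc n" "parent n"]]) auto
  next
    case False
    then have "n = row_end (parent n)" using p by simp
    then show ?thesis
      using row_end_less[of "parent n" "Suc (parent n)"] False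
      by (intro trans[OF parent_eqI[of "Suc n" "Suc (parent n)"]]) auto
  qed
qed

lemma row_end_parent:
  assumes "1 \<le> n"
  shows "n = row_end (parent n) \<or> n + 1 = row_end (parent n) \<and> queens (parent n) > parent n"
proof -
  note p = parent_bounds[OF assms]
  have "row_end (parent n) = row_end (parent n - 1) + (if queens (parent n) > parent n then 2 else 1)"
    using row_end_Suc[of "parent n - 1"] p(1) by simp
  then show "n = row_end (parent n) \<or> n + 1 = row_end (parent n) \<and> queens (parent n) > parent n"
    using p by (auto split: if_splits)
qed

text \<open>The row taken by an upper queen is the second row of its block, so it is recognised from the
  parent of the row.\<close>

lemma upper_row_iff:
  assumes "1 \<le> n"
  shows "upper_row n \<longleftrightarrow> queens (parent n) > parent n \<and> n = row_end (parent n)"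
proof
  assume "upper_row n"
  then obtain j where j: "queens j > j" "queens j = n" unfolding upper_row_def by blast
  then have "1 \<le> j" by (cases "j = 0") (auto simp: queens_0)
  moreover have "n = row_end j" using queens_upper[OF j(1)] j(2) by (simp add: row_end_def)
  ultimately have "parent n = j" using row_end_less[of "j - 1" j] by (intro parent_eqI) auto
  then show "queens (parent n) > parent n \<and> n = row_end (parent n)" using j(1) \<open>n = row_end j\<close> by simp
next
  assume "queens (parent n) > parent n \<and> n = row_end (parent n)"
  then show "upper_row n" unfolding upper_row_def
    using queens_upper[of "parent n"] by (intro exI[of _ "parent n"]) (simp add: row_end_def)
qed

lemma upper_anti_iff:
  assumes "1 \<le> j" "anti_end (j - 1) < s" "s \<le> anti_end j"
  shows "upper_anti s \<longleftrightarrow> queens j > j \<and> s = anti_end j"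
proof -
  have "queens i > i \<Longrightarrow> i + queens i = anti_end i" for i
    using queens_upper[of i] by (simp add: anti_end_def row_end_def)
  moreover have "s = anti_end i \<Longrightarrow> i = j" for i
  proof -
    assume s: "s = anti_end i"
    show "i = j"
    proof (rule ccontr)
      assume "i \<noteq> j"
      then consider "i > j" | "i = j - 1" | "i < j - 1" by linarith
      then show False
        using anti_end_less[of j i] anti_end_less[of i "j - 1"] s assms by cases auto
    qed
  qed
  ultimately show ?thesis unfolding upper_anti_def by metis
qed

section \<open>The certificate\<close>

text \<open>A board describes how earlier lower queens attack eight cells of a column \<open>n\<close>, namely those in
  rows \<open>parent n - 3, \<dots>, parent n + 4\<close>: entry \<open>i\<close> of the three lists tells whether the cell in row
  \<open>parent n - 3 + i\<close> is attacked along its row, its diagonal, its antidiagonal.\<close>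

type_synonym board = "bool list \<times> bool list \<times> bool list"

abbreviation (input) "T \<equiv> True"
abbreviation (input) "F \<equiv> False"
abbreviation (input) Y :: "bool option" where "Y \<equiv> Some True"
abbreviation (input) N :: "bool option" where "N \<equiv> Some False"
abbreviation (input) Q :: "bool option" where "Q \<equiv> None"

definition boards :: "board list" where
  "boards = [
 ([F,F,F,T,F,T,F,T],[F,F,F,F,F,F,F,F],[F,F,F,F,F,F,F,F]),
 ([F,T,F,F,T,T,F,T],[F,F,F,F,F,F,F,F],[F,F,F,F,F,F,F,F]),
 ([F,F,T,T,T,T,F,T],[F,F,F,F,F,F,F,F],[F,F,F,F,F,F,F,F]),
 ([F,T,F,T,F,F,T,T],[F,F,F,T,F,F,F,F],[F,F,F,F,F,F,F,F]),
 ([F,T,F,T,F,T,F,F],[F,F,F,T,T,F,F,F],[F,F,T,F,F,F,F,F]),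
 ([T,F,T,F,F,F,F,F],[F,F,F,T,T,F,F,F],[T,F,F,F,F,F,F,F]),
 ([F,T,F,F,F,F,F,F],[F,F,F,T,T,F,F,F],[F,F,F,F,F,F,F,F]),
 ([F,T,F,F,F,F,F,F],[F,F,F,F,T,T,F,F],[F,F,F,F,F,F,F,F]),
 ([T,F,F,F,F,F,F,F],[F,F,F,F,T,T,F,F],[F,F,F,F,F,F,F,F]),
 ([T,F,T,F,F,F,F,F],[F,F,F,T,F,T,T,F],[F,T,F,F,F,F,F,F]),
 ([F,T,F,T,F,F,F,F],[F,F,F,T,T,T,T,F],[F,F,T,F,F,F,F,F]),
 ([F,T,F,T,F,F,F,F],[F,F,F,F,T,T,T,T],[F,T,F,F,F,F,F,F]),
 ([T,T,T,F,F,F,F,F],[F,F,T,F,T,T,T,T],[T,F,F,F,F,F,F,F]),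
 ([T,T,T,F,F,F,F,F],[F,F,F,T,F,T,T,T],[F,F,F,F,F,F,F,F]),
 ([T,T,F,T,F,F,F,F],[F,F,F,T,T,T,T,T],[F,F,T,F,F,F,F,F]),
 ([T,F,T,F,F,F,F,F],[F,F,F,T,T,T,T,T],[T,F,F,F,F,F,F,F]),
 ([F,T,F,F,F,F,F,F],[F,F,F,T,T,T,T,T],[F,F,F,F,F,F,F,F]),
 ([F,T,F,F,F,F,F,F],[F,F,F,F,T,T,T,T],[F,F,F,F,F,F,F,F]),
 ([T,F,F,F,F,F,F,F],[F,F,F,F,T,T,T,T],[F,F,F,F,F,F,F,F]),
 ([F,T,F,F,F,F,F,F],[F,F,T,F,T,T,T,T],[T,F,F,F,F,F,F,F]),
 ([F,T,F,T,F,F,F,F],[F,F,F,T,T,T,T,T],[F,F,T,F,F,F,F,F]),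
 ([T,F,T,F,F,F,F,F],[F,F,F,T,F,T,T,T],[F,T,F,F,F,F,F,F]),
 ([F,T,T,F,F,F,F,F],[F,F,F,T,T,T,T,T],[F,T,F,F,F,F,F,F]),
 ([T,T,F,F,F,F,F,F],[F,F,F,T,T,T,T,T],[F,F,F,F,F,F,F,F]),
 ([T,T,F,F,F,F,F,F],[F,F,F,F,T,T,T,T],[F,F,F,F,F,F,F,F]),
 ([F,T,F,F,F,F,F,F],[F,F,F,T,F,T,T,T],[F,F,F,F,F,F,F,F]),
 ([F,T,T,F,F,F,F,F],[F,F,F,T,T,F,T,T],[F,T,F,F,F,F,F,F]),
 ([T,T,F,F,F,F,F,F],[F,F,F,T,T,F,T,T],[F,F,F,F,F,F,F,F]),
 ([T,F,F,F,T,F,F,F],[F,F,F,T,T,T,T,T],[F,F,F,T,F,F,F,F]),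
 ([F,T,F,T,F,F,F,F],[F,F,T,T,T,T,T,T],[T,T,F,F,F,F,F,F]),
 ([F,T,F,T,F,F,F,F],[F,F,F,T,T,T,T,T],[T,F,F,F,F,F,F,F]),
 ([T,F,T,F,F,F,F,F],[F,F,F,T,T,T,T,T],[F,F,F,F,F,F,F,F]),
 ([T,F,T,F,F,F,F,F],[F,F,F,F,T,T,T,T],[F,F,F,F,F,F,F,F]),
 ([T,T,F,F,F,F,F,F],[F,F,T,F,T,T,T,T],[T,F,F,F,F,F,F,F]),
 ([T,T,F,F,F,F,F,F],[F,F,F,T,F,T,T,T],[F,F,F,F,F,F,F,F]),
 ([T,T,F,F,F,F,F,F],[F,F,T,T,F,T,T,T],[T,F,F,F,F,F,F,F]),
 ([T,F,T,F,T,F,F,F],[F,F,F,T,T,T,T,T],[F,T,T,F,F,F,F,F]),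
 ([T,F,T,F,F,F,F,F],[F,F,F,T,T,T,T,T],[F,T,F,F,F,F,F,F]),
 ([T,F,T,F,F,F,F,F],[F,F,F,F,T,T,T,T],[T,F,F,F,F,F,F,F]),
 ([T,T,T,F,F,F,F,F],[F,F,F,T,T,T,T,T],[F,T,F,F,F,F,F,F]),
 ([T,T,F,F,T,F,F,F],[F,F,F,T,T,T,T,T],[F,F,F,T,F,F,F,F]),
 ([T,F,F,T,F,F,F,F],[F,F,F,T,T,T,T,T],[F,T,F,F,F,F,F,F]),
 ([F,T,T,F,F,F,F,F],[F,F,T,T,T,T,T,T],[T,F,F,F,F,F,F,F]),
 ([F,T,T,F,F,F,F,F],[F,F,F,T,T,T,T,T],[F,F,F,F,F,F,F,F]),
 ([T,F,F,F,F,F,F,F],[F,F,F,T,T,T,T,T],[F,F,F,F,F,F,F,F]),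
 ([T,F,T,T,F,F,F,F],[F,F,F,T,T,T,T,T],[T,T,F,F,F,F,F,F]),
 ([F,T,T,F,F,F,F,F],[F,F,F,F,T,T,T,T],[F,F,F,F,F,F,F,F]),
 ([T,F,F,F,F,F,F,F],[F,F,T,T,F,T,T,T],[F,F,F,F,F,F,F,F]),
 ([T,F,F,F,F,F,F,F],[F,F,F,T,T,F,T,T],[F,F,F,F,F,F,F,F]),
 ([F,T,F,F,F,F,F,F],[F,F,T,T,T,F,T,T],[T,F,F,F,F,F,F,F]),
 ([F,T,F,F,F,T,F,F],[F,F,F,T,T,T,T,T],[F,F,F,F,T,F,F,F]),
 ([T,F,F,F,T,F,F,F],[F,F,F,T,T,T,T,T],[F,F,T,F,F,F,F,F]),
 ([T,F,F,F,T,F,F,F],[F,F,F,F,T,T,T,T],[F,T,F,F,F,F,F,F]),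
 ([F,T,F,T,F,F,F,F],[F,F,T,F,T,T,T,T],[T,F,F,F,F,F,F,F]),
 ([T,F,T,F,F,F,F,F],[F,F,T,F,T,T,T,T],[F,F,F,F,F,F,F,F]),
 ([T,F,T,F,F,F,F,F],[F,F,F,T,F,T,T,T],[F,F,F,F,F,F,F,F]),
 ([T,T,F,F,F,F,F,F],[F,T,F,F,T,T,T,T],[F,F,F,F,F,F,F,F]),
 ([T,T,F,T,F,F,F,F],[F,F,T,F,T,T,T,T],[F,F,T,F,F,F,F,F]),
 ([T,F,T,F,F,F,F,F],[F,F,T,F,T,T,T,T],[T,F,F,F,F,F,F,F]),
 ([T,T,F,F,F,F,F,F],[F,F,T,F,T,T,T,T],[F,F,F,F,F,F,F,F]),
 ([F,T,T,F,F,F,F,F],[F,F,F,T,F,T,T,T],[F,T,F,F,F,F,F,F]),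
 ([T,F,T,F,F,F,F,F],[F,F,T,T,T,T,T,T],[F,T,F,F,F,F,F,F]),
 ([T,T,T,F,F,F,F,F],[F,F,F,T,T,F,T,T],[F,T,F,F,F,F,F,F]),
 ([T,F,T,T,F,F,F,F],[F,F,F,T,T,T,T,T],[F,F,T,F,F,F,F,F]),
 ([F,T,T,F,F,F,F,F],[F,F,F,T,T,T,T,T],[T,F,F,F,F,F,F,F]),
 ([F,F,F,T,F,F,F,F],[F,F,F,T,T,T,T,T],[T,F,F,F,F,F,F,F]),
 ([F,T,T,F,F,F,F,F],[F,F,T,T,T,T,T,T],[F,T,F,F,F,F,F,F]),
 ([T,F,T,F,F,F,F,F],[F,F,F,T,T,T,F,T],[F,T,F,F,F,F,F,F]),
 ([F,T,F,F,F,F,F,F],[F,F,F,T,T,T,F,T],[F,F,F,F,F,F,F,F]),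
 ([F,T,T,F,F,F,F,F],[F,F,F,T,T,T,T,F],[F,T,F,F,F,F,F,F]),
 ([T,T,F,F,F,F,F,F],[F,F,F,T,T,T,T,F],[F,F,F,F,F,F,F,F]),
 ([T,F,F,F,F,F,T,F],[F,F,F,T,T,T,T,T],[F,F,F,F,F,T,F,F]),
 ([F,T,F,F,F,T,F,F],[F,F,T,T,T,T,T,T],[T,F,F,T,F,F,F,F]),
 ([F,T,F,F,F,T,F,F],[F,F,F,T,T,T,T,T],[F,F,T,F,F,F,F,F]),
 ([T,F,F,F,T,F,F,F],[F,F,F,T,T,T,T,T],[T,F,F,F,F,F,F,F]),
 ([T,F,T,F,T,F,F,F],[F,F,F,T,T,T,T,T],[F,T,F,F,F,F,F,F]),
 ([F,T,F,T,F,F,F,F],[F,F,F,T,T,T,T,T],[F,F,F,F,F,F,F,F]),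
 ([T,T,F,T,F,F,F,F],[F,T,F,F,T,T,T,T],[F,F,F,F,F,F,F,F]),
 ([T,F,T,F,F,F,F,F],[F,T,F,F,T,T,T,T],[F,F,F,F,F,F,F,F]),
 ([T,F,T,F,F,F,F,F],[F,F,T,F,F,T,T,T],[F,F,F,F,F,F,F,F]),
 ([F,T,F,T,F,F,F,F],[F,F,T,F,T,T,T,T],[F,F,T,F,F,F,F,F]),
 ([T,T,T,F,F,F,F,F],[F,F,F,T,F,T,T,T],[F,T,F,F,F,F,F,F]),
 ([F,T,F,F,F,F,F,F],[F,F,T,F,T,T,T,T],[F,F,F,F,F,F,F,F]),
 ([T,T,F,F,F,F,T,F],[F,F,F,T,T,T,T,T],[F,F,F,F,F,T,F,F]),
 ([T,F,F,F,F,T,F,F],[F,F,F,T,T,T,T,T],[F,F,F,T,F,F,F,F]),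
 ([T,F,T,F,F,T,F,F],[F,F,F,T,T,T,T,T],[F,T,T,F,F,F,F,F]),
 ([F,T,F,F,T,F,F,F],[F,F,F,T,T,T,T,T],[T,F,F,F,F,F,F,F]),
 ([T,F,F,T,F,F,F,F],[F,F,F,T,T,T,T,T],[F,F,F,F,F,F,F,F]),
 ([T,F,T,T,F,F,F,F],[F,F,F,T,T,T,T,T],[F,T,F,F,F,F,F,F]),
 ([T,F,F,T,F,F,F,F],[F,F,T,T,T,T,T,T],[F,F,T,F,F,F,F,F]),
 ([T,T,F,F,F,F,F,F],[F,F,T,T,T,T,F,T],[T,F,F,F,F,F,F,F]),
 ([T,T,F,F,F,F,F,F],[F,F,T,T,T,T,T,T],[T,F,F,F,F,F,F,F]),
 ([F,T,F,F,T,F,F,F],[F,F,T,T,T,T,T,T],[T,T,F,F,F,F,F,F]),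
 ([T,F,F,F,F,T,F,F],[F,F,F,T,T,T,T,T],[F,F,F,F,T,F,F,F]),
 ([F,T,F,F,T,F,F,F],[F,F,T,T,T,T,T,T],[T,F,T,F,F,F,F,F]),
 ([F,T,F,F,T,F,F,F],[F,F,F,T,T,T,T,T],[F,T,F,F,F,F,F,F]),
 ([T,T,F,T,F,F,F,F],[F,F,T,T,T,T,T,T],[T,F,F,F,F,F,F,F]),
 ([T,T,F,T,F,F,F,F],[F,F,F,T,T,T,T,T],[F,F,F,F,F,F,F,F]),
 ([T,F,T,F,F,F,T,F],[F,F,F,T,T,T,T,T],[F,T,F,F,T,F,F,F]),
 ([F,T,F,T,F,F,F,F],[F,F,T,T,T,T,T,T],[T,F,F,F,F,F,F,F]),
 ([T,F,F,F,F,F,F,F],[F,F,T,T,T,T,F,T],[F,F,F,F,F,F,F,F]),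
 ([T,F,T,F,F,F,F,F],[F,T,F,T,T,T,T,T],[F,T,F,F,F,F,F,F]),
 ([T,F,T,F,F,F,F,F],[F,F,T,T,T,T,T,T],[F,F,F,F,F,F,F,F]),
 ([T,T,F,F,T,F,F,F],[F,F,T,T,T,T,T,T],[T,F,T,F,F,F,F,F]),
 ([T,T,F,F,T,F,F,F],[F,F,F,T,T,T,T,T],[F,T,F,F,F,F,F,F]),
 ([T,F,F,F,F,F,F,F],[F,T,F,F,T,T,T,T],[F,F,F,F,F,F,F,F]),
 ([T,F,T,F,F,F,F,F],[F,F,T,T,F,T,T,T],[F,T,F,F,F,F,F,F]),
 ([F,T,F,T,F,F,F,F],[F,F,T,T,T,T,T,T],[F,F,T,F,F,F,F,F]),
 ([F,T,F,T,F,F,F,F],[F,F,F,T,T,T,T,T],[F,T,F,F,F,F,F,F]),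
 ([T,T,T,F,F,F,F,F],[F,F,T,T,T,T,T,T],[T,F,F,F,F,F,F,F]),
 ([T,T,T,F,F,F,F,F],[F,F,F,T,T,T,T,T],[F,F,F,F,F,F,F,F]),
 ([T,F,F,F,F,F,F,F],[F,F,F,T,T,T,F,T],[F,F,F,F,F,F,F,F]),
 ([T,F,T,F,F,F,F,F],[F,F,F,T,T,T,T,F],[F,T,F,F,F,F,F,F]),
 ([F,T,F,F,F,F,T,F],[F,F,F,T,T,T,T,T],[F,F,F,F,F,T,F,F]),
 ([F,T,T,F,F,F,T,F],[F,F,F,T,T,T,T,T],[F,T,F,F,T,F,F,F]),
 ([T,T,F,F,F,T,F,F],[F,F,F,T,T,T,T,T],[F,F,T,F,F,F,F,F]),
 ([F,F,F,T,F,F,F,F],[F,F,T,T,T,T,T,T],[F,F,T,F,F,F,F,F]),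
 ([T,F,T,F,F,F,F,F],[F,F,T,T,T,T,T,T],[T,F,F,F,F,F,F,F])]"

text \<open>A window records partial knowledge about the neighbours of a column \<open>n\<close>. Entry \<open>i\<close> of the first
  list says whether row \<open>n + i - 3\<close> belongs to an upper queen (its kind), entry \<open>i\<close> of the second list
  whether column \<open>n + i - 3\<close> is upper (its type), and \<open>Q\<close> makes no claim. Besides the claims about the
  column itself, only those are recorded that the checks below use, directly or through a neighbour.\<close>

definition windows :: "(bool option list \<times> bool option list) list" where
  "windows = [
 ([Q,Q,Q,N,Q,Q,Q,Q],[Q,Q,Q,Y,Q,Q,Q,Q]), ([Q,Q,Q,Y,Q,Q,Q,Q],[Q,Q,Q,Y,Q,Q,Q,Q]),
 ([Q,Q,Q,N,Q,Q,Q,Q],[Q,Q,Q,N,Q,Q,Q,Q]), ([Q,Q,Q,Y,Q,Q,Q,Q],[Q,Q,Q,N,Q,Q,Q,Q]),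
 ([Q,Q,Q,Y,N,Q,Q,Q],[Q,Q,Q,Y,N,Q,Q,Q]), ([Q,Q,Y,N,Q,Q,Q,Q],[Q,Q,Q,N,Q,Q,Q,Q]),
 ([Q,Y,Q,Y,Q,Q,Q,Q],[Q,Q,N,N,Q,Q,Q,Q]), ([Y,Q,Y,N,Q,Q,Q,Q],[Q,Q,Q,Y,Q,Q,Q,Q]),
 ([Q,Y,N,Y,Q,Q,Q,Q],[Q,Q,Q,N,Q,Q,Q,Q]), ([Q,Y,Q,Y,Q,Q,Q,Q],[Q,Q,Q,N,Q,Q,Q,Q]),
 ([Y,Q,Y,N,Q,Q,Q,Q],[Q,Q,N,Y,Q,Q,Q,Q]), ([Q,Y,N,N,N,Q,Q,Q],[Q,Q,Q,Y,Y,Q,Q,Q]),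
 ([Y,Q,N,N,Q,Q,Q,Q],[Q,Q,Q,Y,Q,Q,Q,Q]), ([Q,Y,Q,N,Q,Q,Q,Q],[Q,Q,Q,N,Q,Q,Q,Q]),
 ([Y,Q,N,Y,Q,Q,Q,Q],[Q,Q,N,Y,Q,Q,Q,Q]), ([Q,Q,Y,N,Q,Q,Q,Q],[Q,Q,Q,Y,Y,Q,Q,Q]),
 ([Q,Y,N,N,Y,Q,Q,Q],[Q,Q,Q,Y,Q,Q,Q,Q]), ([Y,Q,N,Y,Q,Y,Q,Q],[Q,Q,Q,Y,Q,Q,Q,Q]),
 ([Q,Q,Y,N,Y,N,Q,Q],[Q,Q,Q,N,N,Q,Q,Q]), ([Q,Y,N,Y,N,Q,Q,Q],[Q,Q,Q,N,Q,Q,Q,Q]),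
 ([Q,Y,Q,N,Q,Q,Q,Q],[Q,Q,Q,Y,Q,Q,Q,Q]), ([Y,Q,N,N,Q,Q,Q,Q],[Q,Q,Q,N,Q,Q,Q,Q]),
 ([Q,Q,N,Y,Q,Q,Q,Q],[Q,Q,Q,Y,Q,Q,Q,Q]), ([Q,Q,Y,N,Y,N,Q,Q],[Q,Q,Q,Y,Y,Q,Q,Q]),
 ([Q,Y,N,Y,N,Q,Q,Q],[Q,Q,Q,Y,Q,Q,Q,Q]), ([Y,Q,Y,N,Q,Q,Q,Q],[Q,Q,Q,N,Q,Q,Q,Q]),
 ([Q,Y,Q,Y,Q,Q,Q,Q],[Q,Q,N,Y,Q,Q,Q,Q]), ([Q,Y,Q,Y,Q,Q,Q,Q],[Q,Q,Q,Y,Q,Q,Q,Q]),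
 ([Y,Q,N,N,Q,Q,Q,Q],[Q,Q,N,Y,Q,Q,Q,Q]), ([Q,Q,Y,N,Q,Q,Q,Q],[Q,Q,Q,Y,Q,Q,Q,Q]),
 ([Y,Q,N,Y,Q,N,Q,Q],[Q,Q,Q,Y,N,Q,Q,Q]), ([Q,Q,Y,N,N,Q,Q,Q],[Q,Q,Q,N,Q,Q,Q,Q]),
 ([Q,Y,N,N,Q,Q,Q,Q],[Q,Q,N,N,Q,Q,Q,Q]), ([Y,Q,Q,Y,Q,Q,Q,Q],[Q,Q,N,Y,Q,Q,Q,Q]),
 ([Q,Y,N,Y,N,Q,Q,Q],[Q,Q,Q,Y,N,Q,Q,Q]), ([Q,Y,Q,N,Q,Q,Q,Q],[Q,Q,N,Y,Q,Q,Q,Q]),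
 ([Y,Q,N,Y,Q,Q,Q,Q],[Q,Q,Q,N,Q,Q,Q,Q]), ([Y,Q,Y,N,Q,Q,Q,Q],[Q,Q,N,N,Q,Q,Q,Q]),
 ([Q,Y,N,Y,Q,Q,Q,Q],[Q,Q,Q,Y,Q,Q,Q,Q]), ([Q,Y,N,N,Q,Q,Q,Q],[Q,Q,N,Y,Q,Q,Q,Q]),
 ([Y,Q,Q,Y,Q,Q,Q,Q],[Q,Q,Q,Y,N,Q,Q,Q]), ([Q,Q,Y,N,Y,Q,Q,Q],[Q,Q,Q,N,Q,Q,Q,Q]),
 ([Y,Q,Y,N,Q,N,Q,Q],[Q,Q,Q,Y,Y,Q,Q,Q]), ([Q,Y,Q,Y,N,Q,Q,Q],[Q,Q,Q,Y,N,Q,Q,Q]),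
 ([Q,Y,N,N,Q,Q,Q,Q],[Q,Q,Q,N,Q,Q,Q,Q]), ([Q,N,Q,Y,Q,Q,Q,Q],[Q,Q,Y,Y,Q,Q,Q,Q]),
 ([Q,Y,N,N,Y,Q,Q,Q],[Q,Q,Q,Y,Y,Q,Q,Q]), ([Q,Y,N,N,N,Q,Q,Q],[Q,Q,Q,Y,N,Q,Q,Q]),
 ([Q,N,Q,Y,Q,Q,Q,Q],[Q,Q,N,Y,Q,Q,Q,Q]), ([Y,Q,N,Y,Q,Q,Q,Q],[Q,Q,Q,Y,Q,Q,Q,Q]),
 ([Y,Q,N,Y,N,Q,Q,Q],[Q,Q,Q,Y,N,Q,Q,Q]), ([Y,Q,N,N,Y,Q,Q,Q],[Q,Q,Q,Y,Q,Q,Q,Q]),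
 ([Q,Q,N,Y,Q,N,Q,Q],[Q,Q,Q,Y,N,Q,Q,Q]), ([Q,Q,N,Y,Q,Y,Q,Q],[Q,Q,Q,Y,Q,Q,Q,Q]),
 ([Q,Q,Y,N,Y,N,Q,Q],[Q,Q,Q,N,Y,Q,Q,Q]), ([Q,Y,N,Y,N,Q,Q,Q],[Q,Q,N,Y,Q,Q,Q,Q]),
 ([Y,Q,Q,Y,Q,Q,Q,Q],[Q,Q,Q,Y,Q,Q,Q,Q]), ([Y,Q,Q,Y,Q,Q,Q,Q],[Q,Q,Q,N,Q,Q,Q,Q]),
 ([Q,Q,Y,N,Q,Q,Q,Q],[Q,Q,N,Y,Q,Q,Q,Q]), ([Q,Y,Q,N,Q,Q,Q,Q],[Q,Q,N,N,Q,Q,Q,Q]),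
 ([Q,Y,N,N,Y,Q,Q,Q],[Q,Q,Q,Y,N,Q,Q,Q]), ([Y,Q,Y,N,Q,N,Q,Q],[Q,Q,Q,Y,N,Q,Q,Q]),
 ([Y,N,Y,N,Q,Q,Q,Q],[Q,Q,N,Y,Q,Q,Q,Q]), ([Q,Q,Y,N,N,Y,Q,Q],[Q,Q,Q,Y,Q,Q,Q,Q]),
 ([Q,Y,N,N,Y,Q,N,Q],[Q,Q,Q,Y,Y,Q,Q,Q]), ([Y,Q,N,Y,Q,N,Q,Y],[Q,Q,Q,Y,Q,Q,Q,Q]),
 ([Q,Q,Y,N,N,Q,Y,N],[Q,Q,Q,N,N,Y,Q,Q]), ([Q,Y,N,N,Q,Y,N,Q],[Q,Q,Q,N,Y,Q,Q,Q]),
 ([Y,Q,N,N,Y,N,Q,Q],[Q,Q,N,Y,Q,Q,Q,Q]), ([Q,N,N,Y,N,Q,Q,Q],[Q,Q,Y,Y,Q,Q,Q,Q]),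
 ([N,Q,Y,N,Q,Q,Q,Q],[Q,Q,Y,Y,Q,Q,Q,Q]), ([Y,Q,Q,N,Q,Q,Q,Q],[Q,Q,Q,Y,Y,Q,Q,Q]),
 ([Q,Q,N,Y,N,Q,Q,Q],[Q,Q,Q,Y,N,Q,Q,Q]), ([Q,Y,Q,N,Q,Q,Q,Q],[Q,Q,Q,Y,N,Q,Q,Q]),
 ([Q,Y,N,N,Y,Q,Y,Q],[Q,Q,Q,Y,Q,Q,Q,Q]), ([Y,Q,N,Y,Q,Y,Q,N],[Q,Q,Q,Y,N,Y,Q,Q]),
 ([Q,Q,Y,N,Y,Q,N,Q],[Q,Q,Q,N,Y,Q,Q,Q]), ([Q,Y,N,Y,Q,N,Q,Q],[Q,Q,N,Y,Q,Q,Q,Q]),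
 ([Y,Q,Y,N,N,Q,Q,Q],[Q,Q,Q,N,Q,Q,Q,Q]), ([Y,Q,Q,N,Q,Q,Q,Q],[Q,Q,Q,Y,N,Q,Q,Q]),
 ([Q,Q,N,Y,Q,Q,Q,Q],[Q,Q,Q,N,Q,Q,Q,Q]), ([Q,Q,Y,N,N,Q,Q,Q],[Q,Q,Q,N,Y,Q,Q,Q]),
 ([Q,Y,N,N,Q,Q,Q,Q],[Q,Q,Q,Y,Q,Q,Q,Q]), ([Y,Q,N,N,Y,Q,Q,Q],[Q,Q,Q,Y,Y,Q,Q,Q]),
 ([Q,Y,N,Y,Q,Q,Q,Q],[Q,Q,N,Y,Q,Q,Q,Q]), ([Y,Q,Y,N,Q,Q,Q,Q],[Q,Q,Q,Y,Y,Q,Q,Q]),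
 ([Y,Q,Q,N,Q,Q,Q,Q],[Q,Q,Q,Y,Q,Q,Q,Q]), ([Q,Y,N,N,Y,Q,Q,Q],[Q,Q,Q,N,Q,Q,Q,Q]),
 ([Q,Q,Y,N,Y,Q,N,Q],[Q,Q,Q,Y,Y,Q,Q,Q]), ([Q,Y,N,Y,Q,N,Q,Q],[Q,Q,Q,Y,Q,Q,Q,Q]),
 ([Y,Q,Q,N,Q,Q,Q,Q],[Q,Q,N,Y,Q,Q,Q,Q]), ([Y,Q,N,Y,Q,Y,Q,N],[Q,Q,Q,Y,N,N,Q,Q]),
 ([Q,Q,Y,N,Y,Q,N,Q],[Q,Q,Q,N,N,Q,Q,Q]), ([Q,Y,N,Y,Q,N,Q,Q],[Q,Q,N,N,Q,Q,Q,Q]),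
 ([Y,Q,Y,N,N,Q,Q,Q],[Q,Q,N,Y,Q,Q,Q,Q]), ([Y,Q,Y,N,Q,Y,N,Q],[Q,Q,Q,Y,N,Y,Q,Q]),
 ([Q,Y,N,N,Y,N,Q,Q],[Q,Q,Q,N,Y,Q,Q,Q]), ([Y,Q,N,Y,N,Q,Q,Q],[Q,Q,Q,Y,Q,Q,Q,Q]),
 ([Y,Q,Q,N,Q,Q,Q,Q],[Q,Q,Q,N,Q,Q,Q,Q]), ([Q,Q,Y,N,Y,Q,Y,N],[Q,Q,Q,Y,Y,N,Q,Q]),
 ([Q,Y,N,Y,Q,Y,N,Q],[Q,Q,Q,Y,N,Q,Q,Q]), ([Y,Q,Y,N,Y,N,Q,Q],[Q,Q,Q,N,Q,Q,Q,Q]),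
 ([Q,Y,N,Y,N,Q,Q,Q],[Q,Q,N,N,Q,Q,Q,Q]), ([Q,Q,Y,N,Y,Q,Y,Q],[Q,Q,Q,N,Q,Q,Q,Q]),
 ([Q,Y,N,Y,Q,Y,N,Q],[Q,Q,Q,Y,Y,Q,Q,Q]), ([Y,Q,Y,N,Y,N,Q,Q],[Q,Q,Q,Y,Q,Q,Q,Q]),
 ([Q,Q,N,Y,Q,Q,Q,Q],[Q,Q,N,Y,Q,Q,Q,Q]), ([Y,Q,Y,N,Q,Q,Q,Q],[Q,Q,Q,Y,N,Q,Q,Q]),
 ([Q,Y,Q,N,Q,Q,Q,Q],[Q,Q,Q,Y,Y,Q,Q,Q]), ([Q,Q,Y,N,Y,N,Q,Q],[Q,Q,Q,Y,N,Q,Q,Q]),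
 ([Y,Q,N,Y,N,Q,Q,Q],[Q,Q,N,Y,Q,Q,Q,Q]), ([Y,Q,N,Y,Q,Q,Q,Q],[Q,Q,N,N,Q,Q,Q,Q]),
 ([Q,Q,Y,N,Q,Q,Q,Q],[Q,Q,Q,Y,N,Q,Q,Q]), ([Y,Q,N,Y,Q,N,Q,Q],[Q,Q,Q,Y,Y,Q,Q,Q]),
 ([Q,Q,Y,N,N,Q,Q,Q],[Q,Q,Q,Y,Q,Q,Q,Q]), ([Y,Q,N,Y,Q,N,Q,N],[Q,Q,Q,Y,N,N,Q,Q]),
 ([Q,Q,Y,N,N,Q,N,Q],[Q,Q,Q,N,N,Q,Q,Q]), ([Q,Y,N,N,Q,N,Q,Q],[Q,Q,N,N,Q,Q,Q,Q]),
 ([Q,Q,Y,N,Q,Q,Q,Q],[Q,Q,Y,Y,Q,Q,Q,Q]), ([Q,Q,N,N,Q,Q,Q,Q],[Q,Q,Q,Y,Q,Q,Q,Q]),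
 ([Q,Q,Y,N,Q,Q,Q,Q],[Q,Q,N,Y,Y,Q,Q,Q]), ([Q,N,Q,Y,Q,Q,Q,Q],[Q,Q,Y,N,Q,Q,Q,Q]),
 ([N,Q,Y,N,Q,Q,Q,Q],[Q,Q,N,Y,Q,Q,Q,Q]), ([Q,Y,N,Y,N,Q,Q,Q],[Q,Q,Q,Y,Y,Q,Q,Q]),
 ([Q,Q,Y,N,N,N,Q,Q],[Q,Q,Q,Y,Y,Q,Q,Q]), ([Q,Y,N,N,N,Q,Q,Q],[Q,Q,Q,Y,Q,Q,Q,Q]),
 ([Q,Q,Q,Y,Q,Q,Q,Q],[Q,Q,N,Y,Q,Q,Q,Q]), ([Y,Q,Y,N,Q,Y,N,Q],[Q,Q,Q,Y,Y,Q,Q,Q]),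
 ([Q,Y,N,N,Y,N,Q,N],[Q,Q,Q,Y,Y,N,Q,Q]), ([Y,Q,N,Y,N,Q,N,Q],[Q,Q,Q,Y,N,Q,Q,Q]),
 ([Q,Q,Y,N,Q,N,Q,Q],[Q,Q,Q,N,Q,Q,Q,Q]), ([Q,Y,N,Y,N,Q,Q,Q],[Q,Q,Q,N,Y,Q,Q,Q]),
 ([Y,Q,N,N,Q,Q,Q,Q],[Q,Q,N,N,Q,Q,Q,Q]), ([Y,Q,N,N,N,Q,Q,Q],[Q,Q,Q,Y,N,Q,Q,Q]),
 ([Q,Q,N,N,Q,Q,Q,Q],[Q,Q,Q,N,Q,Q,Q,Q])]"

hide_const (open) T F Y N Q

text \<open>The row of a letter consists of its board, its window, its children, and the letters that may occur in the
  next column. Two columns have the same letter if their boards, kinds and types agree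
  and those of all their descendants agree as well; a few of these classes are split further so that
  the claims needed are the same for all columns of a class. Letters 0 to 6 belong to columns 1 to 7 alone,
  which are not parents of any column from 13 on.\<close>

type_synonym letter_row = "nat \<times> nat \<times> nat list \<times> nat list"

definition letters0 :: "letter_row list" where
  "letters0 = [
 (0,0,[0,1],[1]), (1,1,[2,3],[2]), (2,2,[4],[3]), (3,3,[5],[4]), (4,0,[6,7],[5]), (5,0,[8,9],[6]),
 (6,0,[10,11],[7]), (7,4,[12,13],[8]), (8,5,[14],[9]), (9,6,[15],[10]), (10,7,[16,17],[11]),
 (11,8,[18],[12]), (12,7,[19,20],[13]), (13,9,[21],[14]), (14,10,[22,23],[15,555,1255]),
 (15,11,[24,25],[16]), (16,12,[26,27],[17]), (17,4,[28,29],[18]), (18,5,[30],[19,630,998,1277]),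
 (19,13,[31],[20]), (20,14,[32,33],[21]), (15,15,[34,35],[22]), (16,16,[36,37],[23]),
 (17,17,[38,39],[24,746]), (18,18,[40],[25]), (21,19,[41],[26]), (20,10,[42,43],[27,376,421]),
 (11,9,[44],[28]), (12,10,[45,46],[29]), (13,8,[47],[30]), (14,7,[48,49],[31]),
 (15,20,[50,51],[32,836,1448]), (16,21,[52],[33]), (22,22,[53,54],[34,324]), (23,23,[55,56],[35]),
 (24,24,[57,58],[36]), (18,25,[59],[37,332,1441,1447]), (21,26,[60,61],[38]),
 (25,25,[62],[39,1190]), (26,27,[63,64],[40]), (27,25,[65],[41]), (28,13,[66],[42,972]),
 (29,28,[67,68],[43]), (30,22,[69,70],[44]), (31,29,[71,72],[45,551,605]), (16,16,[73,74],[46]),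
 (17,30,[75,76],[47]), (18,31,[77],[48]), (19,32,[78],[49]), (20,33,[79,80],[50]),
 (15,29,[81,82],[51,92]), (32,34,[83,84],[52]), (17,25,[85],[53,178,618,702,1062,1657]),
 (33,35,[86,87],[54]), (34,36,[88],[55]), (35,29,[89,90],[56,479,758]), (27,9,[91],[57]),
 (28,37,[92],[58]), (36,38,[93,94],[59]), (30,7,[95,96],[60,490,1578]), (31,16,[97,98],[61,680]),
 (32,30,[99,100],[62]), (17,31,[101],[63,666]), (37,39,[102,103],[64,1374]),
 (38,40,[104,105],[65]), (17,5,[106],[66]), (37,20,[107,108],[67]), (16,21,[109],[68]),
 (22,22,[110,111],[69,341]), (23,41,[112],[70]), (39,24,[113,114],[71]), (23,42,[115,116],[72]),
 (24,24,[117,118],[73]), (18,25,[119],[74,326,805]), (21,43,[120,121],[75]),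
 (25,25,[122],[76,269]), (26,9,[123],[77]), (40,10,[124,125],[78]), (41,44,[126],[79]),
 (42,12,[127,128],[80]), (43,45,[129,130],[81]), (23,29,[131,132],[82]), (24,43,[133,134],[83]),
 (18,25,[135],[84,1319,1383]), (21,9,[136],[85,148]), (20,10,[137,138],[86,279,1275]),
 (15,46,[139,140],[87,556]), (32,30,[141,142],[88]), (17,31,[143],[89,741,1327]),
 (33,32,[144],[90,1587]), (14,33,[145,146],[91]), (15,29,[147,82],[51,92,1111]),
 (16,47,[83,84],[93]), (44,21,[148],[94]), (37,48,[149,150],[95]), (16,29,[151,152],[96,1806]),
 (17,27,[153,154],[97]), (18,25,[155],[98,669,1039]), (21,27,[156,157],[99]),
 (25,25,[158],[100,896])]"

definition letters1 :: "letter_row list" where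
  "letters1 = [
 (26,9,[159],[101]), (40,10,[160,161],[102]), (41,44,[162],[103,879]), (45,49,[163,164],[104]),
 (43,23,[165,166],[105]), (46,24,[167,168],[106]), (24,25,[169],[107,1526]),
 (37,35,[170,171],[108]), (38,50,[172,173],[109]), (17,5,[174],[110]), (33,20,[175,176],[111]),
 (34,36,[177],[112]), (35,29,[178,179],[113,501]), (47,20,[180,181],[114]), (48,36,[182],[115]),
 (49,5,[178],[116]), (50,26,[183,184],[117]), (51,7,[185,186],[118]), (52,8,[187],[119]),
 (53,7,[188,189],[120,638]), (54,20,[190,191],[121,481]), (55,36,[192],[122]),
 (20,29,[193,194],[123]), (15,20,[195,191],[124,403]), (16,51,[192,196],[125,1049]),
 (17,52,[197,198],[126]), (18,31,[199],[127,234]), (19,32,[200],[128]), (20,33,[201,202],[129]),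
 (15,29,[203,204],[130,700,858,1721,1783]), (32,8,[205],[131]), (56,25,[206],[132,987]),
 (57,26,[207,208],[133]), (58,7,[209,210],[134]), (55,8,[211],[135]), (20,7,[212,213],[136]),
 (15,20,[214,215],[137,1479,1536]), (16,51,[216,217],[138,233]), (17,53,[218,219],[139,418]),
 (18,54,[220],[140]), (21,24,[221,222],[141]), (25,25,[223],[142,748]), (26,6,[224],[143]),
 (40,7,[225,226],[144]), (41,44,[227],[145,968]), (42,12,[228,229],[146]),
 (43,45,[180,230],[147,949]), (23,29,[231,232],[82]), (20,10,[137,233],[149]),
 (15,44,[126],[150]), (12,49,[234,235],[151]), (59,41,[236],[152]), (14,55,[237,238],[153,1858]),
 (15,42,[239,240],[154]), (32,24,[241,242],[155]), (17,25,[243],[156]),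
 (37,20,[244,245],[157,882,1257]), (38,56,[246,247],[158]), (17,5,[248],[159]),
 (37,20,[249,250],[160,768]), (16,51,[251,252],[161,1823]), (17,52,[253,254],[162]),
 (18,31,[255],[163,1109]), (19,39,[256,257],[164]), (25,57,[258],[165,777]),
 (35,58,[259,260],[166]), (27,8,[261],[167]), (28,25,[262],[168]), (36,27,[263,264],[169]),
 (30,7,[265,266],[170,1181]), (31,16,[267,268],[171,1503]), (32,17,[75,269],[172]),
 (17,18,[270],[173]), (60,19,[271],[174]), (14,10,[272,273],[175]), (15,20,[274,275],[176]),
 (32,50,[276,277],[177]), (17,5,[278],[178]), (33,59,[279],[179,183]), (14,49,[280,281],[180]),
 (15,29,[282,283],[181,230,507,684,1050]), (32,34,[284,285],[182]),
 (17,25,[286],[53,178,618,702,1062]), (61,12,[280,281],[184]), (15,22,[287,288],[185]),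
 (16,29,[289,290],[186]), (17,34,[291,292],[187]), (18,25,[293],[188,292,1571]),
 (19,59,[294],[189]), (20,49,[295,296],[190]), (15,29,[297,298],[191,316,848,885,1802]),
 (32,34,[299,300],[192]), (17,25,[301],[193,196,590,664]), (33,59,[302],[194]),
 (14,49,[303,304],[195]), (15,29,[305,306],[191]), (60,26,[307,308],[197]),
 (34,25,[309],[198,219]), (62,9,[310],[199]), (40,7,[311,312],[200])]"

definition letters2 :: "letter_row list" where
  "letters2 = [
 (41,44,[313],[201,351]), (42,12,[314,315],[202]), (43,45,[190,316],[203,717]),
 (23,29,[317,318],[204]), (24,43,[319,320],[205]), (18,25,[321],[206,917,1791,1838]),
 (19,13,[322],[207,1906]), (61,28,[323,33],[208]), (15,22,[324,325],[209,1208]),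
 (16,29,[71,72],[210,929]), (17,34,[73,326],[211]), (18,25,[327],[212]), (19,13,[328],[213]),
 (20,14,[329,330],[214]), (15,15,[331,35],[215]), (32,34,[36,332],[216]),
 (17,25,[333],[217,941,1607,1648]), (60,26,[334,335],[218]), (34,25,[336],[198,219]),
 (62,27,[310,337],[220]), (27,25,[338],[221]), (28,13,[339],[222,550]), (36,14,[340,68],[223]),
 (30,15,[341,342],[224,973]), (31,11,[36,332],[225]), (16,12,[333,343],[226]),
 (17,4,[344,345],[227]), (18,5,[346],[228,793,834,1189]), (19,59,[347],[229]),
 (20,49,[348,281],[180]), (32,8,[284],[231]), (56,25,[349],[232,1169]), (57,26,[350,208],[133]),
 (17,52,[218,198],[126]), (19,39,[200,351],[235,1561]), (25,57,[352],[236,707,1177]),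
 (35,58,[353,354],[237]), (47,60,[355,356],[238]), (48,36,[357],[239,779]), (49,41,[358],[240]),
 (50,24,[359,360],[241]), (51,61,[361,362],[242]), (52,19,[363],[243]),
 (53,62,[364,365],[244,596]), (54,13,[366],[245]), (63,56,[367,368],[246]),
 (64,29,[369,370],[247,1433,1487]), (46,34,[291,292],[248]), (24,25,[293],[249,1114]),
 (37,35,[371,372],[250,942]), (38,50,[373,374],[251]), (17,5,[375],[252,914,994,1341,1538]),
 (60,27,[376,377],[253]), (34,25,[378],[254,1865]), (62,9,[379],[255]), (40,10,[380,381],[256]),
 (41,44,[382],[257,1317]), (45,49,[383,384],[258]), (43,63,[385,386],[259,1003]),
 (23,64,[387,388],[260]), (24,65,[389,390],[261]), (18,66,[391],[262]), (19,67,[392],[263]),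
 (61,68,[393,394],[264]), (15,69,[395,396],[265]), (16,70,[397,398],[266]),
 (17,43,[399,400],[267]), (18,25,[401],[268,1366]), (21,43,[402,121],[75]),
 (26,27,[123,403],[270]), (27,25,[404],[271]), (28,13,[405],[272]), (29,28,[406,407],[273]),
 (30,22,[408,409],[274]), (31,29,[410,411],[275,1130,1297]), (32,34,[412,413],[276]),
 (17,25,[414],[277]), (60,9,[415],[278]), (14,10,[416,417],[279]), (15,47,[418,419],[280]),
 (16,21,[420],[281]), (22,48,[421,422],[282,287]), (23,29,[423,424],[283]),
 (24,27,[425,426],[284]), (18,25,[427],[285,349,691]), (21,9,[428],[286,901]),
 (20,10,[429,430],[86,279,1275]), (23,5,[423],[288]), (39,26,[431,432],[289]),
 (23,7,[433,434],[290]), (24,34,[435,436],[291]), (18,25,[437],[292,461,1571]),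
 (21,6,[438],[293]), (20,7,[439,440],[294,371,438,455,1021]), (15,47,[441,442],[295]),
 (16,21,[443],[296]), (22,48,[444,445],[297]), (23,29,[446,447],[298]), (24,27,[448,449],[299]),
 (18,25,[450],[300,472,1074,1116])]"

definition letters3 :: "letter_row list" where
  "letters3 = [
 (21,9,[451],[301]), (20,7,[452,453],[302,307,790,1294,1855]), (15,47,[454,292],[303]),
 (16,21,[293],[304]), (22,48,[455,456],[305,1070]), (23,29,[457,458],[306]),
 (24,27,[459,460],[299]), (15,16,[454,461],[308]), (32,30,[462,463],[309]),
 (17,31,[199],[310,698]), (37,39,[200,351],[311,337]), (16,71,[464,465],[312]),
 (17,72,[466,467],[313]), (18,5,[468],[314,513]), (19,59,[469],[315,1261]),
 (20,49,[470,471],[190]), (32,8,[299],[317]), (56,25,[472],[318,936]), (57,26,[473,474],[319]),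
 (58,7,[475,476],[320]), (55,8,[477],[321]), (20,7,[478,229],[322]),
 (15,20,[180,181],[323,1139,1842]), (16,21,[182],[33]), (23,41,[55],[325]),
 (39,24,[479,480],[71,1238]), (21,9,[120],[327]), (20,10,[481,482],[328,743,1367]),
 (15,73,[483,484],[329]), (16,21,[485],[330]), (22,22,[486,487],[331]), (23,23,[488,489],[35]),
 (21,6,[490],[333]), (20,7,[491,492],[334,343,469,855,1473]), (15,16,[493,494],[335,1164]),
 (32,30,[495,496],[336]), (17,31,[497],[310,594,698]), (38,40,[464,465],[338]),
 (17,5,[466],[339]), (37,20,[498,499],[340]), (16,21,[500],[68]), (23,23,[112,501],[342]),
 (24,24,[502,503],[36]), (11,8,[493],[344]), (12,7,[504,505],[345]), (13,9,[506],[346]),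
 (14,10,[507,508],[347,1024,1061]), (15,47,[509,510],[348]), (16,21,[511],[281]),
 (19,13,[428],[350,1264]), (61,28,[512,33],[208]), (45,49,[513,514],[352,464,1663]),
 (43,63,[515,516],[353,1361]), (23,74,[517,518],[354,566]), (24,75,[519,520],[355]),
 (18,76,[521],[356]), (21,77,[522,523],[357]), (25,78,[524],[358,1007]), (35,39,[525,526],[359]),
 (47,79,[527,528],[360]), (48,80,[529],[361]), (49,5,[530],[362]), (50,27,[531,532],[363]),
 (51,7,[533,534],[364]), (65,44,[535],[365]), (53,49,[536,537],[366,795]), (54,81,[538],[367]),
 (66,82,[539,540],[368]), (64,56,[541,542],[369]), (23,29,[543,544],[370]),
 (24,34,[545,546],[291]), (15,16,[441,547],[372,593]), (32,17,[548,549],[373,1165]),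
 (17,18,[220],[374]), (60,19,[221],[375]), (14,10,[550,43],[376]),
 (15,20,[44,551],[377,1216,1649]), (32,50,[552,553],[378]), (17,5,[554],[379,1037,1138]),
 (37,35,[555,556],[380,703]), (16,83,[557,558],[381]), (17,52,[559,560],[382]),
 (18,31,[561],[383,1477]), (19,39,[562,563],[384]), (25,57,[564],[385]), (35,58,[565,566],[386]),
 (27,34,[567,568],[387]), (48,25,[569],[388,708,1403]), (67,27,[570,571],[389]),
 (68,25,[572],[390,1222]), (69,27,[573,574],[391]), (70,25,[575],[392]), (71,13,[576],[393]),
 (72,28,[577,578],[394]), (73,22,[579,580],[395]), (74,5,[581],[396]), (75,38,[582,583],[397]),
 (76,25,[584],[398]), (77,38,[585,586],[399]), (78,7,[587,588],[400])]"

definition letters4 :: "letter_row list" where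
  "letters4 = [
 (79,8,[589],[401]), (80,7,[314,315],[402]), (58,20,[190,191],[121,481]), (32,50,[192,590],[404]),
 (17,5,[591],[405,1316]), (37,35,[592,593],[406]), (16,21,[336],[407]),
 (22,22,[594,595],[408,1452]), (23,41,[236],[409]), (39,55,[237,238],[410,581]),
 (23,42,[239,240],[411]), (24,24,[241,242],[412]), (18,25,[243],[413,1331,1458]),
 (21,9,[596],[414]), (20,7,[597,598],[415]), (15,20,[599,600],[416]), (16,51,[601,602],[417]),
 (17,53,[603,604],[418]), (18,18,[220],[419]), (21,19,[221],[420]), (20,10,[550,43],[27,376,421]),
 (15,13,[44],[422]), (12,14,[605,606],[423]), (59,5,[607],[424,431]), (14,84,[608,609],[425]),
 (15,85,[610,611],[426]), (32,34,[612,613],[427]), (17,25,[614],[428]),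
 (37,20,[615,616],[429,512,910]), (16,51,[617,618],[430,1128]), (17,53,[619,620],[139,418]),
 (61,39,[608,609],[432]), (15,49,[621,622],[433]), (16,15,[623,624],[434]),
 (17,34,[625,626],[435]), (18,25,[627],[436]), (21,6,[628],[437]), (20,7,[629,440],[371,438]),
 (15,11,[441,442],[439]), (16,12,[443,11],[440]), (17,4,[12,13],[441]),
 (18,5,[14],[442,547,645,1244]), (21,6,[15],[443]), (20,7,[16,17],[11,444]), (15,44,[18],[445]),
 (12,49,[630,631],[446]), (59,41,[632],[447]), (14,24,[633,634],[448]), (15,42,[635,636],[449]),
 (32,24,[637,118],[450]), (17,25,[119],[451]), (37,20,[638,639],[452,654,1284]),
 (16,86,[640,641],[453]), (17,72,[642,643],[454]), (18,5,[644],[188,292,461,1571]),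
 (15,44,[441],[456]), (12,49,[645,646],[457,1279]), (59,41,[55],[458]), (14,24,[479,480],[459]),
 (15,42,[115,116],[460]), (32,24,[117,118],[450]), (21,26,[371,593],[462]),
 (25,25,[336],[463,1614]), (26,9,[310],[199]), (43,23,[515,647],[465]), (46,24,[648,649],[466]),
 (24,25,[59],[467,498]), (81,6,[490],[468]), (14,7,[491,492],[334,469]), (15,47,[493,650],[470]),
 (16,21,[651],[471]), (22,48,[652,653],[297,1437]), (19,13,[451],[473,1314]),
 (61,12,[654,655],[474]), (15,22,[656,657],[475,1157]), (16,29,[658,659],[476]),
 (17,34,[660,661],[477]), (18,25,[662],[478,967]), (19,59,[663],[229]), (47,20,[91,51],[480]),
 (48,36,[52],[115,1025]), (82,21,[192],[482]), (20,22,[664,665],[483,1514]),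
 (15,23,[515,647],[484]), (32,24,[648,649],[485]), (17,25,[59],[486,969,1654]),
 (33,35,[60,61],[487]), (34,36,[62],[488]), (35,29,[666,667],[489,1094,1911]), (27,9,[668],[57]),
 (31,11,[97,669],[491]), (16,12,[670,671],[492]), (17,4,[672,673],[493]),
 (18,5,[674],[494,504,650,1604]), (21,26,[675,676],[495]), (25,25,[677],[496,1357]),
 (26,9,[678],[497]), (40,7,[679,312],[200]), (37,35,[60,680],[499]), (38,50,[681,682],[500])]"

definition letters5 :: "letter_row list" where
  "letters5 = [
 (17,5,[683],[110]), (27,9,[180],[502]), (28,37,[684],[503]), (36,38,[685,686],[59]),
 (19,59,[687],[505]), (20,49,[688,689],[506]), (15,29,[690,283],[507]), (16,16,[284,691],[508]),
 (17,17,[692,693],[509,1246]), (18,18,[694],[510]), (21,19,[695],[511]),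
 (20,10,[696,697],[27,421]), (16,21,[617],[33]), (19,35,[334,335],[514]),
 (25,36,[336],[515,1753]), (35,29,[698,699],[516,647,1608,1893]), (27,27,[129,700],[517]),
 (48,25,[701],[518,1095]), (67,27,[702,703],[519]), (68,25,[704],[520,1509]), (69,9,[705],[521]),
 (83,10,[706,233],[522]), (84,44,[126],[523,760]), (85,49,[234,235],[524]),
 (86,63,[707,386],[525]), (87,87,[387],[526,1225]), (88,17,[708,709],[527]),
 (43,88,[710,711],[528]), (46,89,[712,713],[529]), (24,78,[714],[530]), (33,32,[715],[531]),
 (61,90,[716,202],[532]), (15,22,[717,718],[533,1821]), (16,29,[719,720],[534]),
 (17,34,[721,722],[535]), (18,25,[723],[536,1349,1718]), (19,35,[724,725],[537]),
 (25,36,[726],[538,1020]), (35,5,[727],[539]), (89,20,[728,729],[540]), (41,36,[730],[541]),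
 (42,58,[731,732],[542]), (43,38,[733,734],[543]), (23,7,[735,736],[544]),
 (24,34,[737,738],[545]), (18,25,[739],[546]), (21,6,[740],[437]), (21,26,[555,87],[548]),
 (25,25,[88],[549,794]), (26,27,[741,742],[220]), (29,28,[340,68],[43]), (32,34,[73,326],[552]),
 (17,25,[327],[553,1395,1732]), (60,9,[743],[554]), (14,10,[744,745],[555,1255]),
 (15,46,[746,747],[87,556]), (32,17,[141,748],[557,919]), (17,54,[749],[558]),
 (60,24,[750,751],[559]), (34,25,[752],[560]), (62,6,[753],[561]), (40,7,[754,755],[562]),
 (41,44,[756],[563,948]), (45,49,[757,646],[564,894]), (43,63,[55,758],[565,1610]),
 (23,74,[759,518],[354,566]), (24,91,[519,520],[567]), (18,92,[521],[568]), (21,93,[522],[569]),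
 (20,94,[760,761],[570]), (15,82,[762,763],[571,1546]), (32,56,[764,765],[572]),
 (17,5,[766],[573,926]), (37,20,[767,768],[574,1402]), (38,50,[769,770],[575]),
 (17,5,[771],[576]), (37,35,[772,773],[577]), (16,21,[774],[578]), (22,22,[775,776],[579]),
 (23,41,[777],[580]), (39,55,[778,238],[581]), (23,95,[779,780],[582]), (44,96,[781],[583]),
 (37,97,[782,783],[584]), (16,29,[784,785],[585]), (44,13,[786],[586]), (37,14,[787,788],[587]),
 (16,15,[789,35],[588]), (17,34,[36,332],[589]), (18,25,[333],[314,513,1059]), (60,6,[790],[591]),
 (14,7,[791,792],[592]), (15,16,[227,793],[372,593]), (32,30,[548,794],[336]),
 (33,39,[200,351],[595]), (34,57,[352],[236,1177]), (54,20,[795,796],[597,1591]),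
 (82,98,[797],[598]), (20,22,[798,799],[599]), (15,29,[800,801],[600])]"

definition letters6 :: "letter_row list" where
  "letters6 = [
 (32,34,[802,803],[601]), (17,25,[723],[602]), (60,26,[724,725],[603]), (34,25,[726],[604]),
 (62,27,[804,742],[220]), (16,44,[73],[606]), (22,49,[805,806],[607]), (23,63,[807,808],[608]),
 (44,87,[809],[609]), (37,17,[810,811],[610,621]), (16,99,[812,813],[611]),
 (17,100,[814,815],[612]), (18,101,[816],[613]), (21,102,[817],[614]), (20,10,[818,819],[615]),
 (15,20,[820,821],[616,876]), (32,50,[822,823],[617]), (17,5,[824],[53,618,1062]),
 (60,26,[86,87],[619]), (34,25,[88],[620,1330]), (62,27,[741,742],[220]), (16,103,[812],[622]),
 (22,104,[825,826],[623]), (23,105,[827,828],[624]), (24,24,[829,830],[625]), (18,25,[831],[626]),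
 (21,6,[832],[627]), (20,7,[833,792],[628]), (15,11,[227,834],[629]), (16,12,[835,11],[440]),
 (19,20,[31,836],[631]), (25,36,[837],[632,1670]), (35,29,[838,839],[633,1792]),
 (47,20,[840,841],[634]), (48,36,[842],[635]), (49,5,[843],[636]), (50,26,[844,845],[637]),
 (51,7,[846,847],[118]), (54,13,[190],[639]), (63,14,[848,849],[640,865]),
 (64,15,[850,851],[641,1035]), (46,34,[852,853],[642]), (24,25,[854],[643,941,1451]),
 (81,6,[855],[644]), (14,7,[856,857],[294,371,438]), (19,35,[555,87],[646]),
 (25,36,[88],[55,1449]), (27,9,[129],[648]), (28,37,[858],[649]), (36,38,[859,686],[59,1740]),
 (21,6,[860],[651]), (20,7,[861,862],[652,1083]), (15,44,[863],[653]),
 (12,49,[864,631],[446,1572]), (16,98,[865],[655]), (22,106,[866,867],[656,1476]),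
 (23,5,[868],[657]), (39,84,[869,870],[658,956]), (23,85,[871,872],[659]),
 (24,34,[873,874],[660]), (18,25,[875],[661]), (21,9,[615],[662,980]),
 (20,10,[876,877],[663,996]), (15,47,[878,510],[348]), (33,35,[307,308],[665]),
 (34,36,[309],[515]), (33,32,[102],[667]), (14,33,[879,880],[668]),
 (15,29,[881,82],[51,92,1111,1203,1914]), (21,9,[156],[670]), (20,7,[882,883],[671,1069,1678]),
 (11,8,[884],[672]), (12,7,[188,189],[673]), (13,9,[190],[674]), (14,10,[885,886],[675,687,860]),
 (15,46,[887,888],[676]), (32,30,[889,890],[677]), (17,31,[891],[678,1701]),
 (37,39,[892,893],[679,742]), (16,71,[894,895],[312]), (32,17,[99,896],[681]),
 (17,18,[897],[682]), (60,19,[898],[683]), (14,10,[899,900],[175]), (16,47,[284,285],[685]),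
 (44,21,[901],[686,1247]), (37,48,[902,150],[95]), (15,47,[903,904],[688]), (16,21,[905],[689]),
 (22,48,[906,907],[690]), (23,29,[908,909],[283]), (21,27,[428,910],[692]),
 (25,25,[837],[693,999]), (26,27,[911,912],[694]), (27,25,[913],[695]), (28,13,[914],[696,1386]),
 (29,28,[915,916],[697]), (30,22,[324,325],[44]), (33,32,[200],[699,1820]),
 (14,33,[201,202],[129])]"

definition letters7 :: "letter_row list" where
  "letters7 = [
 (32,34,[205,917],[701]), (17,25,[918],[178,618,702,1062]), (37,35,[86,556],[703,1827]),
 (38,50,[919,920],[704]), (17,5,[921],[705,1307]), (37,20,[922,923],[706,1636,1890]),
 (16,51,[924,925],[233]), (35,58,[353,566],[386]), (49,20,[570,571],[709]), (68,36,[572],[710]),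
 (90,5,[926],[711]), (83,26,[927,928],[712]), (84,25,[209],[713]), (85,84,[929,930],[714]),
 (86,107,[931,932],[715]), (87,44,[933],[716,1360]), (42,12,[934,935],[202]), (23,5,[317],[718]),
 (39,27,[936,937],[719]), (23,7,[938,939],[720,1864]), (24,27,[940,215],[721]),
 (18,25,[216],[722]), (21,9,[941],[723]), (20,10,[942,943],[724,1498]), (15,46,[944,945],[725]),
 (32,30,[946,947],[726]), (17,31,[561],[727,804]), (33,32,[562],[728,1243]),
 (61,90,[948,146],[729]), (15,22,[949,950],[730]), (16,5,[951],[731]), (91,82,[952,953],[732]),
 (23,49,[954,955],[733]), (44,5,[956],[734]), (37,84,[957,958],[735,1549]),
 (16,85,[959,960],[736]), (17,34,[961,962],[737]), (18,25,[963],[738]), (21,6,[964],[739]),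
 (20,7,[965,966],[740]), (15,11,[756,967],[629]), (37,39,[144,968],[679,742]),
 (38,40,[894,895],[338]), (15,108,[483,484],[744,1543]), (16,51,[485,969],[745]),
 (17,53,[970,971],[24,746]), (18,54,[40],[747]), (21,24,[41,972],[141]), (26,26,[973,974],[749]),
 (27,25,[975],[750]), (28,13,[976],[751,1140]), (36,49,[977,978],[752]), (30,29,[979,659],[753]),
 (31,11,[660,661],[754]), (16,12,[980,981],[755]), (17,4,[982,983],[756]),
 (18,5,[984],[478,757,967]), (19,35,[985,986],[646]), (27,27,[91,51],[759]),
 (48,25,[52],[518,1095,1550]), (92,12,[127,128],[761,1638]), (86,45,[129,130],[762]),
 (87,5,[131],[763]), (88,27,[987,988],[764]), (43,7,[989,990],[765,1655]),
 (46,27,[991,992],[766]), (24,25,[993],[767]), (37,20,[941,250],[160,768,1146]),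
 (38,50,[251,994],[769]), (17,5,[995],[770,1124,1545,1644,1781]), (60,6,[996],[771]),
 (14,7,[997,17],[772]), (15,16,[18,998],[773,1134]), (32,30,[692,999],[774]),
 (17,31,[1000],[775,1559]), (33,39,[1001,1002],[776]), (34,57,[258],[777]),
 (35,58,[1003,1004],[778]), (47,60,[1005,1006],[238]), (49,109,[1007,1008],[780]),
 (68,19,[1009],[781]), (93,37,[1010],[782]), (94,35,[1011,1012],[783]), (95,36,[1013],[784]),
 (96,58,[1014,1015],[785]), (97,38,[1016,1017],[786]), (31,7,[1018,1019],[787]),
 (16,44,[535],[788]), (22,49,[536,537],[789]), (23,23,[1020,56],[35]), (15,11,[454,292],[791]),
 (16,12,[293,1021],[792]), (17,4,[1022,1023],[227]), (21,26,[1024,986],[548]), (26,9,[741],[497]),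
 (54,41,[1020],[796]), (63,24,[479,480],[797,1687]), (64,95,[1025,1026],[798]),
 (23,96,[1027],[799]), (39,110,[1028,1029],[800])]"

definition letters8 :: "letter_row list" where
  "letters8 = [
 (23,29,[1030,1031],[801]), (24,27,[1032,1033],[802]), (18,25,[1034],[803,1388]),
 (21,9,[249],[723]), (37,39,[562,563],[679,742]), (19,20,[638,639],[806]),
 (25,57,[640],[807,1149]), (35,58,[1035,1036],[808]), (27,34,[24,25],[809]), (48,25,[26],[810]),
 (49,20,[376,377],[811]), (68,36,[378],[812]), (90,29,[1037,1038],[813,825]), (70,9,[180],[814]),
 (71,37,[684],[815]), (98,38,[685,686],[816]), (73,7,[95,96],[817]), (74,44,[97],[818]),
 (99,12,[1039,1040],[819]), (76,45,[1041,1042],[820]), (31,29,[1043,1044],[821]),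
 (32,43,[1045,1046],[822]), (17,25,[1047],[823,1105]), (60,9,[1048],[824]),
 (14,10,[124,1049],[86,1275]), (100,13,[180],[826]), (71,111,[1050],[827]),
 (72,58,[1051,1052],[828]), (73,38,[1053,1054],[829]), (74,25,[1055],[830]),
 (75,38,[1056,1057],[831]), (76,7,[1058,588],[832]), (31,11,[589,1059],[833]),
 (16,12,[1060,1021],[792]), (21,6,[1061],[835]), (20,7,[997,17],[11,772,1615]),
 (32,50,[52,1062],[837]), (17,5,[1063],[838,911]), (33,59,[1064],[839,1747]),
 (14,49,[1065,1066],[840]), (15,29,[1067,1068],[841,1843]), (32,34,[97,669],[842]),
 (17,25,[670],[843]), (33,59,[1069],[844]), (61,12,[303,304],[845]), (15,22,[1070,1071],[846]),
 (16,29,[1072,1073],[847,1877]), (17,34,[187,292],[187]), (16,44,[299],[849]),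
 (22,49,[1074,1075],[850]), (23,23,[1076,1077],[851]), (24,24,[1078,1079],[852]),
 (18,25,[1080],[853,1092,1254]), (21,6,[1081],[854]), (20,7,[1082,492],[334,855,1473]),
 (15,11,[493,650],[856]), (16,12,[651,1083],[857]), (17,4,[1084,13],[441]),
 (16,47,[205,917],[859]), (44,21,[1085],[686]), (15,11,[903,904],[861]), (16,12,[905,1086],[862]),
 (17,4,[1087,1088],[863]), (18,5,[1089],[864,1295]), (19,20,[1090,1091],[631]),
 (64,112,[850,851],[866]), (23,44,[852],[867]), (39,49,[1092,1093],[331,868]),
 (23,63,[488,1094],[869]), (44,87,[759],[870,1412]), (37,17,[1095,1096],[871,1173]),
 (16,99,[1097,1098],[872]), (17,100,[1099,1100],[873]), (18,101,[1101],[874]),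
 (21,102,[1102],[875]), (20,10,[1103,1104],[615]), (16,51,[822,1105],[877,1199]),
 (17,53,[1106,1107],[878]), (18,18,[1108],[510]), (42,12,[1109,1110],[880]),
 (43,45,[668,1111],[881]), (23,29,[1112,1113],[82]), (16,86,[246,247],[883]),
 (17,72,[248,1114],[884]), (18,5,[1115],[188,292,1571]), (16,16,[299,1116],[886]),
 (17,17,[1117,1118],[887,903]), (18,54,[897],[888]), (21,24,[898,1119],[889]),
 (25,25,[1120],[890]), (26,6,[1121],[891]), (40,7,[1122,1123],[892]), (41,44,[441],[893,1780]),
 (45,49,[645,646],[894]), (43,23,[55,56],[895]), (46,24,[57,58],[466]), (26,27,[159,768],[897]),
 (27,25,[769],[898]), (28,13,[1124],[899,1119]), (29,28,[1125,1126],[900])]"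

definition letters9 :: "letter_row list" where
  "letters9 = [
 (30,22,[1127,409],[274]), (20,10,[429,1128],[902]), (15,44,[1129],[150,1423]),
 (18,18,[897],[904]), (21,19,[898],[905]), (20,10,[899,900],[906,1086]), (15,13,[274],[907]),
 (12,14,[1130,1131],[908]), (59,5,[1132],[909]), (14,84,[1133,609],[425]),
 (38,50,[617,1062],[837]), (37,35,[772,1134],[912,1218]), (38,50,[1135,1136],[913]),
 (17,5,[1137],[914]), (37,20,[376,377],[915]), (16,21,[378],[916]), (22,22,[1138,54],[34,324]),
 (21,9,[322],[918,1085]), (20,10,[1139,430],[86,279,1275]), (17,18,[749],[920]),
 (60,19,[750],[921]), (14,10,[1140,1141],[922,1870]), (15,20,[1142,1143],[923,1471]),
 (32,50,[1144,1145],[924]), (17,5,[1115],[925,1145,1602,1637]), (60,26,[371,593],[218]),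
 (33,13,[767],[927]), (61,28,[1146,1147],[928]), (15,22,[1148,70],[209]), (44,44,[73],[930]),
 (37,49,[805,806],[931]), (16,23,[1149,1150],[932]), (17,24,[1151,1152],[933]),
 (18,25,[1153],[934,1508]), (19,59,[1154],[935]), (20,49,[1155,1156],[190]),
 (101,35,[473,474],[937]), (58,49,[1157,1158],[938]), (82,5,[1159],[939]),
 (20,84,[1160,1161],[940,1889]), (15,85,[1162,1163],[215]), (37,35,[334,1164],[250,942]),
 (16,83,[1165,1166],[943,1533]), (17,53,[1167,1168],[944,1625]), (18,54,[749],[945]),
 (21,24,[750,751],[946]), (25,25,[752],[947]), (26,6,[753],[561]), (42,12,[478,229],[146]),
 (23,5,[231],[950]), (39,27,[1169,988],[951]), (23,7,[989,990],[952]), (44,13,[1170],[953]),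
 (37,14,[1171,1172],[954]), (16,5,[868],[955,1230]), (22,84,[869,870],[658,956]),
 (23,107,[1173,1174],[957]), (44,44,[1175],[958]), (37,49,[1176,235],[959]),
 (16,23,[1177,1178],[960]), (17,24,[1179,1180],[961]), (18,25,[169],[962,1353]),
 (21,6,[1181],[963]), (20,7,[1182,1183],[964,1324,1453,1528]), (15,11,[1184,1185],[965]),
 (16,12,[1186,1187],[966]), (17,4,[1188,983],[756]), (21,6,[996],[835]),
 (45,49,[1189,646],[564,894]), (60,26,[60,61],[970]), (34,25,[62],[971]), (62,27,[63,64],[40]),
 (36,14,[67,68],[223]), (31,16,[36,37],[974]), (32,30,[38,1190],[975]), (17,31,[1191],[976]),
 (37,39,[1192,1193],[977]), (16,98,[1194],[978,1336]), (22,106,[1195,1196],[979]),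
 (23,15,[1197,1198],[659]), (20,10,[876,1199],[981]), (11,8,[1200],[982]),
 (12,7,[1201,1202],[983]), (13,9,[668],[984]), (14,10,[1203,1204],[663,985,996]),
 (15,46,[1205,1206],[986,1730]), (32,30,[1207,142],[88]), (101,35,[207,208],[988]),
 (58,49,[1208,1209],[989]), (82,5,[1210],[990]), (20,84,[1211,1212],[991,1170]),
 (15,85,[1213,1214],[992]), (32,34,[1215,853],[993]), (17,25,[854],[941]), (60,9,[376],[995]),
 (14,10,[1216,1217],[663,985,996]), (15,11,[878,510],[997]), (16,12,[511,27],[17]),
 (21,27,[31,836],[692]), (26,9,[911],[1000])]"

definition letters10 :: "letter_row list" where
  "letters10 = [
 (40,10,[1218,1219],[1001]), (41,44,[1220],[1002,1382]), (45,49,[1221,384],[258]),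
 (23,74,[387,388],[1004]), (24,75,[389,1222],[1005]), (18,76,[1223],[1006]),
 (21,77,[1224,523],[357]), (35,39,[525,1225],[1008]), (27,57,[1226],[1009]), (28,5,[1227],[1010]),
 (29,82,[1228,1229],[1011]), (102,12,[954,1230],[1012]), (31,22,[1231,1232],[1013]),
 (16,5,[1233],[1014]), (91,39,[1234,1235],[1015]), (23,49,[1236,1237],[1016]),
 (44,5,[1238],[1017]), (37,38,[1239,1240],[1018]), (16,7,[1241,1242],[1019]),
 (17,34,[802,803],[535]), (35,29,[727,1243],[56,479]), (11,8,[441],[1022]),
 (12,7,[1244,1245],[1023]), (13,9,[180],[346]), (15,46,[1246,1206],[986]),
 (49,29,[178,179],[1026,1761]), (68,9,[180],[1027]), (93,37,[684],[1028]),
 (94,82,[685,1247],[1029]), (95,36,[1248],[1030]), (96,29,[1249,1250],[1031]),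
 (97,38,[1251,1252],[1032]), (31,7,[1253,588],[1033]), (32,34,[589,1059],[1034]),
 (17,25,[1060],[249]), (23,16,[852,1254],[1036,1344]), (24,17,[38,39],[24]),
 (33,59,[1255],[1038]), (14,49,[1256,281],[180]), (19,13,[156],[1040,1714]),
 (20,49,[1257,1258],[1041]), (15,29,[1259,1260],[1042,1878]), (32,8,[589],[1043]),
 (56,25,[314],[1044]), (57,26,[1261,1262],[1045]), (58,7,[1263,186],[1046]), (55,8,[187],[1047]),
 (20,7,[188,189],[1048]), (15,20,[190,191],[124,403]), (17,53,[197,219],[139,418]),
 (16,44,[284],[1051]), (91,12,[349,1264],[1052]), (23,45,[1265,1266],[1053]),
 (44,5,[1267],[1054]), (37,27,[1268,1269],[1055]), (16,7,[1270,1271],[1056]),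
 (44,13,[1272],[1057]), (37,14,[1273,1274],[954,1058]), (16,15,[331,35],[588]),
 (21,6,[855],[1060]), (20,7,[856,857],[371,438,1021]), (15,11,[509,510],[997]),
 (60,6,[1275],[1063]), (14,7,[1276,17],[772,1064]), (15,47,[18,1277],[1065]),
 (16,21,[1278],[1066,1813]), (22,48,[902,150],[1067]), (23,29,[151,152],[1068]),
 (24,27,[153,154],[97]), (15,47,[884,292],[303]), (23,5,[1279],[1071]),
 (39,27,[1280,1281],[1072]), (23,7,[1282,1283],[1073,1583]), (24,34,[291,292],[187]),
 (19,20,[451,1284],[1075]), (25,36,[1285],[1076]), (35,29,[1286,1287],[1077]),
 (27,9,[1288],[1078]), (28,37,[1289],[1079]), (36,38,[1290,1291],[1080]),
 (30,7,[1292,1293],[1081,1305]), (31,11,[299,300],[1082]), (16,12,[301,1294],[492]),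
 (11,8,[863],[1084]), (12,7,[1295,1296],[13]), (20,10,[1139,1128],[902]), (11,9,[274],[1087]),
 (12,10,[1297,1298],[1088]), (13,8,[1299],[1089]), (14,7,[1300,1301],[1090]),
 (15,20,[1302,1303],[1091,1457]), (32,50,[1304,1062],[837]), (19,35,[1305,1306],[1093]),
 (25,36,[62],[488]), (27,27,[668,51],[759]), (49,20,[702,703],[1096]), (68,36,[704],[1097,1358]),
 (90,29,[1307,1308],[1098]), (70,9,[1309],[1099]), (71,37,[1310],[1100])]"

definition letters11 :: "letter_row list" where
  "letters11 = [
 (98,38,[1311,1312],[1101]), (73,7,[1313,1293],[1102]), (74,44,[299],[1103]),
 (99,12,[472,1314],[1104]), (76,45,[1315,1042],[820]), (60,27,[1048,403],[1106]),
 (34,25,[404],[1107,1380]), (62,27,[1316,250],[1108]), (27,25,[251],[695]), (19,32,[256],[1110]),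
 (20,33,[1317,1318],[668]), (32,8,[83],[1112]), (56,25,[1319],[1113,1739]),
 (57,26,[1320,1321],[133]), (81,6,[438],[1115]), (14,7,[439,440],[294,371,438]),
 (21,27,[451,1284],[1117]), (25,25,[1285],[1118,1470]), (26,27,[767,768],[897]),
 (36,14,[1125,1126],[1120]), (30,15,[1322,1323],[1121]), (31,11,[961,962],[1122]),
 (16,12,[963,1324],[1123]), (17,4,[1325,1326],[441]), (37,35,[985,986],[1125]),
 (16,21,[88],[1126,1658]), (22,22,[1327,1328],[1127,1322]), (23,41,[1329],[409]),
 (17,52,[619,1330],[1129]), (18,31,[497],[127,234]), (16,44,[412],[1131]),
 (22,49,[1331,1332],[1132]), (23,63,[1333,1334],[1133]), (44,87,[1335],[609]),
 (32,17,[692,693],[1135,1398]), (17,18,[694],[1136]), (60,19,[695],[1137]),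
 (14,10,[696,697],[376]), (33,35,[555,87],[54]), (16,51,[182,618],[430,1128]),
 (29,12,[977,1336],[1141]), (30,22,[1337,1232],[1142]), (31,29,[1233,1338],[1143,1716,1891]),
 (32,34,[1339,1340],[1144]), (17,25,[437],[1145,1602]), (60,6,[438],[1115]), (16,21,[251],[1147]),
 (22,22,[1341,1342],[1148]), (23,41,[1343],[70]), (35,58,[1035,1344],[1150]),
 (27,8,[1345],[1151]), (28,25,[1346],[1152]), (36,27,[1347,1348],[1153]),
 (30,7,[533,534],[1154,1634]), (31,47,[535,1349],[1155]), (16,21,[1350],[1156]),
 (22,48,[1351,1352],[297]), (16,5,[956],[1158]), (22,84,[957,958],[1159]),
 (23,107,[959,960],[1160]), (44,44,[961],[1161]), (37,49,[1353,1354],[1162]),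
 (16,23,[1355,1356],[1163]), (17,24,[57,58],[36]), (32,17,[495,1357],[373,1165]),
 (17,54,[220],[1166]), (60,24,[221,222],[1167]), (34,25,[223],[1168,1401]),
 (62,26,[973,974],[749]), (101,35,[350,208],[988]), (15,107,[1213,1214],[1171]),
 (16,44,[1215],[1172]), (22,49,[1092,1093],[868]), (16,88,[1358,1359],[1174]),
 (17,89,[712,713],[1175]), (18,78,[714],[1176]), (19,39,[715,1360],[235]),
 (35,58,[1361,1362],[1178]), (27,8,[1363],[1179]), (28,25,[1364],[1180]),
 (36,27,[1365,264],[169]), (31,11,[267,1366],[1182]), (16,12,[327,1367],[1183]),
 (17,4,[1368,1369],[1184]), (18,5,[1370],[1185,1484,1588,1645]), (21,9,[1371],[1186]),
 (20,10,[1372,1373],[1187,1784]), (11,8,[162],[1188]), (12,7,[1109,1110],[983]),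
 (19,35,[1024,986],[646]), (26,9,[63],[1191]), (40,7,[1374,1375],[1192]),
 (41,44,[1376],[1193,1494]), (45,49,[1377,1378],[1194]), (43,63,[1379,1094],[1195]),
 (23,87,[759],[1196,1489]), (39,17,[1095,1096],[1197]), (23,99,[1097,1098],[1198]),
 (24,100,[1099,1100],[873]), (17,52,[1106,1380],[1200])]"

definition letters12 :: "letter_row list" where
  "letters12 = [
 (18,31,[1381],[1201]), (19,32,[1001],[1202]), (20,33,[1382,1318],[668]),
 (16,16,[83,1383],[1204]), (17,17,[1384,1385],[878,1205]), (18,54,[1108],[1206]),
 (21,24,[695,1386],[1207]), (25,25,[1387],[142,748]), (16,5,[1238],[1209]),
 (22,38,[1239,1240],[1210]), (23,7,[1241,1242],[1211]), (44,44,[802],[1212]),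
 (37,49,[1388,1389],[1213]), (16,23,[1390,1391],[1214]), (17,24,[1392,1393],[1215]),
 (18,25,[1394],[853,1092]), (16,51,[552,1395],[1217]), (17,53,[1396,1397],[878,1205]),
 (16,83,[1398,1399],[1219]), (17,52,[1400,1401],[1220]), (18,31,[143],[1221,1534]),
 (19,39,[144,968],[384]), (69,9,[573],[1223]), (83,10,[1402,1128],[1224]), (84,44,[1129],[523]),
 (88,113,[1403,1404],[1226]), (43,114,[1405,1406],[1227]), (23,82,[1407,1408],[1228]),
 (44,98,[1409],[1229]), (37,106,[1410,1411],[954]), (22,84,[869,1412],[1231]),
 (23,25,[1413],[1232]), (39,38,[1414,1415],[1233]), (23,7,[1416,1417],[1234,1338]),
 (44,44,[1418],[1235]), (37,49,[1419,1420],[1236]), (16,41,[1421],[1237]),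
 (22,24,[1422,480],[1238]), (23,95,[1025,1026],[1239]), (44,96,[1027],[1240]),
 (37,110,[1028,1029],[1241]), (16,29,[1030,1031],[1242]), (17,27,[1032,1033],[802]),
 (14,33,[948,146],[91]), (19,59,[1255],[1245]), (20,49,[1256,281],[180]), (18,54,[694],[1206]),
 (37,48,[902,1423],[1248]), (16,5,[1424],[1249]), (91,20,[1425,1426],[1250]),
 (23,49,[1427,1428],[1251]), (44,5,[1429],[1252]), (37,84,[1430,1431],[1253]),
 (16,85,[1432,1163],[588]), (21,26,[1305,1306],[38]), (15,47,[24,25],[1256]), (16,21,[26],[281]),
 (16,98,[246],[1258]), (22,106,[1433,1434],[1259,1788]), (23,15,[1435,1436],[1260]),
 (24,34,[36,332],[589]), (61,12,[470,471],[1262]), (15,22,[1437,1438],[1263]),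
 (16,29,[1439,1440],[186]), (20,14,[512,33],[1265]), (15,112,[34,35],[1266,1273]),
 (32,8,[36],[1267]), (56,25,[1441],[1268,1600]), (101,35,[1442,1443],[1269]),
 (58,49,[1444,1445],[1270]), (82,5,[1446],[1271]), (20,84,[1430,1431],[1272]),
 (15,107,[1432,1163],[1273]), (16,44,[36],[1274,1907]), (22,49,[1447,1093],[331,868]),
 (15,11,[418,419],[1276]), (16,12,[420,27],[17]), (21,9,[31],[1278]),
 (20,10,[1448,1128],[902,1706]), (59,81,[1449],[1280]), (61,82,[1450,540],[1281]),
 (15,56,[541,542],[1282]), (16,29,[543,544],[1283]), (17,34,[545,546],[291]),
 (38,56,[640,641],[1285]), (17,5,[642],[767,1286]), (33,13,[1451],[1287]),
 (14,14,[406,407],[1288]), (15,15,[1452,1323],[1289,1776]), (16,47,[961,962],[1290]),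
 (44,21,[963],[1291]), (37,48,[1453,1454],[1292]), (16,29,[1455,1456],[1293]),
 (17,27,[459,460],[299]), (11,8,[454],[672]), (19,13,[1090],[1296]), (20,14,[1457,33],[21]),
 (16,16,[412,1458],[1298]), (17,30,[1459,1460],[1299]), (18,31,[1461],[1300])]"

definition letters13 :: "letter_row list" where
  "letters13 = [
 (19,32,[1462],[1301]), (20,33,[1463,1464],[1302]), (15,29,[1465,1466],[1303]),
 (32,34,[1467,1468],[1304]), (17,25,[1469],[53,1062]), (31,16,[299,1116],[1306]),
 (32,30,[1117,1470],[62]), (33,13,[922],[1308,1507]), (14,14,[1471,1472],[1309]),
 (15,15,[1435,1436],[1310]), (16,47,[36,332],[1311]), (44,21,[333],[1312]),
 (37,48,[1473,1474],[1313]), (16,29,[1475,458],[1293]), (20,49,[654,655],[1315]),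
 (15,29,[1476,1260],[1042]), (37,35,[592,372],[250,942]), (42,12,[1477,1478],[1318]),
 (43,45,[91,1111],[881]), (19,13,[136],[1320,1917]), (61,28,[1479,1480],[1321]),
 (15,22,[1481,1482],[209,1208]), (23,23,[1483,1178],[1323]), (24,24,[1179,1180],[961]),
 (11,8,[1184],[1325]), (12,7,[1484,1485],[1326]), (13,9,[1486],[14]), (33,39,[144,968],[1328]),
 (34,57,[564],[1329,1483]), (35,58,[565,354],[237]), (62,9,[741],[497]), (19,20,[244,245],[1332]),
 (25,57,[246],[1333]), (35,58,[1487,1488],[1334]), (27,34,[418,419],[1335]), (48,25,[420],[810]),
 (22,106,[1195,1489],[1337]), (23,5,[1490],[1232]), (24,34,[1418,1491],[1339]),
 (18,25,[1492],[1340,1790,1862]), (21,6,[1493],[437]), (33,20,[376,377],[1342]),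
 (34,36,[378],[1343]), (35,29,[1037,1038],[113]), (24,30,[38,1190],[1345]), (18,31,[1191],[1346]),
 (19,32,[1192],[1347]), (61,90,[1494,1495],[1348]), (15,22,[1496,1497],[533]),
 (21,6,[1498],[1350]), (20,7,[1499,1500],[1351,1751]), (15,44,[1501],[1352]),
 (12,49,[1502,631],[446]), (19,35,[170,1503],[1354]), (25,36,[1504],[1355]),
 (35,29,[1505,1506],[1356]), (27,9,[50],[57]), (26,27,[678,742],[220]), (90,5,[1307],[1359]),
 (83,26,[1507,1321],[712]), (88,49,[1508,514],[352]), (23,64,[517,518],[1362]),
 (24,65,[519,1509],[1363]), (18,66,[1510],[1364]), (19,67,[1511],[1365]),
 (61,68,[1512,1513],[264]), (21,9,[402],[327]), (11,9,[1514],[1368]), (12,10,[1515,1516],[1369]),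
 (13,8,[1517],[1370]), (14,7,[1518,1519],[1371]), (15,20,[1520,1521],[1372,1611,1683]),
 (16,51,[1522,1523],[1373]), (17,52,[1524,1525],[162]), (16,71,[104,105],[1375]),
 (17,72,[106,1526],[1376]), (18,5,[1527],[1377,1619]), (19,35,[1528,1529],[1378]),
 (25,36,[1530],[1379]), (35,29,[1531,1532],[489,1094]), (62,9,[1316],[1381]),
 (40,10,[942,1533],[1001]), (42,12,[1534,1535],[1318]), (21,27,[136,1536],[1384]),
 (25,25,[1537],[1385]), (26,27,[249,250],[1108]), (36,14,[915,916],[1387]),
 (30,15,[34,35],[224,973]), (19,20,[249,250],[1389]), (25,36,[251],[1390]),
 (35,29,[1538,1539],[1391]), (27,9,[1540],[1392]), (28,37,[1541],[1393]),
 (36,38,[1542,1312],[1394]), (30,7,[1313,1293],[1081,1305]), (60,27,[743,1543],[1396]),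
 (34,25,[1544],[1397]), (62,27,[941,250],[1108]), (17,54,[694],[1399]), (60,24,[695,1386],[1400])]"

definition letters14 :: "letter_row list" where
  "letters14 = [
 (34,25,[1387],[1401]), (62,6,[224],[143]), (16,51,[769,1545],[1128]), (49,13,[570],[1404]),
 (50,36,[1546],[1405]), (103,58,[1547,1548],[1406]), (104,38,[733,734],[1407]),
 (87,25,[1549],[1408]), (88,84,[1160,1161],[1409]), (43,107,[1162,1163],[1410]),
 (23,44,[36],[1411]), (39,49,[1447,1093],[868]), (37,113,[1550,1551],[1413]),
 (16,114,[1552,1553],[1414]), (44,44,[1554],[1415]), (37,33,[1555,1556],[1416]),
 (16,29,[1557,1558],[1417]), (17,34,[477,967],[1418]), (18,25,[835],[1419,1491]),
 (19,35,[772,773],[1420]), (25,36,[774],[1421]), (35,29,[1559,1560],[1422]),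
 (47,20,[668,51],[480]), (12,49,[234,1561],[1424]), (59,81,[1562],[1425]),
 (61,39,[1563,1564],[1426]), (15,56,[1565,1566],[1427,1575]), (16,5,[1567],[1428]),
 (22,84,[1568,1569],[1429]), (23,107,[1570,1163],[1430]), (44,44,[36],[1431]),
 (37,49,[1447,1093],[1432]), (16,23,[488,489],[1163]), (23,44,[291],[1434]),
 (39,49,[1571,514],[1435,1839]), (23,23,[515,647],[1436]), (24,24,[648,649],[36]),
 (23,5,[1572],[1438]), (39,27,[1573,1574],[1439]), (23,7,[1575,1576],[1440,1816]),
 (24,34,[1577,1340],[291]), (19,59,[1578],[1442]), (61,12,[1579,1580],[1443]),
 (15,22,[1581,1582],[846,1444]), (16,5,[1072],[1445]), (22,84,[1583,1584],[1446]),
 (23,107,[1585,1586],[1430]), (19,35,[60,61],[1093]), (16,51,[52,618],[1128]), (35,5,[89],[1450]),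
 (89,20,[1587,729],[540]), (37,35,[334,335],[406]), (23,23,[1177,1178],[1323]),
 (15,44,[1184],[1454]), (12,49,[1588,1589],[1455]), (59,41,[1590],[1456]),
 (14,24,[113,114],[459]), (16,21,[1304],[33]), (21,43,[596,1591],[1459]), (25,25,[1592],[1460]),
 (26,6,[1593],[1461]), (40,7,[1594,1595],[1462]), (41,44,[1596],[1463]),
 (42,12,[1597,1598],[1464]), (43,45,[1599,1266],[1465]), (23,29,[1267,1600],[1466]),
 (24,43,[1601,1046],[1467]), (18,25,[1047],[1468]), (21,9,[1048],[1469]),
 (20,10,[124,1049],[86,1275]), (26,9,[767],[101]), (16,21,[1144],[1472]),
 (22,22,[1602,1603],[1435,1481]), (15,44,[493],[1474]), (12,49,[1604,1605],[1475]),
 (59,41,[1606],[458]), (23,15,[331,35],[1260]), (19,32,[562],[1478]), (20,33,[948,146],[91]),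
 (16,21,[216],[1480]), (22,22,[1607,1603],[1435,1481]), (23,41,[515],[1482]),
 (39,24,[1608,1609],[71,1238]), (35,58,[1610,1362],[1178]), (19,13,[1371],[1485]),
 (20,14,[1611,1612],[1486]), (15,15,[1613,342],[22]), (23,16,[291,461],[1488]),
 (24,17,[462,1614],[418]), (39,113,[1550,1551],[1490]), (23,114,[1552,1553],[1414]),
 (21,6,[1615],[1492]), (20,7,[1616,1617],[1493,1841]), (15,11,[1618,834],[629]),
 (42,12,[1619,1620],[1495]), (43,45,[1621,1622],[1496]), (23,5,[1623],[1497]),
 (39,27,[1624,937],[719]), (15,11,[1625,1626],[1499]), (16,12,[1627,1628],[1500])]"

definition letters15 :: "letter_row list" where
  "letters15 = [
 (17,4,[1629,1630],[1501]), (18,5,[1631],[1502,1818]), (19,20,[1632,1633],[631]),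
 (32,30,[75,76],[1504]), (17,31,[77],[1505]), (33,32,[78],[1506]), (14,33,[79,80],[50]),
 (61,28,[1471,1472],[1321]), (19,35,[1634,1635],[514]), (69,27,[705,1636],[1510]),
 (70,25,[924],[1511]), (71,13,[1637],[1512]), (72,28,[406,407],[1513]), (73,22,[408,409],[395]),
 (15,63,[515,516],[1515]), (16,64,[517,518],[1516]), (17,115,[519,520],[1517]),
 (18,116,[521],[1518]), (19,117,[522],[1519]), (20,110,[760,1638],[1520]),
 (15,118,[1639,1640],[1521]), (32,27,[1641,1642],[1522]), (17,25,[1643],[1523,1703,1757]),
 (60,27,[159,768],[1524]), (34,25,[769],[1525]), (62,9,[1644],[255]), (81,6,[1181],[1527]),
 (14,7,[1182,1183],[1528,1710]), (15,16,[1184,1645],[1529]), (32,30,[1646,1647],[1530]),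
 (17,31,[255],[1531]), (33,32,[256],[1532]), (14,33,[1317,1318],[668]),
 (17,52,[1167,1401],[1220]), (19,32,[144],[1535]), (20,33,[145,146],[91]),
 (32,50,[216,1648],[1537]), (17,5,[644],[249]), (33,13,[376],[1539]), (14,14,[1649,1650],[1540]),
 (15,15,[1651,1652],[1541]), (16,47,[1653,853],[1542]), (44,21,[854],[1312]),
 (32,50,[485,1654],[1544]), (17,5,[468],[941,1800]), (60,26,[985,986],[619]),
 (16,98,[764],[1547]), (91,119,[1655,1656],[1548]), (23,22,[656,657],[733]),
 (16,107,[959,960],[1160]), (49,13,[1657],[1551]), (50,111,[1125],[1552]),
 (103,58,[1658,1659],[1553]), (104,38,[1660,1661],[1554]), (87,25,[1662],[1555]),
 (42,82,[952,953],[1556]), (43,49,[954,955],[1557]), (23,29,[658,659],[1558]),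
 (24,34,[660,661],[477]), (33,32,[1001],[1560]), (14,33,[1382,1318],[668]), (25,57,[1663],[1562]),
 (35,5,[1664],[1563]), (89,82,[1665,1666],[1564]), (41,36,[1667],[1565]),
 (42,58,[1668,1669],[1566]), (43,38,[1016,1017],[1567]), (23,7,[1018,1019],[1568,1674]),
 (44,44,[535],[1569]), (37,49,[536,537],[1570]), (16,23,[1020,56],[1163]),
 (19,35,[371,593],[514]), (59,81,[1670],[1573]), (61,82,[1671,1672],[1574]),
 (15,56,[1673,1566],[1575]), (16,29,[1567,1674],[1576]), (17,34,[1675,1676],[1577]),
 (18,25,[1677],[1340,1862]), (31,47,[97,669],[1579]), (16,21,[670],[1580]),
 (22,48,[1678,1679],[1581]), (23,5,[1680],[1582]), (39,27,[1681,1682],[1072]),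
 (44,44,[291],[1584]), (37,49,[1571,514],[1585,1745]), (16,23,[515,647],[1586]),
 (17,24,[648,649],[36]), (61,90,[145,146],[729]), (19,20,[1371,1683],[1589]),
 (25,36,[1684],[1590]), (35,29,[1685,1686],[113]), (55,57,[1687],[1592]),
 (20,120,[1688,1689],[1593]), (15,11,[1690,1691],[1594]), (16,12,[1692,1693],[1595]),
 (17,4,[1694,1695],[1596]), (18,5,[1696],[1597]), (19,13,[1697],[1598]),
 (20,14,[1698,1699],[1599]), (15,112,[1700,35],[1266])]"

definition letters16 :: "letter_row list" where
  "letters16 = [
 (57,26,[1442,1443],[1601,1833]), (58,7,[846,847],[1046]), (33,35,[371,593],[1603]),
 (34,36,[336],[515]), (19,35,[675,676],[1605]), (25,36,[677],[1606]), (35,29,[1701,1702],[479]),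
 (33,35,[334,335],[1603]), (47,20,[129,700],[1609]), (48,36,[701],[115,1025]),
 (23,64,[759,518],[1362]), (16,21,[1522],[1612]), (22,22,[1703,1704],[1613]),
 (23,23,[1705,501],[342]), (26,27,[310,337],[220]), (15,11,[18,1277],[1616]),
 (16,12,[1278,1706],[1617]), (17,4,[1707,1708],[1618]), (18,5,[1709],[793,834]),
 (19,59,[1710],[1620]), (20,49,[1711,1712],[1621]), (15,29,[1713,1068],[1622]),
 (32,8,[97],[1623]), (56,25,[1039],[1624]), (101,35,[1714,1715],[937]), (18,18,[749],[1626]),
 (21,19,[750],[1627]), (20,10,[1140,1141],[1628]), (11,9,[1142],[1629]),
 (12,10,[1716,1717],[1630]), (13,8,[126],[1631]), (14,7,[127,128],[1632]),
 (15,20,[129,700],[1633,1863]), (32,50,[701,1062],[837]), (31,16,[535,1718],[1635]),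
 (32,30,[1719,1720],[336]), (38,50,[924,1145],[924]), (37,35,[371,593],[406]),
 (86,121,[129],[1639]), (96,122,[1721,1722],[1640]), (97,123,[1723,1724],[1641]),
 (31,7,[1725,1726],[1642]), (32,27,[1727,1728],[1643]), (17,25,[1729],[159]),
 (37,35,[985,1730],[380]), (21,27,[1371,1683],[1646]), (25,25,[1684],[1647]), (26,9,[1731],[255]),
 (60,6,[855],[644]), (16,21,[552],[1650]), (22,22,[1732,1733],[1651]), (23,23,[1734,1735],[1652]),
 (24,24,[1736,1737],[1653]), (18,25,[1738],[853]), (60,6,[490],[468]), (23,13,[1170],[1656]),
 (39,14,[1171,1172],[656]), (37,35,[86,87],[1125]), (91,119,[89,90],[1659]),
 (23,45,[91,1111],[1660]), (44,5,[1112],[1661]), (37,27,[1739,988],[1662]),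
 (16,7,[989,990],[952]), (43,124,[515,647],[1664]), (23,125,[648,649],[1665]),
 (44,21,[1740],[1666]), (37,126,[1741,1742],[1667]), (16,5,[1743],[1668]),
 (91,39,[1744,1584],[1669]), (23,49,[1745,1746],[1016]), (35,5,[838],[1671]),
 (89,35,[1747,1748],[1672]), (41,36,[1749],[1673]), (42,58,[1750,1669],[1566]),
 (24,34,[535,1349],[1675]), (18,25,[1350],[1676]), (21,6,[1751],[1677]),
 (20,7,[1752,1617],[1493,1841]), (15,44,[884],[1679]), (12,49,[1571,514],[1680,1856]),
 (59,81,[1753],[1681]), (61,82,[1754,1755],[1682]), (15,56,[1756,542],[1282]),
 (32,50,[1522,1757],[1684]), (17,5,[1758],[1685,1731]), (33,59,[1759],[1686]),
 (14,49,[1760,281],[180]), (64,127,[1025,1761],[1688]), (23,128,[1762,1763],[1689]),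
 (24,129,[1764,1765],[1690]), (18,130,[1766],[1691]), (21,102,[1767],[1692]),
 (20,10,[1768,1769],[1693]), (11,9,[1770],[1694]), (12,7,[1771,1772],[1695]),
 (13,8,[1773],[1696]), (14,7,[1774,1775],[1697]), (15,20,[1288,1776],[1698]),
 (16,21,[1777],[1699]), (22,22,[1778,1779],[1700])]"

definition letters17 :: "letter_row list" where
  "letters17 = [
 (23,23,[1379,489],[35]), (33,32,[892],[1702]), (14,33,[1780,146],[91]), (33,20,[159,768],[1704]),
 (34,36,[769],[1705]), (35,29,[1781,1782],[501]), (11,8,[1129],[1707]), (12,7,[127,128],[1708]),
 (13,9,[129],[1709]), (14,10,[1783,508],[1024,1061]), (15,47,[1184,1185],[1711]),
 (16,21,[1186],[1712]), (22,48,[1784,1785],[1713]), (23,29,[1786,1787],[1068]),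
 (61,12,[1257,1258],[1715]), (15,22,[1788,1789],[1157]), (16,16,[1339,1790],[1717]),
 (17,30,[462,463],[126]), (21,26,[724,725],[1719]), (25,25,[726],[1720]), (26,9,[804],[497]),
 (16,44,[205],[1722,1901]), (56,49,[1791,631],[1723]), (105,41,[632],[1724]),
 (106,131,[1792],[1725]), (107,62,[1793,1794],[1726]), (108,27,[1795,1796],[1727]),
 (31,7,[1797,847],[1728]), (32,34,[187,292],[1729]), (17,25,[293],[249]),
 (32,17,[1207,748],[557]), (37,35,[1798,1799],[380]), (33,20,[743,1543],[1733]),
 (34,36,[1544],[1734]), (35,29,[1800,1801],[1735]), (27,9,[190],[1736]), (28,37,[1802],[1737]),
 (36,38,[1803,1804],[1738]), (30,7,[1805,1293],[1081]), (101,35,[1320,1321],[988]),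
 (30,25,[95],[1741]), (109,82,[1806,1807],[1742]), (110,49,[1808,1809],[1743]),
 (23,29,[1810,1811],[1744]), (44,44,[1812],[1584]), (16,41,[515],[1746]),
 (22,24,[1608,1609],[1238]), (61,12,[1065,1813],[1748]), (15,22,[1814,1815],[1749]),
 (16,5,[1439],[1750]), (91,39,[1816,1817],[1669]), (15,11,[1501,1818],[1752]),
 (16,12,[1819,1706],[1617]), (35,5,[698],[1754]), (89,20,[1820,532],[1755]),
 (41,36,[1821],[1756]), (42,58,[1822,732],[542]), (60,9,[159],[1758]),
 (14,10,[160,1823],[1759,1798]), (15,47,[1824,1825],[1760]), (16,21,[1826],[281]),
 (68,27,[180,181],[1762]), (111,25,[182],[1763]), (112,9,[702],[1764]), (113,37,[1827],[1765]),
 (114,38,[1828,1829],[1766]), (115,7,[1830,1831],[1767]), (74,44,[1832],[1768]),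
 (99,12,[349,1264],[1769]), (76,45,[1265,1266],[1770]), (31,29,[1267,1600],[1771]),
 (16,20,[1833,1834],[1772]), (17,56,[1835,1836],[1773]), (18,5,[1837],[1774]),
 (19,13,[1451],[1775]), (20,14,[406,407],[1288]), (32,34,[961,962],[1777]), (17,25,[963],[1778]),
 (33,35,[1528,1529],[1779]), (34,36,[1530],[1379]), (42,12,[1244,1245],[146]),
 (33,59,[663],[1782]), (14,49,[348,281],[180]), (16,16,[205,1838],[508]), (15,44,[162],[1785]),
 (12,49,[163,164],[1786]), (59,41,[777],[1787]), (14,55,[778,238],[153]), (23,5,[1839],[1789]),
 (39,84,[1840,870],[956]), (21,26,[1841,593],[462]), (19,20,[322,1842],[631]),
 (47,13,[840],[1793]), (116,132,[1843],[1794]), (29,106,[1844,1845],[1795]),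
 (102,118,[1846,1847],[1796]), (31,38,[1848,1849],[1797]), (16,7,[1850,1851],[847]),
 (15,46,[1852,1853],[1799]), (32,17,[1854,748],[557])]"

definition letters18 :: "letter_row list" where
  "letters18 = [
 (33,59,[469],[1801]), (14,49,[470,471],[190]), (16,47,[299,300],[1803]), (44,21,[301],[1804]),
 (37,48,[1855,1679],[1805]), (16,29,[1856,1857],[1293]), (44,13,[1858],[1807]),
 (37,49,[1859,1860],[1808]), (16,5,[1861],[1809]), (22,38,[585,586],[1810]),
 (23,7,[587,588],[1811]), (24,34,[589,1059],[1812]), (18,25,[1060],[292,1571]),
 (22,48,[902,1423],[1814]), (23,5,[1424],[1815]), (39,27,[1425,1426],[1439]),
 (44,44,[1577],[1817]), (37,49,[1862,514],[1745]), (21,9,[1632],[1819]),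
 (20,10,[1863,1128],[1706]), (61,90,[201,202],[532]), (16,5,[719],[1822]),
 (91,82,[1864,1057],[732]), (17,53,[253,1865],[1824,1852]), (18,18,[1866],[1825]),
 (21,19,[1867],[1826]), (20,10,[1868,1869],[421]), (16,133,[919,920],[1828]),
 (44,134,[921],[1829]), (37,48,[1870,1871],[1830]), (16,29,[1872,1873],[1831]),
 (17,27,[1874,1875],[1832]), (18,25,[1876],[349]), (58,25,[846],[1834]),
 (63,84,[1877,1584],[1835]), (64,85,[1585,1586],[1836]), (46,34,[36,332],[1837]),
 (24,25,[333],[1451]), (21,27,[322,1842],[692]), (23,63,[515,516],[1840]), (44,87,[517],[870]),
 (15,16,[1618,793],[593]), (32,50,[182,1062],[837]), (16,44,[97],[1844]),
 (91,12,[1039,1040],[1845]), (23,121,[1041],[1846]), (91,122,[1878,1879],[1847]),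
 (23,34,[1880,1881],[1848]), (44,25,[1882],[1849]), (37,27,[1883,1884],[1850]),
 (16,7,[1885,1886],[1744,1851]), (17,34,[1812,292],[187]), (18,54,[1866],[1853]),
 (21,24,[1867,1887],[1854]), (25,25,[1888],[748]), (15,44,[454],[1679]), (59,41,[515],[1857]),
 (14,24,[1608,1609],[459]), (15,95,[779,780],[1859]), (16,96,[781],[1860]),
 (22,97,[782,783],[1861]), (23,29,[784,785],[585]), (19,35,[1841,593],[514]),
 (16,51,[701,618],[1128]), (44,13,[1889],[1057]), (62,27,[379,703],[1866]), (27,25,[704],[1867]),
 (28,13,[705],[1868,1887]), (29,28,[1890,1472],[1869]), (30,22,[1481,1482],[44]),
 (15,13,[1142],[1871]), (12,14,[1891,1892],[1872]), (59,5,[1839],[1873]),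
 (14,84,[1840,870],[1874]), (15,85,[871,872],[1875]), (32,34,[873,874],[1876]),
 (17,25,[875],[428]), (44,44,[187],[1584]), (16,44,[589],[1879]), (56,49,[513,514],[1880]),
 (105,41,[515],[1881]), (106,131,[1893],[1882]), (107,62,[1894,1895],[1883]),
 (117,20,[1896,1897],[1884]), (31,49,[1898,1899],[1885]), (16,29,[1900,1260],[1886]),
 (17,34,[589,1059],[1812]), (36,14,[1890,1472],[1888]), (30,15,[1435,1436],[973]),
 (15,107,[1162,1163],[1273]), (16,21,[924],[1472]), (16,44,[1339],[1892]),
 (22,49,[1862,514],[1839]), (47,13,[129],[1894]), (116,132,[1721],[1895]),
 (29,106,[1901,1902],[1896]), (102,118,[1903,1904],[1897]), (31,38,[1905,1849],[1898]),
 (16,25,[1850],[1899]), (22,84,[1744,1584],[1900])]"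

definition letters19 :: "letter_row list" where
  "letters19 = [
 (23,85,[1585,1586],[1260]), (91,12,[206,1906],[1902]), (23,121,[1265],[1903]),
 (91,122,[1273,1907],[1904]), (23,34,[1908,1909],[1905]), (44,25,[1910],[1849]),
 (20,14,[323,33],[1265]), (56,49,[1447,1093],[1908]), (105,41,[488],[1909]),
 (106,131,[1911],[1910]), (107,62,[1912,1913],[1883]), (47,13,[668],[1912]),
 (116,132,[1914],[1913]), (29,106,[1915,1916],[1896]), (16,44,[83],[1915]),
 (91,12,[1319,1917],[1916]), (23,121,[1918],[1903]), (20,14,[1479,1480],[1918]),
 (15,112,[1435,1436],[1273])]"

definition letters :: "letter_row list" where
  "letters =
 letters0 @ letters1 @ letters2 @ letters3 @ letters4 @ letters5 @ letters6 @ letters7 @ letters8 @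
 letters9 @ letters10 @ letters11 @ letters12 @ letters13 @ letters14 @ letters15 @ letters16 @ letters17 @
 letters18 @ letters19"

text \<open>Reading a literal list as a family of equations, one for each entry, makes it possible to
  look up an entry in one rewriting step.\<close>

fun listed :: "(nat \<Rightarrow> 'a) \<Rightarrow> nat \<Rightarrow> 'a list \<Rightarrow> bool" where
  "listed f n [] \<longleftrightarrow> True"
| "listed f n (x # xs) \<longleftrightarrow> f n = x \<and> listed f (Suc n) xs"

fun skip :: "nat \<Rightarrow> 'a list \<Rightarrow> nat" where
  "skip n [] = n"
| "skip n (x # xs) = skip (Suc n) xs"

lemma listed_drop: "listed ((!) xs) n (drop n xs)"
proof (induction "length xs - n" arbitrary: n)
  case 0
  then show ?case by simp
next
  case (Suc k)
  then have "drop n xs = xs ! n # drop (Suc n) xs"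
    by (simp add: Cons_nth_drop_Suc)
  then show ?case using Suc.hyps(1)[of "Suc n"] Suc.hyps(2) by simp
qed

lemma listed_nth: "xs = ys \<Longrightarrow> listed ((!) xs) 0 ys"
  using listed_drop[of xs 0] by simp

lemma listed_append: "listed f n (xs @ ys) \<longleftrightarrow> listed f n xs \<and> listed f (skip n xs) ys"
  by (induction xs arbitrary: n) auto

lemma Suc_numerals: "Suc 0 = 1" "Suc 1 = 2" "Suc (numeral k) = numeral (Num.inc k)"
  by (simp_all add: add_One)

lemmas listed_simps = listed.simps skip.simps Suc_numerals Num.inc.simps simp_thms

lemmas boards_nth = listed_nth[OF boards_def, unfolded listed_simps]
lemmas windows_nth = listed_nth[OF windows_def, unfolded listed_simps]

lemma letters_chunk_ends:
  "skip 0 letters0 = 100"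
  "skip 100 letters1 = 200"
  "skip 200 letters2 = 300"
  "skip 300 letters3 = 400"
  "skip 400 letters4 = 500"
  "skip 500 letters5 = 600"
  "skip 600 letters6 = 700"
  "skip 700 letters7 = 800"
  "skip 800 letters8 = 900"
  "skip 900 letters9 = 1000"
  "skip 1000 letters10 = 1100"
  "skip 1100 letters11 = 1200"
  "skip 1200 letters12 = 1300"
  "skip 1300 letters13 = 1400"
  "skip 1400 letters14 = 1500"
  "skip 1500 letters15 = 1600"
  "skip 1600 letters16 = 1700"
  "skip 1700 letters17 = 1800"
  "skip 1800 letters18 = 1900"
  by (simp_all only: letters0_def letters1_def letters2_def letters3_def letters4_def letters5_def
    letters6_def letters7_def letters8_def letters9_def letters10_def letters11_def
    letters12_def letters13_def letters14_def letters15_def letters16_def letters17_def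
    letters18_def letters19_def listed_simps)

lemma letters_chunks:
  "listed ((!) letters) 0 letters0"
  "listed ((!) letters) 100 letters1"
  "listed ((!) letters) 200 letters2"
  "listed ((!) letters) 300 letters3"
  "listed ((!) letters) 400 letters4"
  "listed ((!) letters) 500 letters5"
  "listed ((!) letters) 600 letters6"
  "listed ((!) letters) 700 letters7"
  "listed ((!) letters) 800 letters8"
  "listed ((!) letters) 900 letters9"
  "listed ((!) letters) 1000 letters10"
  "listed ((!) letters) 1100 letters11"
  "listed ((!) letters) 1200 letters12"
  "listed ((!) letters) 1300 letters13"
  "listed ((!) letters) 1400 letters14"
  "listed ((!) letters) 1500 letters15"
  "listed ((!) letters) 1600 letters16"
  "listed ((!) letters) 1700 letters17"
  "listed ((!) letters) 1800 letters18"
  "listed ((!) letters) 1900 letters19"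
  using listed_nth[OF letters_def] by (simp_all only: listed_append letters_chunk_ends)

lemmas letters_nth = letters_chunks[unfolded letters0_def letters1_def letters2_def letters3_def letters4_def letters5_def
    letters6_def letters7_def letters8_def letters9_def letters10_def letters11_def
    letters12_def letters13_def letters14_def letters15_def letters16_def letters17_def
    letters18_def letters19_def listed_simps]

section \<open>Local checks on letters\<close>

definition board_of :: "nat \<Rightarrow> board" where
  "board_of a = boards ! fst (letters ! a)"

definition kinds_of :: "nat \<Rightarrow> bool option list" where
  "kinds_of a = fst (windows ! fst (snd (letters ! a)))"

definition types_of :: "nat \<Rightarrow> bool option list" where
  "types_of a = snd (windows ! fst (snd (letters ! a)))"

definition children :: "nat \<Rightarrow> nat list" where
  "children a = fst (snd (snd (letters ! a)))"

definition successors :: "nat \<Rightarrow> nat list" where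
  "successors a = snd (snd (snd (letters ! a)))"

definition first_child :: "nat \<Rightarrow> nat" where
  "first_child a = hd (children a)"

definition second_child :: "nat \<Rightarrow> nat" where
  "second_child a = hd (tl (children a))"

definition two_children :: "nat \<Rightarrow> bool" where
  "two_children a \<longleftrightarrow> tl (children a) \<noteq> []"

definition last_child :: "nat \<Rightarrow> nat" where
  "last_child a = (if two_children a then second_child a else first_child a)"

definition claims_in :: "'a option list \<Rightarrow> 'a option list \<Rightarrow> bool" where
  "claims_in = list_all2 (\<lambda>x y. x = None \<or> x = y)"

text \<open>For windows of consecutive columns. A claim about a column to the right is passed on to the next
  column, a claim about a column to the left must have come from the previous one; so every
  claim is eventually traced to the column it speaks about.\<close>

definition claims_pass :: "'a option list \<Rightarrow> 'a option list \<Rightarrow> bool" where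
  "claims_pass xs ys \<longleftrightarrow>
     claims_in (take 3 ys) (take 3 (tl xs)) \<and> claims_in (drop 4 xs) (take 4 (drop 3 ys))"

definition centre :: "'a option list \<Rightarrow> 'a option" where
  "centre xs = hd (drop 3 xs)"

definition followed_by :: "nat \<Rightarrow> nat \<Rightarrow> bool" where
  "followed_by a b \<longleftrightarrow>
     claims_pass (kinds_of a) (kinds_of b) \<and> claims_pass (types_of a) (types_of b) \<and>
     first_child b \<in> set (successors (last_child a))"

text \<open>The claims that a letter makes about its own column are checked against its children: the number of
  children shows the type of the column, and the first child is never the row of an upper queen while the
  second always is.\<close>

definition consistent :: "nat \<Rightarrow> bool" where
  "consistent a \<longleftrightarrow>
     length (kinds_of a) = 8 \<and> length (types_of a) = 8 \<and>
     list_all (\<lambda>c. c < 1919) (children a) \<and> children a \<noteq> [] \<and>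
     centre (types_of a) = Some (two_children a) \<and>
     centre (kinds_of (first_child a)) = Some False \<and>
     (two_children a \<longrightarrow> centre (kinds_of (second_child a)) = Some True \<and>
        second_child a \<in> set (successors (first_child a))) \<and>
     list_all (followed_by a) (successors a)"

text \<open>The antidiagonals above \<open>anti_end j\<close>, in increasing order, given the types of the columns
  \<open>j + 1, j + 2, \<dots>\<close>: the last one of a block of three belongs to an upper queen, and no other does.
  The first two of a block are known to be clear of upper queens even if the type is unknown.\<close>

fun antis_above :: "bool option list \<Rightarrow> bool option list" where
  "antis_above [] = []"
| "antis_above (None # ts) = [Some False, Some False]"
| "antis_above (Some u # ts) =
     Some False # Some False # (if u then Some True # antis_above ts else antis_above ts)"

text \<open>The antidiagonals \<open>anti_end j, anti_end j - 1, \<dots>\<close>, given the types of columns \<open>j, j - 1, \<dots>\<close>.\<close>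

fun antis_below :: "bool option list \<Rightarrow> bool option list" where
  "antis_below [] = []"
| "antis_below (None # ts) = []"
| "antis_below (Some u # ts) =
     (if u then Some True # Some False # Some False # antis_below ts
      else Some False # Some False # antis_below ts)"

text \<open>The antidiagonals from \<open>anti_end p - 4\<close> to \<open>anti_end p + 4\<close>, given the types around column \<open>p\<close>.\<close>

definition upper_antis :: "bool option list \<Rightarrow> bool option list" where
  "upper_antis ts =
     rev (take 5 (antis_below (rev (take 4 ts)) @ [None, None, None, None, None])) @
     take 4 (antis_above (drop 4 ts) @ [None, None, None, None])"

text \<open>Whether a cell is free, as far as this is known.\<close>

definition cell :: "bool \<Rightarrow> bool \<Rightarrow> bool \<Rightarrow> bool option \<Rightarrow> bool option \<Rightarrow> bool option" where
  "cell r d a k x =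
     (if r \<or> d \<or> a \<or> k = Some True \<or> x = Some True then Some False
      else if k = Some False \<and> x = Some False then Some True else None)"

text \<open>The greedy choice among the eight cells: \<open>Some None\<close> if all are attacked, \<open>None\<close> if the knowledge
  does not decide the choice.\<close>

fun first_free :: "bool option list \<Rightarrow> nat option option" where
  "first_free [] = Some None"
| "first_free (None # cs) = None"
| "first_free (Some free # cs) =
     (if free then Some (Some 0) else map_option (map_option Suc) (first_free cs))"

fun cells :: "bool option list \<Rightarrow> bool option list \<Rightarrow> board \<Rightarrow> bool option list" where
  "cells ks xs (R, D, A) =
     map (\<lambda>(r, d, a, k, x). cell r d a k x) (zip R (zip D (zip A (zip ks xs))))"

fun place :: "nat option \<Rightarrow> board \<Rightarrow> board" where
  "place None B = B"
| "place (Some i) (R, D, A) = (R[i := True], D[i := True], A[i := True])"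

text \<open>The next column is the second child of the same parent. The rows in view stay the same, each cell moves to
  the next diagonal and antidiagonal. The diagonal that drops out of view must be occupied, and the one
  that comes into view is still free.\<close>

fun stay :: "board \<Rightarrow> board \<Rightarrow> bool" where
  "stay B (R, D, A) \<longleftrightarrow> last D \<and> B = (R, False # butlast D, tl A @ [False])"

text \<open>The next column is a first child, so the parent moves on by one and the rows in view with it. The row that drops out
  of view must be occupied. Diagonals stay in place and antidiagonals move by two.\<close>

fun advance :: "bool option list \<Rightarrow> board \<Rightarrow> nat \<Rightarrow> bool" where
  "advance ks (R, D, A) b \<longleftrightarrow> (hd R \<or> hd ks = Some True) \<and>
     board_of (first_child b) = (tl R @ [False], D, drop 2 A @ [False, False])"

definition advance_all :: "nat \<Rightarrow> board \<Rightarrow> bool" where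
  "advance_all a B \<longleftrightarrow> list_all (advance (kinds_of a) B) (successors a)"

fun tally :: "bool list \<Rightarrow> nat" where
  "tally [] = 0"
| "tally (x # xs) = (if x then Suc (tally xs) else tally xs)"

definition diags_used :: "nat \<Rightarrow> nat" where
  "diags_used a = tally (fst (snd (board_of a)))"

text \<open>If \<open>m\<close> of the eight diagonals in view are occupied, then \<open>U (n - 1) = parent n + 4 - m\<close>, so a queen in
  row \<open>parent n - 3 + i\<close> is in row \<open>U n + (i + m - 7)\<close>.\<close>

fun offset_ok :: "nat option \<Rightarrow> nat \<Rightarrow> bool" where
  "offset_ok None m \<longleftrightarrow> True"
| "offset_ok (Some i) m \<longleftrightarrow> 5 \<le> i + m \<and> i + m \<le> 11"

text \<open>One column of the greedy rule: letter \<open>c\<close> is the child of letter \<open>a\<close>, and \<open>early\<close> says that it is the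
  first of two. In that case the antidiagonal of the cell in row \<open>p\<close>, where \<open>p\<close> is the parent, is
  \<open>anti_end p - 1\<close>; otherwise it is \<open>anti_end p\<close>, and the list of antidiagonals is shifted by one.\<close>

definition column_ok :: "nat \<Rightarrow> bool \<Rightarrow> nat \<Rightarrow> (board \<Rightarrow> bool) \<Rightarrow> bool" where
  "column_ok a early c next \<longleftrightarrow>
     (case first_free (cells (kinds_of a)
         (if early then upper_antis (types_of a) else tl (upper_antis (types_of a))) (board_of c)) of
        None \<Rightarrow> False
      | Some q \<Rightarrow> (q = None) = two_children c \<and> offset_ok q (diags_used c) \<and> next (place q (board_of c)))"

text \<open>This is \<^const>\<open>of_bool\<close> with values in unary, the form in which \<^const>\<open>tally\<close> counts.\<close>

definition as_count :: "bool \<Rightarrow> nat" where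
  "as_count b = (if b then Suc 0 else 0)"

text \<open>This is the bound \<open>-3 \<le> lag m \<le> 2\<close> with \<open>lag m = U z - U j + 6 - s - v\<close>, where \<open>z\<close> is the
  grandparent of \<open>m + 1\<close>, \<open>j = L m\<close> and \<open>j = z + s - 2\<close>. The difference \<open>U z - U j\<close> is computed from the types of the
  columns between \<open>j\<close> and \<open>z\<close>, which is why the cases differ.\<close>

definition lag_within :: "nat \<Rightarrow> nat \<Rightarrow> bool option list \<Rightarrow> bool" where
  "lag_within s v ts \<longleftrightarrow>
     (case s of
        0 \<Rightarrow> (case hd (drop 2 ts) of None \<Rightarrow> False
          | Some u \<Rightarrow> (case hd (drop 3 ts) of None \<Rightarrow> False
              | Some u' \<Rightarrow> 4 + as_count u + as_count u' \<le> v \<and> v \<le> 9 + as_count u + as_count u'))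
      | Suc s1 \<Rightarrow> (case s1 of
        0 \<Rightarrow> (case hd (drop 3 ts) of None \<Rightarrow> False
          | Some u \<Rightarrow> 3 + as_count u \<le> v \<and> v \<le> 8 + as_count u)
      | Suc s2 \<Rightarrow> (case s2 of
        0 \<Rightarrow> 2 \<le> v \<and> v \<le> 7
      | Suc s3 \<Rightarrow> s3 = 0 \<and> (case hd (drop 4 ts) of None \<Rightarrow> False
          | Some u \<Rightarrow> Suc 0 \<le> v + as_count u \<and> v + as_count u \<le> 6))))"

text \<open>Three generations enter: column \<open>m + 1\<close> has letter \<open>c\<close>, its parent has letter \<open>a\<close> and its
  grandparent has letter \<open>z\<close>. The occupied diagonals of \<open>a\<close> and \<open>c\<close> give \<open>U\<close> just before these columns, hence \<open>L m\<close>
  relative to the grandparent.\<close>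

definition lag_ok :: "nat \<Rightarrow> bool \<Rightarrow> nat \<Rightarrow> bool \<Rightarrow> nat \<Rightarrow> bool" where
  "lag_ok z early a early' c \<longleftrightarrow>
     diags_used a + as_count early' \<le> Suc (diags_used c + as_count (two_children a)) \<and>
     lag_within (Suc (diags_used c + as_count (two_children a)) - (diags_used a + as_count early'))
       (diags_used c + as_count early) (types_of z)"

definition lags_ok :: "nat \<Rightarrow> bool \<Rightarrow> nat \<Rightarrow> bool" where
  "lags_ok z early a \<longleftrightarrow>
     lag_ok z early a (two_children a) (first_child a) \<and>
     (two_children a \<longrightarrow> lag_ok z early a False (second_child a))"

definition steps_ok :: "nat \<Rightarrow> bool" where
  "steps_ok a \<longleftrightarrow>
     list_all (\<lambda>b. 7 \<le> b) (successors a) \<and>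
     (if two_children a
      then column_ok a True (first_child a) (stay (board_of (second_child a))) \<and>
        column_ok a False (second_child a) (advance_all a) \<and>
        lags_ok a True (first_child a) \<and> lags_ok a False (second_child a)
      else column_ok a False (first_child a) (advance_all a) \<and> lags_ok a False (first_child a))"

definition letter_ok :: "nat \<Rightarrow> bool" where
  "letter_ok a \<longleftrightarrow> consistent a \<and> steps_ok a"

lemma Suc_not_le_0: "(Suc n \<le> 0) = False"
  by simp

lemma take_drop_numeral:
  "take (numeral k) (x # xs) = x # take (pred_numeral k) xs"
  "drop (numeral k) (x # xs) = drop (pred_numeral k) xs"
  by (simp_all add: numeral_eq_Suc)

lemmas check_simps =
  num.inject num.distinct numeral_eq_iff zero_neq_numeral numeral_neq_zero
  numeral_eq_one_iff one_eq_numeral_iff zero_neq_one one_neq_zero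
  le_num_simps less_num_simps numeral_le_iff numeral_less_iff numeral_le_one_iff
  not_numeral_le_zero zero_less_numeral one_less_numeral_iff
  le_numeral_Suc le_Suc_numeral Suc_eq_numeral pred_numeral_simps Num.BitM.simps
  Suc_le_mono le0 Suc_not_le_0 add_Suc add_Suc_right add_0 add_0_right
  diff_Suc_Suc minus_nat.diff_0 diff_0_eq_0
  simp_thms if_True if_False option.distinct option.inject option.case option.map
  prod.inject fst_conv snd_conv prod.case nat.case
  list.sel list.distinct list.inject list.set list.map list.size(3,4) list.pred_inject
  insert_iff empty_iff append.simps rev.simps last.simps butlast.simps
  take_drop_numeral take_0 drop_0 take_Nil drop_Nil zip_Cons_Cons zip_Nil
  list_update_code list_all2_Cons list_all2_Nil
  board_of_def kinds_of_def types_of_def children_def successors_def first_child_def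
  second_child_def two_children_def last_child_def claims_in_def claims_pass_def
  centre_def followed_by_def consistent_def antis_above.simps antis_below.simps
  upper_antis_def cell_def first_free.simps cells.simps place.simps stay.simps
  advance.simps advance_all_def tally.simps diags_used_def offset_ok.simps column_ok_def
  as_count_def lag_within_def lag_ok_def lags_ok_def steps_ok_def letter_ok_def

lemmas check_congs =
  if_weak_cong option.case_cong_weak nat.case_cong_weak prod.case_cong_weak

lemmas upt_simps =
  upt_rec_numeral Suc_numerals Num.inc.simps less_num_simps le_num_simps numeral_less_iff
  if_True if_False

lemma early_letters_consistent:
  "consistent 0" "consistent 1" "consistent 2" "consistent 3" "consistent 4" "consistent 5" "consistent 6"
  by (simp_all only: letters_nth boards_nth windows_nth check_simps cong: check_congs)

text \<open>This evaluates one column of the greedy rule for every child of each letter and each letter that may follow.\<close>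

lemma letters_ok: "list_all letter_ok [7..<1919]"
  by (simp only: upt_simps cong: if_weak_cong)
     (simp only: letters_nth boards_nth windows_nth check_simps cong: check_congs)

section \<open>Labelling columns with letters\<close>

text \<open>A column is also a row, so it lies in the block of its parent and inherits its letter from there. That this
  labelling, which refers to the letter table alone once the parents are known, predicts the types of
  the columns is what the induction has to prove.\<close>

function letter :: "nat \<Rightarrow> nat" where
  "letter n = (if n \<le> 1 then 0
     else if upper_row n then second_child (letter (parent n)) else first_child (letter (parent n)))"
  by auto
termination by (relation "measure id") (auto simp: parent_less)

declare letter.simps [simp del]

text \<open>The labelling is right about the types of the columns before \<open>m\<close>.\<close>

definition typed :: "nat \<Rightarrow> bool" where
  "typed m \<longleftrightarrow> (\<forall>j. 1 \<le> j \<and> j < m \<longrightarrow> (two_children (letter j) \<longleftrightarrow> queens j > j))"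

lemma typedD: "typed m \<Longrightarrow> 1 \<le> j \<Longrightarrow> j < m \<Longrightarrow> two_children (letter j) \<longleftrightarrow> queens j > j"
  unfolding typed_def by blast

lemma typed_mono: "typed m \<Longrightarrow> k \<le> m \<Longrightarrow> typed k"
  unfolding typed_def by simp

lemma list_all_upt: "list_all P [m..<n] \<Longrightarrow> m \<le> a \<Longrightarrow> a < n \<Longrightarrow> P a"
  by (simp add: list_all_iff)

lemma letter_ok_ge_7: "7 \<le> a \<Longrightarrow> a < 1919 \<Longrightarrow> letter_ok a"
  by (rule list_all_upt[OF letters_ok])

lemma consistent_letter: "a < 1919 \<Longrightarrow> consistent a"
proof -
  assume a: "a < 1919"
  consider "7 \<le> a" | "a = 0" | "a = 1" | "a = 2" | "a = 3" | "a = 4" | "a = 5" | "a = 6"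
    by linarith
  then show "consistent a"
  proof cases
    case 1
    then show ?thesis using letter_ok_ge_7[OF 1 a] unfolding letter_ok_def by blast
  qed (simp_all only: early_letters_consistent)
qed

lemma steps_ok_letter: "7 \<le> a \<Longrightarrow> a < 1919 \<Longrightarrow> steps_ok a"
  using letter_ok_ge_7 unfolding letter_ok_def by blast

lemma root_children: "first_child 0 = 0" "two_children 0"
  by (simp_all only: letters_nth check_simps cong: check_congs)

lemma letter_less:
  assumes "typed m" "1 \<le> n" "n \<le> m"
  shows "letter n < 1919"
  using assms(2,3)
proof (induction n rule: less_induct)
  case (less n)
  show ?case
  proof (cases "n = 1")
    case True
    then show ?thesis by (simp add: letter.simps)
  next
    case False
    then have n: "2 \<le> n" using less.prems by simp
    let ?p = "parent n"
    have p: "1 \<le> ?p" "?p < n" using parent_bounds(1)[of n] parent_less[OF n] n by simp_all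
    then have l: "letter ?p < 1919" using less.IH[of ?p] less.prems by simp
    then have c: "children (letter ?p) \<noteq> []" "\<And>c. c \<in> set (children (letter ?p)) \<Longrightarrow> c < 1919"
      using consistent_letter[OF l] by (auto simp: consistent_def list_all_iff)
    have "two_children (letter ?p)" if "upper_row n"
      using that upper_row_iff[of n] typedD[OF assms(1), of ?p] p less.prems by simp
    then have "upper_row n \<Longrightarrow> second_child (letter ?p) \<in> set (children (letter ?p))"
      using c(1) by (cases "children (letter ?p)") (auto simp: two_children_def second_child_def)
    moreover have "first_child (letter ?p) \<in> set (children (letter ?p))"
      using c(1) by (simp add: first_child_def)
    ultimately show ?thesis using n c(2) by (subst letter.simps) auto
  qed
qed

lemma letter_1: "letter (Suc 0) = 0"
  by (simp add: letter.simps)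

lemma parent_1: "parent (Suc 0) = Suc 0"
  by (rule parent_eqI) (simp_all add: row_end_Suc[of 0, simplified])

lemma letter_first:
  assumes "1 \<le> n" "\<not> upper_row n"
  shows "letter n = first_child (letter (parent n))"
proof (cases "n = 1")
  case True
  then show ?thesis by (simp add: letter_1 parent_1 root_children)
next
  case False
  then show ?thesis using assms by (simp add: letter.simps[of n])
qed

lemma not_upper_row_1: "\<not> upper_row (Suc 0)"
  using upper_row_iff[of "Suc 0"] row_end_Suc[of 0] by (simp add: parent_1)

lemma letter_second:
  assumes "1 \<le> n" "upper_row n"
  shows "letter n = second_child (letter (parent n))"
proof -
  have "n \<noteq> 1" using assms not_upper_row_1 by auto
  then show ?thesis using assms by (simp add: letter.simps[of n])
qed

lemma letter_row_end:
  assumes "typed m" "1 \<le> n" "n = row_end (parent n)" "parent n < m"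
  shows "letter n = last_child (letter (parent n))"
  using assms letter_first[of n] letter_second[of n] upper_row_iff[of n] typedD[OF assms(1), of "parent n"]
    parent_bounds(1)[of n] by (auto simp: last_child_def)

lemma not_upper_row_Suc_row_end: "1 \<le> n \<Longrightarrow> n = row_end (parent n) \<Longrightarrow> \<not> upper_row (Suc n)"
proof
  assume n: "1 \<le> n" "n = row_end (parent n)" and "upper_row (Suc n)"
  have p: "parent (Suc n) = Suc (parent n)" using parent_Suc[OF n(1)] n(2) by simp
  then have "queens (Suc (parent n)) > Suc (parent n)" "Suc n = row_end (Suc (parent n))"
    using \<open>upper_row (Suc n)\<close> upper_row_iff[of "Suc n"] by simp_all
  then show False using n(2) row_end_Suc[of "parent n"] by simp
qed

lemma consistentD:
  assumes "consistent a"
  shows "length (kinds_of a) = 8" "length (types_of a) = 8"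
    "centre (types_of a) = Some (two_children a)"
    "centre (kinds_of (first_child a)) = Some False"
    "two_children a \<Longrightarrow> centre (kinds_of (second_child a)) = Some True"
    "two_children a \<Longrightarrow> second_child a \<in> set (successors (first_child a))"
    "b \<in> set (successors a) \<Longrightarrow> followed_by a b"
  using assms by (auto simp: consistent_def list_all_iff)

text \<open>Consecutive columns are siblings, or the last and the first child of consecutive columns. In the latter case
  the claim follows from the same claim about the parents, which are smaller. For column 1, its own parent, the
  next column is a sibling.\<close>

lemma letter_Suc:
  assumes "typed m" "1 \<le> n" "n < m"
  shows "letter (Suc n) \<in> set (successors (letter n))"
  using assms(2,3)
proof (induction n rule: less_induct)
  case (less n)
  let ?p = "parent n"
  note p = parent_bounds[OF less.prems(1)]
  have pn: "?p \<le> n" using parent_less[of n] less.prems parent_1 by (cases "n = 1") auto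
  have cons: "consistent (letter k)" if "1 \<le> k" "k \<le> m" for k
    using consistent_letter[OF letter_less[OF assms(1) that]] .
  show ?case
  proof (cases "n = row_end ?p")
    case False
    then have q: "n + 1 = row_end ?p" "queens ?p > ?p" using row_end_parent[OF less.prems(1)] by auto
    then have ps: "parent (Suc n) = ?p" using parent_Suc[OF less.prems(1)] by simp
    have "upper_row (Suc n)" using upper_row_iff[of "Suc n"] ps q by simp
    moreover have "\<not> upper_row n" using upper_row_iff[OF less.prems(1)] q by simp
    moreover have "two_children (letter ?p)" using typedD[OF assms(1) p(1)] pn less.prems q(2) by simp
    ultimately show ?thesis
      using letter_first[OF less.prems(1)] letter_second[of "Suc n"] ps cons[OF p(1)] pn less.prems consistentD(6)
      by simp
  next
    case True
    then have ps: "parent (Suc n) = Suc ?p" using parent_Suc[OF less.prems(1)] by simp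
    have "n \<noteq> 1"
    proof
      assume "n = 1"
      then show False using True parent_1 by (simp add: row_end_def upper_count_1)
    qed
    then have pn': "?p < n" using parent_less[of n] less.prems by simp
    have "letter (Suc ?p) \<in> set (successors (letter ?p))" using less.IH[OF pn' p(1)] pn' less.prems by simp
    then have "followed_by (letter ?p) (letter (Suc ?p))" using cons[OF p(1)] pn' less.prems consistentD(7) by simp
    moreover have "letter n = last_child (letter ?p)" using letter_row_end[OF assms(1) less.prems(1) True] pn' less.prems by simp
    moreover have "letter (Suc n) = first_child (letter (Suc ?p))"
      using letter_first[of "Suc n"] not_upper_row_Suc_row_end[OF less.prems(1) True] ps by simp
    ultimately show ?thesis by (simp add: followed_by_def)
  qed
qed

section \<open>Claims about neighbouring columns\<close>

lemma claims_in_nth: "claims_in xs ys \<Longrightarrow> i < length xs \<Longrightarrow> xs ! i = Some v \<Longrightarrow> ys ! i = Some v"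
  unfolding claims_in_def by (drule (1) list_all2_nthD) simp

lemma claims_pass_up:
  assumes "claims_pass xs ys" "length xs = 8" "length ys = 8" "3 \<le> i" "i < 7" "xs ! Suc i = Some v"
  shows "ys ! i = Some v"
proof -
  have "take 4 (drop 3 ys) ! (i - 3) = Some v"
    by (rule claims_in_nth[of "drop 4 xs"]) (use assms in \<open>auto simp: claims_pass_def\<close>)
  then show ?thesis using assms by simp
qed

lemma claims_pass_down:
  assumes "claims_pass xs ys" "length xs = 8" "length ys = 8" "i < 3" "ys ! i = Some v"
  shows "xs ! Suc i = Some v"
proof -
  have "take 3 (tl xs) ! i = Some v"
    by (rule claims_in_nth[of "take 3 ys"]) (use assms in \<open>auto simp: claims_pass_def\<close>)
  then show ?thesis using assms by (simp add: nth_tl)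
qed

text \<open>A claim about another column is passed on step by step until it has become a claim of that column about
  itself.\<close>

lemma claims_true:
  fixes W :: "nat \<Rightarrow> 'a option list"
  assumes pass: "\<And>c. 1 \<le> c \<Longrightarrow> c < m \<Longrightarrow> claims_pass (W c) (W (Suc c))"
    and len: "\<And>c. 1 \<le> c \<Longrightarrow> c \<le> m \<Longrightarrow> length (W c) = 8"
    and centre: "\<And>c v. 1 \<le> c \<Longrightarrow> c \<le> m \<Longrightarrow> W c ! 3 = Some v \<Longrightarrow> f c = v"
    and c: "1 \<le> c" "c \<le> m" "4 \<le> c + i" "c + i \<le> m + 3" "i < 8" "W c ! i = Some v"
  shows "f (c + i - 3) = v"
proof (cases "3 \<le> i")
  case True
  have "1 \<le> c \<Longrightarrow> c + k \<le> m \<Longrightarrow> k + 3 < 8 \<Longrightarrow> W c ! (k + 3) = Some v \<Longrightarrow> f (c + k) = v" for c k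
  proof (induction k arbitrary: c)
    case 0
    then show ?case using centre[of c] by simp
  next
    case (Suc k)
    then have "W (Suc c) ! (k + 3) = Some v"
      using claims_pass_up[OF pass[of c] len[of c] len[of "Suc c"]] by simp
    then show ?case using Suc.IH[of "Suc c"] Suc.prems by simp
  qed
  from this[of c "i - 3"] show ?thesis using True c by simp
next
  case False
  have "k < c \<Longrightarrow> c \<le> m \<Longrightarrow> k \<le> 3 \<Longrightarrow> W c ! (3 - k) = Some v \<Longrightarrow> f (c - k) = v" for c k
  proof (induction k arbitrary: c)
    case 0
    then show ?case using centre[of c] by simp
  next
    case (Suc k)
    then obtain d where d: "c = Suc d" by (cases c) auto
    have k: "Suc (3 - Suc k) = 3 - k" using Suc.prems by simp
    have "W d ! Suc (3 - Suc k) = Some v"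
      using claims_pass_down[OF pass[of d] len[of d] len[of "Suc d"], of "3 - Suc k"] Suc.prems d by simp
    then have "W d ! (3 - k) = Some v" unfolding k .
    then show ?case using Suc.IH[of d] Suc.prems d by simp
  qed
  from this[of "3 - i" c] show ?thesis using False c by simp
qed

lemma centre_nth: "length xs = 8 \<Longrightarrow> centre xs = xs ! 3"
  by (simp add: centre_def hd_drop_conv_nth)

lemma types_true:
  assumes "typed m" "1 \<le> c" "c < m" "4 \<le> c + i" "c + i < m + 3" "i < 8" "types_of (letter c) ! i = Some v"
  shows "(queens (c + i - 3) > c + i - 3) = v"
proof (rule claims_true[where W = "\<lambda>c. types_of (letter c)" and m = "m - 1" and f = "\<lambda>c. queens c > c"])
  have cons: "consistent (letter k)" if "1 \<le> k" "k \<le> m - 1" for k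
    using consistent_letter[OF letter_less[OF assms(1) that(1)]] that by simp
  show "length (types_of (letter k)) = 8" if "1 \<le> k" "k \<le> m - 1" for k
    using consistentD(2)[OF cons[OF that]] .
  show "claims_pass (types_of (letter k)) (types_of (letter (Suc k)))" if "1 \<le> k" "k < m - 1" for k
    using consistentD(7)[OF cons[of k] letter_Suc[OF assms(1), of k]] that by (simp add: followed_by_def)
  show "(queens k > k) = v" if "1 \<le> k" "k \<le> m - 1" "types_of (letter k) ! 3 = Some v" for k v
    using consistentD(2,3)[OF cons[OF that(1,2)]] that typedD[OF assms(1), of k] by (simp add: centre_nth)
qed (use assms in auto)

lemma kinds_true:
  assumes "typed m" "1 \<le> c" "c < m" "4 \<le> c + i" "c + i < m + 3" "i < 8" "kinds_of (letter c) ! i = Some v"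
  shows "upper_row (c + i - 3) = v"
proof (rule claims_true[where W = "\<lambda>c. kinds_of (letter c)" and m = "m - 1" and f = upper_row])
  have cons: "consistent (letter k)" if "1 \<le> k" "k \<le> m - 1" for k
    using consistent_letter[OF letter_less[OF assms(1) that(1)]] that by simp
  show len: "length (kinds_of (letter k)) = 8" if "1 \<le> k" "k \<le> m - 1" for k
    using consistentD(1)[OF cons[OF that]] .
  show "claims_pass (kinds_of (letter k)) (kinds_of (letter (Suc k)))" if "1 \<le> k" "k < m - 1" for k
    using consistentD(7)[OF cons[of k] letter_Suc[OF assms(1), of k]] that by (simp add: followed_by_def)
  show "upper_row k = v" if k: "1 \<le> k" "k \<le> m - 1" "kinds_of (letter k) ! 3 = Some v" for k v
  proof -
    let ?p = "parent k"
    have p: "1 \<le> ?p" "?p \<le> k" using parent_bounds(1)[OF k(1)] parent_less[of k] parent_1 k(1) by (cases "k = 1"; auto)+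
    have cp: "consistent (letter ?p)" using cons p k by simp
    have v: "centre (kinds_of (letter k)) = Some v" using k(3) len[OF k(1,2)] by (simp add: centre_nth)
    show ?thesis
    proof (cases "upper_row k")
      case True
      then have "two_children (letter ?p)"
        using upper_row_iff[OF k(1)] typedD[OF assms(1), of ?p] p k by simp
      then show ?thesis using True v letter_second[OF k(1) True] consistentD(5)[OF cp] by simp
    next
      case False
      then show ?thesis using v letter_first[OF k(1) False] consistentD(4)[OF cp] by simp
    qed
  qed
qed (use assms in auto)

section \<open>Upper antidiagonals from types\<close>

text \<open>Each column contributes a block of two or three antidiagonals, and the induction removes one block at a time.\<close>

lemma antis_above_true:
  assumes "\<And>i v. i < length ts \<Longrightarrow> ts ! i = Some v \<Longrightarrow> (queens (j + 1 + i) > j + 1 + i) = v"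
    and "k < length (antis_above ts)" "antis_above ts ! k = Some v"
  shows "upper_anti (anti_end j + 1 + k) = v"
  using assms
proof (induction ts arbitrary: j k rule: antis_above.induct)
  case (2 ts)
  have "\<not> upper_anti (anti_end j + 1 + k)" if "k < 2"
    using upper_anti_iff[of "Suc j" "anti_end j + 1 + k"] that by (auto simp: anti_end_Suc)
  moreover have "k < 2" using "2.prems"(2) by simp
  moreover have "v = False" using "2.prems"(3) \<open>k < 2\<close> by (auto simp: less_2_cases_iff)
  ultimately show ?case by simp
next
  case (3 u ts)
  have u: "(queens (Suc j) > Suc j) = u" using "3.prems"(1)[of 0 u] by simp
  define l where "l = (if u then 3 else 2 :: nat)"
  have l: "anti_end (Suc j) = anti_end j + l" using u by (simp add: anti_end_Suc l_def)
  show ?case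
  proof (cases "k < l")
    case True
    have "upper_anti (anti_end j + 1 + k) \<longleftrightarrow> u \<and> anti_end j + 1 + k = anti_end (Suc j)"
      using upper_anti_iff[of "Suc j" "anti_end j + 1 + k"] True u by (simp add: l)
    moreover have "v \<longleftrightarrow> u \<and> k + 1 = l"
      using "3.prems"(3) True unfolding l_def
      by (cases u; cases k; cases "k - 1") (auto simp: numeral_eq_Suc)
    ultimately show ?thesis using l by auto
  next
    case False
    then have k: "antis_above ts ! (k - l) = Some v" "k - l < length (antis_above ts)"
      using "3.prems"(2,3) unfolding l_def by (auto simp: nth_Cons' numeral_2_eq_2 numeral_3_eq_3 split: if_splits)
    have "upper_anti (anti_end (Suc j) + 1 + (k - l)) = v"
    proof (cases u)
      case True
      show ?thesis
        using "3.IH"(1)[OF True _ k(2,1), of "Suc j"] "3.prems"(1)[of "Suc i" for i] by fastforce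
    next
      case False
      show ?thesis
        using "3.IH"(2)[OF False _ k(2,1), of "Suc j"] "3.prems"(1)[of "Suc i" for i] by fastforce
    qed
    then show ?thesis using False by (simp add: l)
  qed
qed simp

lemma antis_below_true:
  assumes "\<And>i v. i < length ts \<Longrightarrow> ts ! i = Some v \<Longrightarrow> (queens (j - i) > j - i) = v"
    and "length ts \<le> j"
    and "k < length (antis_below ts)" "antis_below ts ! k = Some v"
  shows "upper_anti (anti_end j - k) = v"
  using assms
proof (induction ts arbitrary: j k rule: antis_below.induct)
  case (3 u ts)
  then obtain h where h: "j = Suc h" by (cases j) auto
  have u: "(queens j > j) = u" using "3.prems"(1)[of 0 u] by simp
  define l where "l = (if u then 3 else 2 :: nat)"
  have l: "anti_end j = anti_end h + l" using u by (simp add: anti_end_Suc l_def h)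
  have hj: "h = j - 1" "1 \<le> j" using h by simp_all
  show ?case
  proof (cases "k < l")
    case True
    have "upper_anti (anti_end j - k) \<longleftrightarrow> u \<and> anti_end j - k = anti_end j"
      using upper_anti_iff[of j "anti_end j - k"] True u l hj by simp
    moreover have "v \<longleftrightarrow> u \<and> k = 0"
      using "3.prems"(4) True unfolding l_def
      by (cases u; cases k; cases "k - 1") (auto simp: numeral_eq_Suc)
    ultimately show ?thesis using l by (auto simp: l_def)
  next
    case False
    then have k: "antis_below ts ! (k - l) = Some v" "k - l < length (antis_below ts)"
      using "3.prems"(3,4) unfolding l_def by (auto simp: nth_Cons' numeral_2_eq_2 numeral_3_eq_3 split: if_splits)
    have len: "length ts \<le> h" using "3.prems"(2) h by simp
    have ty: "(queens (h - i) > h - i) = v" if "i < length ts" "ts ! i = Some v" for i v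
      using "3.prems"(1)[of "Suc i" v] that h by simp
    have "upper_anti (anti_end h - (k - l)) = v"
    proof (cases u)
      case True
      show ?thesis by (rule "3.IH"(1)[OF True ty len k(2,1)])
    next
      case False
      show ?thesis by (rule "3.IH"(2)[OF False ty len k(2,1)])
    qed
    then show ?thesis using False by (simp add: l)
  qed
qed simp_all

lemma length_upper_antis: "length (upper_antis ts) = 9"
  by (simp add: upper_antis_def)

lemma upper_antis_true:
  assumes ty: "\<And>i v. i < 8 \<Longrightarrow> ts ! i = Some v \<Longrightarrow> (queens (p + i - 3) > p + i - 3) = v"
    and len: "length ts = 8" and p: "4 \<le> p"
    and m: "m < 9" "upper_antis ts ! m = Some v"
  shows "upper_anti (anti_end p + m - 4) = v"
proof (cases "m < 5")
  case True
  define bs where "bs = antis_below (rev (take 4 ts))"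
  define xs where "xs = take 5 (bs @ [None, None, None, None, None])"
  have "length xs = 5" by (simp add: xs_def)
  moreover have "upper_antis ts = rev xs @ take 4 (antis_above (drop 4 ts) @ [None, None, None, None])"
    by (simp only: upper_antis_def xs_def bs_def)
  ultimately have "xs ! (4 - m) = Some v"
    using m True by (simp add: nth_append rev_nth)
  then have "(bs @ [None, None, None, None, None]) ! (4 - m) = Some v"
    unfolding xs_def by (subst (asm) nth_take) simp_all
  moreover have "([None, None, None, None, None] :: bool option list) ! i \<noteq> Some v" if "i < 5" for i
    using that by (auto simp: less_Suc_eq numeral_eq_Suc)
  ultimately have k: "4 - m < length bs" "bs ! (4 - m) = Some v"
    by (auto simp: nth_append split: if_splits)
  have "(queens (p - i) > p - i) = w" if "i < length (rev (take 4 ts))" "rev (take 4 ts) ! i = Some w" for i w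
    using ty[of "3 - i" w] that len p by (simp add: rev_nth)
  then have "upper_anti (anti_end p - (4 - m)) = v"
    using antis_below_true[of "rev (take 4 ts)" p "4 - m" v] k p unfolding bs_def by auto
  moreover have "anti_end p - (4 - m) = anti_end p + m - 4"
    using True p by (simp add: anti_end_def)
  ultimately show ?thesis by simp
next
  case False
  define as where "as = antis_above (drop 4 ts)"
  define xs where "xs = rev (take 5 (antis_below (rev (take 4 ts)) @ [None, None, None, None, None]))"
  have "length xs = 5" by (simp add: xs_def)
  moreover have "upper_antis ts = xs @ take 4 (as @ [None, None, None, None])"
    by (simp only: upper_antis_def xs_def as_def)
  ultimately have "take 4 (as @ [None, None, None, None]) ! (m - 5) = Some v"
    using m False by (simp only: nth_append) simp
  then have "(as @ [None, None, None, None]) ! (m - 5) = Some v"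
    using m by (subst (asm) nth_take) simp_all
  moreover have "([None, None, None, None] :: bool option list) ! i \<noteq> Some v" if "i < 4" for i
    using that by (auto simp: less_Suc_eq numeral_eq_Suc)
  ultimately have k: "m - 5 < length as" "as ! (m - 5) = Some v"
    using m by (auto simp: nth_append split: if_splits)
  have "(queens (p + 1 + i) > p + 1 + i) = w" if "i < length (drop 4 ts)" "drop 4 ts ! i = Some w" for i w
    using ty[of "4 + i" w] that len by (simp add: algebra_simps)
  then have "upper_anti (anti_end p + 1 + (m - 5)) = v"
    using antis_above_true[of "drop 4 ts" p "m - 5" v] k unfolding as_def by auto
  moreover have "anti_end p + 1 + (m - 5) = anti_end p + m - 4"
    using False by simp
  ultimately show ?thesis by (simp only:)
qed

section \<open>Boards\<close>

text \<open>The board is read relative to three bases: row \<open>b\<close>, diagonal \<open>e + 7\<close> and antidiagonal \<open>s\<close> belong to entry 0.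
  For the column \<open>n = b + e + 7\<close> and \<open>s = n + b\<close> entry \<open>i\<close> describes the cell in row \<open>b + i\<close>; keeping the bases
  independent makes it possible to place the queen first and to move the bases afterwards. The remaining conditions say that
  nothing outside the view is in doubt: rows below it and smaller diagonals are
  occupied, larger rows, diagonals and antidiagonals are not.\<close>

fun represents :: "nat \<Rightarrow> nat \<Rightarrow> nat \<Rightarrow> nat \<Rightarrow> board \<Rightarrow> bool" where
  "represents n b e s (R, D, A) \<longleftrightarrow>
     length R = 8 \<and> length D = 8 \<and> length A = 8 \<and>
     (\<forall>i<8. R ! i \<longleftrightarrow> lower_row n (b + i)) \<and>
     (\<forall>i<8. D ! i \<longleftrightarrow> lower_diag n (e + 7 - i)) \<and>
     (\<forall>i<8. A ! i \<longleftrightarrow> lower_anti n (s + i)) \<and>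
     (\<forall>y. 0 < y \<and> y < b \<longrightarrow> lower_row n y \<or> upper_row y) \<and>
     (\<forall>y. lower_row n y \<longrightarrow> y < b + 8) \<and>
     (\<forall>d. 0 < d \<and> d < e \<longrightarrow> lower_diag n d) \<and>
     (\<forall>d. lower_diag n d \<longrightarrow> d < e + 8) \<and>
     (\<forall>x. lower_anti n x \<longrightarrow> x < s + 8)"

lemma representsD:
  assumes "represents n b e s (R, D, A)"
  shows "length R = 8" "length D = 8" "length A = 8"
    "\<And>i. i < 8 \<Longrightarrow> R ! i \<longleftrightarrow> lower_row n (b + i)"
    "\<And>i. i < 8 \<Longrightarrow> D ! i \<longleftrightarrow> lower_diag n (e + 7 - i)"
    "\<And>i. i < 8 \<Longrightarrow> A ! i \<longleftrightarrow> lower_anti n (s + i)"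
    "\<And>y. 0 < y \<Longrightarrow> y < b \<Longrightarrow> lower_row n y \<or> upper_row y"
    "\<And>y. lower_row n y \<Longrightarrow> y < b + 8"
    "\<And>d. 0 < d \<Longrightarrow> d < e \<Longrightarrow> lower_diag n d"
    "\<And>d. lower_diag n d \<Longrightarrow> d < e + 8"
    "\<And>x. lower_anti n x \<Longrightarrow> x < s + 8"
  using assms by simp_all

lemma representsI:
  assumes "length R = 8" "length D = 8" "length A = 8"
    "\<And>i. i < 8 \<Longrightarrow> R ! i \<longleftrightarrow> lower_row n (b + i)"
    "\<And>i. i < 8 \<Longrightarrow> D ! i \<longleftrightarrow> lower_diag n (e + 7 - i)"
    "\<And>i. i < 8 \<Longrightarrow> A ! i \<longleftrightarrow> lower_anti n (s + i)"
    "\<And>y. 0 < y \<Longrightarrow> y < b \<Longrightarrow> lower_row n y \<or> upper_row y"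
    "\<And>y. lower_row n y \<Longrightarrow> y < b + 8"
    "\<And>d. 0 < d \<Longrightarrow> d < e \<Longrightarrow> lower_diag n d"
    "\<And>d. lower_diag n d \<Longrightarrow> d < e + 8"
    "\<And>x. lower_anti n x \<Longrightarrow> x < s + 8"
  shows "represents n b e s (R, D, A)"
  using assms by simp

lemma nth_shift:
  assumes "length xs = 8" "\<And>i. i < 8 \<Longrightarrow> xs ! i \<longleftrightarrow> f (a + i)" "\<And>y. f y \<Longrightarrow> y < a + 8" "i < 8"
  shows "(tl xs @ [False]) ! i \<longleftrightarrow> f (Suc a + i)"
proof (cases "i < 7")
  case True
  then show ?thesis using assms(1) assms(2)[of "Suc i"] by (simp add: nth_append nth_tl)
next
  case False
  then have "i = 7" using assms(4) by simp
  then show ?thesis using assms(1) assms(3)[of "8 + a"] by (auto simp: nth_append)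
qed

lemma nth_shift2:
  assumes "length xs = 8" "\<And>i. i < 8 \<Longrightarrow> xs ! i \<longleftrightarrow> f (a + i)" "\<And>y. f y \<Longrightarrow> y < a + 8" "i < 8"
  shows "(drop 2 xs @ [False, False]) ! i \<longleftrightarrow> f (Suc (Suc a) + i)"
proof -
  have "drop 2 xs @ [False, False] = tl (tl xs @ [False]) @ [False]"
    using assms(1) by (cases xs; cases "tl xs") (auto simp: numeral_2_eq_2)
  moreover have "length (tl xs @ [False]) = 8" using assms(1) by simp
  ultimately show ?thesis
    using nth_shift[of "tl xs @ [False]" f "Suc a" i] nth_shift[of xs f a] assms
    by (metis Suc_eq_plus1 add_Suc less_Suc_eq)
qed

lemma represents_stay:
  assumes "represents n b e s B" "stay B' B" "0 < e"
  shows "represents n b (Suc e) (Suc s) B'"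
proof -
  obtain R D A where B: "B = (R, D, A)" by (cases B)
  note r = representsD[OF assms(1)[unfolded B]]
  have B': "B' = (R, False # butlast D, tl A @ [False])" and lastD: "last D"
    using assms(2) unfolding B by simp_all
  have "last D = D ! 7" using r(2) by (subst last_conv_nth) auto
  then have e: "lower_diag n e" using lastD r(5)[of 7] by simp
  show ?thesis unfolding B'
  proof (rule representsI)
    show "length R = 8" "length (False # butlast D) = 8" "length (tl A @ [False]) = 8"
      using r(1-3) by simp_all
    show "(False # butlast D) ! i \<longleftrightarrow> lower_diag n (Suc e + 7 - i)" if "i < 8" for i
    proof (cases i)
      case 0
      then show ?thesis using r(10)[of "8 + e"] by auto
    next
      case (Suc k)
      then show ?thesis using that r(2) r(5)[of k] by (simp add: nth_butlast add.commute)
    qed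
    show "(tl A @ [False]) ! i \<longleftrightarrow> lower_anti n (Suc s + i)" if "i < 8" for i
      using r(3,6,11) that by (rule nth_shift)
    show "lower_diag n d" if "0 < d" "d < Suc e" for d
      using that r(9)[of d] e by (cases "d = e") auto
    show "d < Suc e + 8" if "lower_diag n d" for d
      using r(10)[OF that] by simp
    show "x < Suc s + 8" if "lower_anti n x" for x
      using r(11)[OF that] by simp
  qed (use r in blast)+
qed

lemma represents_advance:
  assumes "represents n b e s B" "advance ks B a"
    and "hd ks = Some True \<Longrightarrow> upper_row b"
  shows "represents n (Suc b) e (Suc (Suc s)) (board_of (first_child a))"
proof -
  obtain R D A where B: "B = (R, D, A)" by (cases B)
  note r = representsD[OF assms(1)[unfolded B]]
  have B': "board_of (first_child a) = (tl R @ [False], D, drop 2 A @ [False, False])"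
    and "hd R \<or> hd ks = Some True"
    using assms(2) unfolding B by simp_all
  moreover have "hd R = R ! 0" using r(1) by (subst hd_conv_nth) auto
  ultimately have b: "lower_row n b \<or> upper_row b" using r(4)[of 0] assms(3) by auto
  show ?thesis unfolding B'
  proof (rule representsI)
    show "length (tl R @ [False]) = 8" "length D = 8" "length (drop 2 A @ [False, False]) = 8"
      using r(1-3) by simp_all
    show "(tl R @ [False]) ! i \<longleftrightarrow> lower_row n (Suc b + i)" if "i < 8" for i
      using r(1,4,8) that by (rule nth_shift)
    show "(drop 2 A @ [False, False]) ! i \<longleftrightarrow> lower_anti n (Suc (Suc s) + i)" if "i < 8" for i
      using r(3,6,11) that by (rule nth_shift2)
    show "lower_row n y \<or> upper_row y" if "0 < y" "y < Suc b" for y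
      using that r(7)[of y] b by (cases "y = b") auto
    show "y < Suc b + 8" if "lower_row n y" for y
      using r(8)[OF that] by simp
    show "x < Suc (Suc s) + 8" if "lower_anti n x" for x
      using r(11)[OF that] by simp
  qed (use r in blast)+
qed

lemma represents_upper_column:
  assumes "represents n b e s B" "\<not> queens n < n"
  shows "represents (Suc n) b e s (place None B)"
  using assms by (cases B) (simp add: lower_row_Suc lower_diag_Suc lower_anti_Suc)

lemma represents_lower_column:
  assumes "represents n b e (n + b) B" "queens n = b + i" "i < 8" "n = b + e + 7" "0 < e"
  shows "represents (Suc n) b e (n + b) (place (Some i) B)"
proof -
  obtain R D A where B: "B = (R, D, A)" by (cases B)
  note r = representsD[OF assms(1)[unfolded B]]
  have q: "queens n < n" "n - queens n = e + 7 - i" "n + queens n = n + b + i"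
    using assms by simp_all
  show ?thesis unfolding B place.simps
  proof (rule representsI)
    show "R[i := True] ! k \<longleftrightarrow> lower_row (Suc n) (b + k)" if "k < 8" for k
      using that r(1) r(4)[of k] q assms(2,3) by (cases "k = i") (auto simp: lower_row_Suc)
    show "D[i := True] ! k \<longleftrightarrow> lower_diag (Suc n) (e + 7 - k)" if "k < 8" for k
      using that r(2) r(5)[of k] q assms(2,3) by (cases "k = i") (auto simp: lower_diag_Suc)
    show "A[i := True] ! k \<longleftrightarrow> lower_anti (Suc n) (n + b + k)" if "k < 8" for k
      using that r(3) r(6)[of k] q assms(2,3) by (cases "k = i") (auto simp: lower_anti_Suc)
    show "lower_row (Suc n) y \<or> upper_row y" if "0 < y" "y < b" for y
      using r(7)[OF that] by (auto simp: lower_row_Suc)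
    show "y < b + 8" if "lower_row (Suc n) y" for y
      using that r(8)[of y] assms(2,3) by (auto simp: lower_row_Suc)
    show "lower_diag (Suc n) d" if "0 < d" "d < e" for d
      using r(9)[OF that] by (simp add: lower_diag_Suc)
    show "d < e + 8" if "lower_diag (Suc n) d" for d
      using that r(10)[of d] q(2) by (auto simp: lower_diag_Suc)
    show "x < n + b + 8" if "lower_anti (Suc n) x" for x
      using that r(11)[of x] q(3) assms(3) by (auto simp: lower_anti_Suc)
  qed (use r(1-3) in simp_all)
qed

lemma tally_card: "tally xs = card {i. i < length xs \<and> xs ! i}"
proof (induction xs)
  case Nil
  then show ?case by simp
next
  case (Cons x xs)
  have "{i. i < length (x # xs) \<and> (x # xs) ! i} =
      (if x then {0} else {}) \<union> Suc ` {i. i < length xs \<and> xs ! i}"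
  proof (rule set_eqI)
    fix k
    show "k \<in> {i. i < length (x # xs) \<and> (x # xs) ! i} \<longleftrightarrow>
        k \<in> (if x then {0} else {}) \<union> Suc ` {i. i < length xs \<and> xs ! i}"
      by (cases k) auto
  qed
  then show ?case using Cons by (simp add: card_image)
qed

text \<open>The occupied diagonals are those below \<open>e\<close> and the marked ones; there are as many of them as lower
  queens.\<close>

lemma represents_upper_count:
  assumes "represents n b e s (R, D, A)" "n = b + e + 7" "0 < e"
  shows "upper_count (n - 1) + tally D = b + 7"
proof -
  note r = representsD[OF assms(1)]
  obtain k where k: "n = Suc k" using assms(2) by (cases n) auto
  have pos: "0 < d" if "lower_diag n d" for d
    using that unfolding lower_diag_def by auto
  have "{d. lower_diag n d} = {1..<e} \<union> (\<lambda>i. e + 7 - i) ` {i. i < length D \<and> D ! i}"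
  proof (intro set_eqI iffI)
    fix d assume "d \<in> {d. lower_diag n d}"
    then have d: "lower_diag n d" "0 < d" "d < e + 8" using pos r(10) by auto
    show "d \<in> {1..<e} \<union> (\<lambda>i. e + 7 - i) ` {i. i < length D \<and> D ! i}"
    proof (cases "d < e")
      case False
      then have "d = e + 7 - (e + 7 - d)" "e + 7 - d < 8" using d by auto
      then show ?thesis using d r(2) r(5)[of "e + 7 - d"] by (intro UnI2 image_eqI[of _ _ "e + 7 - d"]) auto
    qed (use d in auto)
  next
    fix d assume "d \<in> {1..<e} \<union> (\<lambda>i. e + 7 - i) ` {i. i < length D \<and> D ! i}"
    then show "d \<in> {d. lower_diag n d}" using r(9)[of d] r(2,5) by auto
  qed
  moreover have "{1..<e} \<inter> (\<lambda>i. e + 7 - i) ` {i. i < length D \<and> D ! i} = {}"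
    using r(2) by auto
  moreover have "inj_on (\<lambda>i. e + 7 - i) {i. i < length D \<and> D ! i}"
    using r(2) by (auto simp: inj_on_def)
  ultimately have "card {d. lower_diag n d} = e - 1 + tally D"
    by (simp add: card_Un_disjoint card_image tally_card)
  then show ?thesis using card_lower_diag[of k] k assms by simp
qed

section \<open>One column of the greedy rule\<close>

lemma first_free_None: "first_free cs = Some None \<Longrightarrow> i < length cs \<Longrightarrow> cs ! i = Some False"
  by (induction cs arbitrary: i rule: first_free.induct)
    (auto simp: nth_Cons split: if_splits nat.splits)

lemma first_free_Some:
  "first_free cs = Some (Some j) \<Longrightarrow> j < length cs \<and> cs ! j = Some True \<and> (\<forall>i<j. cs ! i = Some False)"
proof (induction cs arbitrary: j rule: first_free.induct)
  case (3 free cs)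
  show ?case
  proof (cases free)
    case True
    then show ?thesis using 3 by auto
  next
    case False
    then obtain k where k: "first_free cs = Some (Some k)" "j = Suc k" using 3 by auto
    then have "k < length cs \<and> cs ! k = Some True \<and> (\<forall>i<k. cs ! i = Some False)" using 3 False by blast
    then show ?thesis using k False by (auto simp: nth_Cons split: nat.splits)
  qed
qed auto

lemma cells_nth:
  assumes "length R = 8" "length D = 8" "length A = 8" "length ks = 8" "8 \<le> length xs"
  shows "length (cells ks xs (R, D, A)) = 8"
    "i < 8 \<Longrightarrow> cells ks xs (R, D, A) ! i = cell (R ! i) (D ! i) (A ! i) (ks ! i) (xs ! i)"
  using assms by simp_all

declare cells.simps [simp del]

text \<open>Cells below the rows in view are attacked because their rows are occupied, and cells above them
  because their diagonals are. So the first free cell in view, if any, is the greedy choice among all cells below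
  the main diagonal.\<close>

lemma greedy_column:
  assumes rep: "represents n b e (n + b) B" and n: "n = b + e + 7" and pos: "0 < b" "0 < e"
    and len: "length ks = 8" "8 \<le> length xs"
    and kinds: "\<And>i v. i < 8 \<Longrightarrow> ks ! i = Some v \<Longrightarrow> upper_row (b + i) = v"
    and antis: "\<And>i v. i < 8 \<Longrightarrow> xs ! i = Some v \<Longrightarrow> upper_anti (n + b + i) = v"
    and q: "first_free (cells ks xs B) = Some q"
  shows "represents (Suc n) b e (n + b) (place q B)" "q = None \<longleftrightarrow> queens n > n"
    "q = Some i \<Longrightarrow> queens n = b + i"
proof -
  obtain R D A where B: "B = (R, D, A)" by (cases B)
  note r = representsD[OF rep[unfolded B]]
  note cells = cells_nth[OF r(1-3) len]
  have att: "attacked n (b + i) \<longleftrightarrow> R ! i \<or> upper_row (b + i) \<or> D ! i \<or> A ! i \<or> upper_anti (n + b + i)"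
    if "i < 8" for i
    using attacked_iff[of "b + i" n] that n pos r(4-6)[OF that] by (simp add: add.assoc)
  have blocked: "attacked n (b + i)" if "i < 8" "cells ks xs B ! i = Some False" for i
    using that att[of i] cells(2)[of i] kinds[of i True] antis[of i True] unfolding B
    by (auto simp: cell_def split: if_splits)
  have free: "\<not> attacked n (b + i)" if "i < 8" "cells ks xs B ! i = Some True" for i
    using that att[of i] cells(2)[of i] kinds[of i False] antis[of i False] unfolding B
    by (auto simp: cell_def split: if_splits)
  have low: "attacked n y" if "y < b" for y
    using attacked_0[of n] attacked_iff[of y n] that r(7)[of y] n by (cases "y = 0") auto
  have high: "attacked n y" if "b + 8 \<le> y" "y < n" for y
    using attacked_iff[of y n] that r(9)[of "n - y"] n by auto
  have place: "represents (Suc n) b e (n + b) (place q B) \<and> (q = None \<longleftrightarrow> queens n > n) \<and>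
      (\<forall>i. q = Some i \<longrightarrow> queens n = b + i)"
  proof (cases q)
    case None
    have "attacked n y" if "y < n" for y
    proof -
      consider "y < b" | "b + 8 \<le> y" | "y = b + (y - b)" "y - b < 8" by linarith
      then show ?thesis
      proof cases
        case 3
        then show ?thesis using blocked[of "y - b"] first_free_None[of "cells ks xs B" "y - b"] q None cells(1)
          unfolding B by simp
      qed (use low high that in auto)
    qed
    then have "queens n > n" using n by (intro queens_gt_if_all_attacked) auto
    then show ?thesis using None rep represents_upper_column[of n b e "n + b" B] by simp
  next
    case (Some j)
    then have j: "j < 8" "cells ks xs B ! j = Some True" "\<forall>i<j. cells ks xs B ! i = Some False"
      using first_free_Some[of "cells ks xs B" j] q cells(1) unfolding B by auto
    have "attacked n z" if "z < b + j" for z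
    proof (cases "z < b")
      case False
      then have "z = b + (z - b)" "z - b < j" using that by auto
      then show ?thesis using blocked[of "z - b"] j by simp
    qed (use low in auto)
    then have "queens n = b + j" using free[OF j(1,2)] by (intro queens_eqI) auto
    then show ?thesis
      using Some rep represents_lower_column[of n b e B j] j(1) n pos by auto
  qed
  then show "represents (Suc n) b e (n + b) (place q B)" "q = None \<longleftrightarrow> queens n > n"
    by blast+
  show "queens n = b + i" if "q = Some i" using place that by blast
qed

text \<open>The true position in column \<open>n\<close> is the one listed for its letter, in the window whose fourth row is the parent.\<close>

definition on_track :: "nat \<Rightarrow> bool" where
  "on_track n \<longleftrightarrow>
     represents n (parent n - 3) (n - parent n - 4) (n + (parent n - 3)) (board_of (letter n))"

lemma column_okE:
  assumes "column_ok a early c nxt"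
  obtains q where
    "first_free (cells (kinds_of a) (if early then upper_antis (types_of a) else tl (upper_antis (types_of a)))
       (board_of c)) = Some q"
    "(q = None) = two_children c" "offset_ok q (diags_used c)" "nxt (place q (board_of c))"
  using assms unfolding column_ok_def by (auto split: option.splits)

lemma on_track_upper_count:
  assumes "on_track n" "3 < parent n" "parent n + 5 \<le> n"
  shows "upper_count (n - 1) + diags_used (letter n) = parent n + 4"
proof -
  obtain R D A where B: "board_of (letter n) = (R, D, A)" by (cases "board_of (letter n)")
  then show ?thesis
    using represents_upper_count[of n "parent n - 3" "n - parent n - 4" "n + (parent n - 3)" R D A] assms
    unfolding on_track_def diags_used_def by simp
qed

text \<open>The board of \<open>letter n\<close> is correct by assumption, and so are the claims of the parent's letter, since all
  columns that they mention come before \<open>n\<close> because of \<open>parent n + 4 < n\<close>. So the evaluated check tells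
  what the greedy rule does in column \<open>n\<close>, in particular its type, and the checked successor relation identifies the letter of
  the next column.\<close>

lemma on_track_Suc:
  assumes typed: "typed n" and track: "on_track n" and p: "4 \<le> parent n" "parent n + 5 \<le> n"
    and ge: "7 \<le> letter (parent n)"
  shows "typed (Suc n)" "on_track (Suc n)"
    "queens n < n \<Longrightarrow> upper_count n \<le> queens n + 2 \<and> queens n \<le> upper_count n + 4"
proof -
  let ?p = "parent n" and ?a = "letter (parent n)"
  have n1: "1 \<le> n" using p by simp
  note pb = parent_bounds[OF n1]
  define b where "b = ?p - 3"
  define e where "e = n - ?p - 4"
  have be: "n = b + e + 7" "0 < b" "0 < e" "?p = b + 3" using p by (auto simp: b_def e_def)
  have rep: "represents n b e (n + b) (board_of (letter n))"
    using track unfolding on_track_def b_def e_def .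
  have less: "?a < 1919" using letter_less[OF typed pb(1)] p by simp
  have cons: "consistent ?a" using consistent_letter[OF less] .
  have steps: "steps_ok ?a" using steps_ok_letter[OF ge less] .
  have two: "two_children ?a \<longleftrightarrow> queens ?p > ?p" using typedD[OF typed pb(1)] p by simp
  have kinds: "upper_row (b + i) = v" if "i < 8" "kinds_of ?a ! i = Some v" for i v
    using kinds_true[OF typed pb(1), of i v] that p by (simp add: b_def)
  have types: "(queens (?p + i - 3) > ?p + i - 3) = v" if "i < 8" "types_of ?a ! i = Some v" for i v
    using types_true[OF typed pb(1), of i v] that p by simp
  have antis: "upper_anti (anti_end ?p + m - 4) = v" if "m < 9" "upper_antis (types_of ?a) ! m = Some v" for m v
    by (rule upper_antis_true[OF types consistentD(2)[OF cons] p(1) that])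
  have "typed (Suc n) \<and> on_track (Suc n) \<and>
      (queens n < n \<longrightarrow> upper_count n \<le> queens n + 2 \<and> queens n \<le> upper_count n + 4)"
    if q: "first_free (cells (kinds_of ?a) xs (board_of (letter n))) = Some q"
      and q2: "(q = None) = two_children (letter n)" "offset_ok q (diags_used (letter n))"
      and xs: "8 \<le> length xs" "\<And>i v. i < 8 \<Longrightarrow> xs ! i = Some v \<Longrightarrow> upper_anti (n + b + i) = v"
      and nxt: "represents (Suc n) b e (n + b) (place q (board_of (letter n))) \<Longrightarrow> on_track (Suc n)"
    for q xs
  proof -
    note greedy = greedy_column[OF rep be(1-3) consistentD(1)[OF cons] xs(1) _ _ q]
    have col1: "represents (Suc n) b e (n + b) (place q (board_of (letter n)))"
      by (rule greedy(1)) (rule kinds xs(2), assumption+)+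
    have col2: "q = None \<longleftrightarrow> queens n > n"
      by (rule greedy(2)) (rule kinds xs(2), assumption+)+
    have col3: "queens n = b + i" if "q = Some i" for i
      by (rule greedy(3)[OF _ _ that]) (rule kinds xs(2), assumption+)+
    have "two_children (letter n) \<longleftrightarrow> queens n > n"
      using col2 q2(1) by blast
    then have "typed (Suc n)"
      using typed unfolding typed_def less_Suc_eq by blast
    moreover have "upper_count n \<le> queens n + 2 \<and> queens n \<le> upper_count n + 4" if low: "queens n < n"
    proof -
      have "q \<noteq> None" using col2 low by linarith
      then obtain i where i: "q = Some i" by blast
      obtain k where k: "n = Suc k" using n1 by (cases n) auto
      have "upper_count n = upper_count (n - 1)" unfolding k using upper_count_Suc[of k] low k by simp
      moreover have "upper_count (n - 1) + diags_used (letter n) = ?p + 4"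
        by (rule on_track_upper_count[OF track _ p(2)]) (use p in simp)
      moreover have "queens n = b + i" using col3[OF i] .
      moreover have "5 \<le> i + diags_used (letter n)" "i + diags_used (letter n) \<le> 11" using q2(2) i by simp_all
      ultimately show ?thesis using be(4) by linarith
    qed
    ultimately show ?thesis using nxt col1 by blast
  qed
  note main = this
  have "typed (Suc n) \<and> on_track (Suc n) \<and>
      (queens n < n \<longrightarrow> upper_count n \<le> queens n + 2 \<and> queens n \<le> upper_count n + 4)"
  proof (cases "n = row_end ?p")
    case False
    then have up: "n + 1 = row_end ?p" "queens ?p > ?p" using row_end_parent[OF n1] by auto
    have ps: "parent (Suc n) = ?p" using parent_Suc[OF n1] up by simp
    have "\<not> upper_row n" "upper_row (Suc n)" using upper_row_iff[OF n1] upper_row_iff[of "Suc n"] up ps by simp_all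
    then have l: "letter n = first_child ?a" "letter (Suc n) = second_child ?a"
      using letter_first[OF n1] letter_second[of "Suc n"] ps by simp_all
    have "column_ok ?a True (letter n) (stay (board_of (letter (Suc n))))"
      unfolding l using steps two up(2) unfolding steps_ok_def by argo
    from column_okE[OF this] obtain q where q: "first_free (cells (kinds_of ?a) (upper_antis (types_of ?a)) (board_of (letter n))) = Some q"
      "(q = None) = two_children (letter n)" "offset_ok q (diags_used (letter n))"
      "stay (board_of (letter (Suc n))) (place q (board_of (letter n)))"
      unfolding if_True if_False by blast
    show ?thesis
    proof (rule main[OF q(1-3)])
      show "8 \<le> length (upper_antis (types_of ?a))" by (simp add: length_upper_antis)
      show "upper_anti (n + b + i) = v" if "i < 8" "upper_antis (types_of ?a) ! i = Some v" for i v
      proof -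
        have "anti_end ?p + i - 4 = n + b + i" using up(1) p by (simp add: anti_end_def b_def)
        then show ?thesis using antis[of i v] that by simp
      qed
      assume "represents (Suc n) b e (n + b) (place q (board_of (letter n)))"
      from represents_stay[OF this q(4) be(3)]
      have "represents (Suc n) b (Suc e) (Suc (n + b)) (board_of (letter (Suc n)))" .
      moreover have "Suc e = Suc n - ?p - 4" "Suc (n + b) = Suc n + (?p - 3)"
        using p by (simp_all add: b_def e_def)
      ultimately show "on_track (Suc n)" unfolding on_track_def ps b_def by (simp only:)
    qed
  next
    case True
    have ps: "parent (Suc n) = Suc ?p" using parent_Suc[OF n1] True by simp
    have l: "letter n = last_child ?a" using letter_row_end[OF typed n1 True] p by simp
    have l2: "letter (Suc n) = first_child (letter (Suc ?p))"
      using letter_first[of "Suc n"] not_upper_row_Suc_row_end[OF n1 True] ps by simp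
    have "column_ok ?a False (letter n) (advance_all ?a)"
      unfolding l using steps unfolding steps_ok_def last_child_def by (cases "two_children ?a") simp_all
    from column_okE[OF this] obtain q where q: "first_free (cells (kinds_of ?a) (tl (upper_antis (types_of ?a))) (board_of (letter n))) = Some q"
      "(q = None) = two_children (letter n)" "offset_ok q (diags_used (letter n))"
      "advance_all ?a (place q (board_of (letter n)))"
      unfolding if_True if_False by blast
    have "letter (Suc ?p) \<in> set (successors ?a)" using letter_Suc[OF typed pb(1)] p by simp
    then have adv: "advance (kinds_of ?a) (place q (board_of (letter n))) (letter (Suc ?p))"
      using q(4) by (simp add: advance_all_def list_all_iff)
    show ?thesis
    proof (rule main[OF q(1-3)])
      show "8 \<le> length (tl (upper_antis (types_of ?a)))" by (simp add: length_upper_antis)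
      show "upper_anti (n + b + i) = v" if "i < 8" "tl (upper_antis (types_of ?a)) ! i = Some v" for i v
      proof -
        have "anti_end ?p + Suc i - 4 = n + b + i" using True p by (simp add: anti_end_def b_def)
        then show ?thesis using antis[of "Suc i" v] that by (simp add: nth_tl length_upper_antis)
      qed
      have hd: "upper_row b" if "hd (kinds_of ?a) = Some True"
        using kinds[of 0 True] that consistentD(1)[OF cons] by (cases "kinds_of ?a") auto
      assume "represents (Suc n) b e (n + b) (place q (board_of (letter n)))"
      from represents_advance[OF this adv hd]
      have "represents (Suc n) (Suc b) e (Suc (Suc (n + b))) (board_of (letter (Suc n)))"
        unfolding l2 .
      moreover have "Suc b = Suc ?p - 3" "e = Suc n - Suc ?p - 4" "Suc (Suc (n + b)) = Suc n + (Suc ?p - 3)"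
        using p by (simp_all add: b_def e_def)
      ultimately show "on_track (Suc n)" unfolding on_track_def ps by (simp only:)
    qed
  qed
  then show "typed (Suc n)" "on_track (Suc n)"
    "queens n < n \<Longrightarrow> upper_count n \<le> queens n + 2 \<and> queens n \<le> upper_count n + 4"
    by blast+
qed

section \<open>The first columns\<close>

definition attacked_in :: "nat list \<Rightarrow> nat \<Rightarrow> nat \<Rightarrow> bool" where
  "attacked_in xs n y \<longleftrightarrow>
     list_ex (\<lambda>i. y = xs ! i \<or> y + i = xs ! i + n \<or> y + n = xs ! i + i) [0..<n]"

definition greedy_prefix :: "nat list \<Rightarrow> bool" where
  "greedy_prefix xs \<longleftrightarrow> list_all (\<lambda>n. \<not> attacked_in xs n (xs ! n) \<and>
     list_all (attacked_in xs n) [0..<xs ! n]) [0..<length xs]"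

lemma greedy_prefix_queens:
  assumes "greedy_prefix xs" "n < length xs"
  shows "queens n = xs ! n"
  using assms(2)
proof (induction n rule: less_induct)
  case (less n)
  then have "attacked n y \<longleftrightarrow> attacked_in xs n y" for y
    unfolding attacked_def attacked_in_def list_ex_iff by auto
  then show ?case
    using assms(1) less.prems by (intro queens_eqI) (auto simp: greedy_prefix_def list_all_iff)
qed

text \<open>The induction starts at column 13, the first child of column 8. The lag is governed by boards of a
  column and its parent; as column 20 is the first child of column 13, lags before column 19 are taken from
  these values.\<close>

definition queens_start :: "nat list" where
  "queens_start = [0, 2, 4, 1, 3, 8, 10, 12, 14, 5, 7, 18, 6, 21, 9, 24, 26, 28, 30]"

lemma greedy_prefix_start: "greedy_prefix queens_start"
  by code_simp

lemma queens_start_nth: "n < 19 \<Longrightarrow> queens n = queens_start ! n"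
  using greedy_prefix_queens[OF greedy_prefix_start] by (simp add: queens_start_def)

lemma queens_values:
  "queens 1 = 2" "queens 2 = 4" "queens 3 = 1" "queens 4 = 3" "queens 5 = 8" "queens 6 = 10"
  "queens 7 = 12" "queens 8 = 14" "queens 9 = 5" "queens 10 = 7" "queens 11 = 18" "queens 12 = 6"
  "queens 13 = 21" "queens 14 = 9" "queens 15 = 24" "queens 16 = 26" "queens 17 = 28" "queens 18 = 30"
  by (simp_all add: queens_start_nth queens_start_def)

lemma upper_count_numeral:
  "upper_count (numeral k) = upper_count (pred_numeral k) + (if queens (numeral k) > numeral k then 1 else 0)"
  by (simp add: numeral_eq_Suc upper_count_Suc)

lemma upper_count_values:
  "upper_count 2 = 2" "upper_count 3 = 2" "upper_count 4 = 2" "upper_count 5 = 3" "upper_count 6 = 4"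
  "upper_count 7 = 5" "upper_count 8 = 6" "upper_count 9 = 6" "upper_count 10 = 6" "upper_count 11 = 7"
  "upper_count 12 = 7" "upper_count 13 = 8" "upper_count 14 = 8" "upper_count 15 = 9"
  "upper_count 16 = 10" "upper_count 17 = 11" "upper_count 18 = 12"
  by (simp_all add: upper_count_numeral upper_count_1 queens_values)

lemma letter_at_row_start: "letter (Suc (row_end j)) = first_child (letter (Suc j))"
proof -
  have p: "parent (Suc (row_end j)) = Suc j"
    by (rule parent_eqI) (simp_all add: row_end_Suc)
  have "\<not> upper_row (Suc (row_end j))"
    using upper_row_iff[of "Suc (row_end j)"] p by (auto simp: row_end_Suc)
  then show ?thesis using letter_first[of "Suc (row_end j)"] p by simp
qed

lemma letter_at_row_end:
  assumes "queens j > j"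
  shows "letter (row_end j) = second_child (letter j)"
proof -
  have j: "1 \<le> j" using assms by (cases j) (auto simp: queens_0)
  have p: "parent (row_end j) = j"
    using j row_end_less[of "j - 1" j] by (intro parent_eqI) auto
  have "1 \<le> row_end j" using j by (simp add: row_end_def)
  then show ?thesis
    using letter_second[of "row_end j"] upper_row_iff[of "row_end j"] p assms by simp
qed

lemma letter_first_column: "letter 1 = 0"
  by (simp add: letter_1)

lemma letter_values:
  "letter 2 = 1" "letter 3 = 2" "letter 4 = 3" "letter 5 = 4" "letter 6 = 5" "letter 7 = 6"
  "letter 8 = 7" "letter 9 = 8" "letter 10 = 9" "letter 11 = 10" "letter 12 = 11" "letter 13 = 12"
proof -
  have ends: "row_end 1 = 2" "row_end 2 = 4" "row_end 3 = 5" "row_end 4 = 6" "row_end 5 = 8"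
    "row_end 6 = 10" "row_end 7 = 12"
    by (simp_all add: row_end_def upper_count_1 upper_count_values)
  have c: "second_child 0 = 1" "first_child 1 = 2" "second_child 1 = 3" "first_child 2 = 4" "first_child 3 = 5"
    "first_child 4 = 6" "second_child 4 = 7" "first_child 5 = 8" "second_child 5 = 9"
    "first_child 6 = 10" "second_child 6 = 11" "first_child 7 = 12"
    by (simp_all only: letters_nth check_simps cong: check_congs)
  note eval = ends c queens_values letter_first_column Suc_numerals Num.inc.simps numeral_less_iff one_less_numeral_iff less_num_simps le_num_simps simp_thms
  show l2: "letter 2 = 1" using letter_at_row_end[of 1] by (simp only: eval)
  show l3: "letter 3 = 2" using letter_at_row_start[of 1] by (simp only: eval l2)
  show l4: "letter 4 = 3" using letter_at_row_end[of 2] by (simp only: eval l2)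
  show l5: "letter 5 = 4" using letter_at_row_start[of 2] by (simp only: eval l3)
  show l6: "letter 6 = 5" using letter_at_row_start[of 3] by (simp only: eval l4)
  show l7: "letter 7 = 6" using letter_at_row_start[of 4] by (simp only: eval l5)
  show l8: "letter 8 = 7" using letter_at_row_end[of 5] by (simp only: eval l5)
  show l9: "letter 9 = 8" using letter_at_row_start[of 5] by (simp only: eval l6)
  show l10: "letter 10 = 9" using letter_at_row_end[of 6] by (simp only: eval l6)
  show l11: "letter 11 = 10" using letter_at_row_start[of 6] by (simp only: eval l7)
  show l12: "letter 12 = 11" using letter_at_row_end[of 7] by (simp only: eval l7)
  show l13: "letter 13 = 12" using letter_at_row_start[of 7] by (simp only: eval l8)
qed

lemma lower_numeral:
  "lower_row (numeral k) y \<longleftrightarrow> lower_row (pred_numeral k) y \<or>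
     queens (pred_numeral k) < pred_numeral k \<and> queens (pred_numeral k) = y"
  "lower_diag (numeral k) y \<longleftrightarrow> lower_diag (pred_numeral k) y \<or>
     queens (pred_numeral k) < pred_numeral k \<and> pred_numeral k - queens (pred_numeral k) = y"
  "lower_anti (numeral k) y \<longleftrightarrow> lower_anti (pred_numeral k) y \<or>
     queens (pred_numeral k) < pred_numeral k \<and> pred_numeral k + queens (pred_numeral k) = y"
  by (simp_all only: numeral_eq_Suc lower_row_Suc lower_diag_Suc lower_anti_Suc)

lemma lower_1: "\<not> lower_row (Suc 0) y" "\<not> lower_diag (Suc 0) y" "\<not> lower_anti (Suc 0) y"
  by (simp_all add: lower_row_def lower_diag_def lower_anti_def)

lemma lower_13:
  "lower_row 13 y \<longleftrightarrow> y \<in> {1, 3, 5, 6, 7}"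
  "lower_diag 13 y \<longleftrightarrow> y \<in> {1, 2, 3, 4, 6}"
  "lower_anti 13 y \<longleftrightarrow> y \<in> {4, 7, 14, 17, 18}"
  by (auto simp: lower_numeral lower_1 queens_1 queens_values)

lemma all_less_numeral:
  "(\<forall>i<numeral k. P i) \<longleftrightarrow> (\<forall>i<pred_numeral k. P i) \<and> P (pred_numeral k)"
  by (auto simp: numeral_eq_Suc less_Suc_eq)

lemma on_track_13: "on_track 13"
proof -
  have p: "parent 13 = 8"
    by (rule parent_eqI) (simp_all add: row_end_def upper_count_values)
  have "board_of 12 = ([True, True, True, False, False, False, False, False],
      [False, False, True, False, True, True, True, True],
      [True, False, False, False, False, False, False, False])"
    by (simp only: letters_nth boards_nth check_simps cong: check_congs)
  moreover have "lower_row 13 y \<or> upper_row y" if "0 < y" "y < 5" for y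
  proof -
    have "upper_row 2" "upper_row 4"
      unfolding upper_row_def using queens_values(1,2) by (auto intro: exI[of _ 1] exI[of _ 2])
    moreover have "y = 1 \<or> y = 2 \<or> y = 3 \<or> y = 4" using that by linarith
    ultimately show ?thesis by (auto simp: lower_13)
  qed
  ultimately show ?thesis
    unfolding on_track_def p letter_values
    by (simp add: lower_13 all_less_numeral) linarith
qed

section \<open>The induction\<close>

lemma typed_13: "typed 13"
proof -
  have "two_children 0" "two_children 1" "\<not> two_children 2" "\<not> two_children 3" "two_children 4"
    "two_children 5" "two_children 6" "two_children 7" "\<not> two_children 8" "\<not> two_children 9"
    "two_children 10" "\<not> two_children 11"
    by (simp_all only: letters_nth check_simps cong: check_congs)
  then have "\<forall>j<13. 1 \<le> j \<longrightarrow> (two_children (letter j) \<longleftrightarrow> queens j > j)"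
    by (simp add: all_less_numeral letter_1 letter_values queens_1 queens_values)
  then show ?thesis unfolding typed_def by blast
qed

lemma letter_ge_7:
  assumes "typed m" "8 \<le> p" "p \<le> m"
  shows "7 \<le> letter p"
  using assms(2,3)
proof (induction p rule: dec_induct)
  case base
  then show ?case by (simp add: letter_values)
next
  case (step p)
  then have "letter p < 1919" "7 \<le> letter p" using letter_less[OF assms(1), of p] by simp_all
  then have "steps_ok (letter p)" by (simp add: steps_ok_letter)
  moreover have "letter (Suc p) \<in> set (successors (letter p))"
    using letter_Suc[OF assms(1), of p] step by simp
  ultimately show ?case unfolding steps_ok_def list_all_iff by blast
qed

lemma parent_ge:
  assumes "row_end k < n"
  shows "k < parent n"
proof (rule ccontr)
  assume "\<not> k < parent n"
  then have "row_end (parent n) \<le> row_end k"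
    using row_end_less[of "parent n" k] by (cases "parent n = k") auto
  then show False using parent_bounds(2)[of n] assms by simp
qed

lemma parent_13_le:
  assumes "13 \<le> n"
  shows "8 \<le> parent n" "parent n + 5 \<le> n"
proof -
  show 8: "8 \<le> parent n"
    using parent_ge[of 7 n] assms by (simp add: row_end_def upper_count_values)
  then have "5 \<le> upper_count (parent n - 1)"
    using upper_count_mono[of 7 "parent n - 1"] by (simp add: upper_count_values)
  then show "parent n + 5 \<le> n"
    using parent_bounds(3)[of n] assms by (simp add: row_end_def)
qed

lemma typed_and_on_track:
  assumes "13 \<le> n"
  shows "typed n \<and> on_track n"
  using assms
proof (induction n rule: dec_induct)
  case base
  then show ?case using typed_13 on_track_13 by blast
next
  case (step n)
  note p = parent_13_le[OF step(1)]
  have "7 \<le> letter (parent n)" using letter_ge_7[of n "parent n"] step(3) p by simp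
  then have "typed (Suc n)" "on_track (Suc n)"
    using on_track_Suc(1,2)[of n] step(3) p by linarith+
  then show ?case by blast
qed

lemma typed_all: "typed n"
  using typed_and_on_track[of "n + 13"] typed_mono[of "n + 13" n] by simp

lemma lower_queen_near_upper_count:
  assumes "queens n < n"
  shows "upper_count n \<le> queens n + 2" "queens n \<le> upper_count n + 4"
proof -
  have "upper_count n \<le> queens n + 2 \<and> queens n \<le> upper_count n + 4"
  proof (cases "13 \<le> n")
    case True
    note p = parent_13_le[OF True]
    have "7 \<le> letter (parent n)" using letter_ge_7[OF typed_all[of n]] p by simp
    moreover have "4 \<le> parent n" using p(1) by simp
    ultimately show ?thesis
      using on_track_Suc(3)[OF _ _ _ p(2) _ assms] typed_and_on_track[OF True] by blast
  next
    case False
    have "\<forall>k<13. queens k < k \<longrightarrow> upper_count k \<le> queens k + 2 \<and> queens k \<le> upper_count k + 4"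
      by (simp add: all_less_numeral queens_1 queens_values upper_count_values)
    then show ?thesis using False assms by (metis not_le)
  qed
  then show "upper_count n \<le> queens n + 2" "queens n \<le> upper_count n + 4" by blast+
qed

section \<open>The lag\<close>

definition lag :: "nat \<Rightarrow> int" where
  "lag n = int n - 2 * int (n - upper_count n) - int (upper_count (n - upper_count n))"

lemma lag_withinD:
  assumes "length ts = 8"
  shows "lag_within 0 v ts \<Longrightarrow> \<exists>u u'. ts ! 2 = Some u \<and> ts ! 3 = Some u' \<and>
      4 + as_count u + as_count u' \<le> v \<and> v \<le> 9 + as_count u + as_count u'"
    "lag_within (Suc 0) v ts \<Longrightarrow> \<exists>u. ts ! 3 = Some u \<and> 3 + as_count u \<le> v \<and> v \<le> 8 + as_count u"
    "lag_within (Suc (Suc 0)) v ts \<Longrightarrow> 2 \<le> v \<and> v \<le> 7"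
    "lag_within (Suc (Suc (Suc k))) v ts \<Longrightarrow>
      k = 0 \<and> (\<exists>u. ts ! 4 = Some u \<and> 1 \<le> v + as_count u \<and> v + as_count u \<le> 6)"
proof -
  have hd: "hd (drop i ts) = ts ! i" if "i < 8" for i
    using that assms by (simp add: hd_drop_conv_nth)
  have hd2: "hd (drop 2 ts) = ts ! 2" and hd3: "hd (drop 3 ts) = ts ! 3" and hd4: "hd (drop 4 ts) = ts ! 4"
    by (rule hd, simp)+
  show "lag_within 0 v ts \<Longrightarrow> \<exists>u u'. ts ! 2 = Some u \<and> ts ! 3 = Some u' \<and>
      4 + as_count u + as_count u' \<le> v \<and> v \<le> 9 + as_count u + as_count u'"
    unfolding lag_within_def nat.case hd2 hd3 by (cases "ts ! 2"; cases "ts ! 3") simp_all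
  show "lag_within (Suc 0) v ts \<Longrightarrow> \<exists>u. ts ! 3 = Some u \<and> 3 + as_count u \<le> v \<and> v \<le> 8 + as_count u"
    unfolding lag_within_def nat.case hd3 by (cases "ts ! 3") simp_all
  show "lag_within (Suc (Suc 0)) v ts \<Longrightarrow> 2 \<le> v \<and> v \<le> 7"
    unfolding lag_within_def nat.case .
  show "lag_within (Suc (Suc (Suc k))) v ts \<Longrightarrow>
      k = 0 \<and> (\<exists>u. ts ! 4 = Some u \<and> 1 \<le> v + as_count u \<and> v + as_count u \<le> 6)"
    unfolding lag_within_def nat.case hd4 by (cases "ts ! 4") simp_all
qed

lemma lag_within_bounds:
  assumes "lag_within s v ts" "length ts = 8" "2 \<le> z"
    and types: "\<And>i u. i < 8 \<Longrightarrow> ts ! i = Some u \<Longrightarrow> (queens (z + i - 3) > z + i - 3) = u"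
    and j: "j + 2 = z + s"
  shows "int (upper_count z) - int (upper_count j) + 6 - int s - int v \<in> {-3..2}"
proof -
  have U: "upper_count (Suc k) = upper_count k + as_count (queens (Suc k) > Suc k)" for k
    by (simp add: upper_count_Suc as_count_def)
  obtain k where z: "z = Suc (Suc k)" using assms(3) by (cases z; cases "z - 1") auto
  have t2: "as_count u = as_count (queens (Suc k) > Suc k)" if "ts ! 2 = Some u" for u
    using types[of 2 u] that z by simp
  have t3: "as_count u = as_count (queens z > z)" if "ts ! 3 = Some u" for u
    using types[of 3 u] that by simp
  have t4: "as_count u = as_count (queens (Suc z) > Suc z)" if "ts ! 4 = Some u" for u
    using types[of 4 u] that by simp
  consider "s = 0" | "s = Suc 0" | "s = Suc (Suc 0)" | l where "s = Suc (Suc (Suc l))"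
    by (cases s; cases "s - 1"; cases "s - 2") auto
  then show ?thesis
  proof cases
    case 1
    then have "j = k" using j z by simp
    moreover obtain u u' where u: "ts ! 2 = Some u" "ts ! 3 = Some u'"
      "4 + as_count u + as_count u' \<le> v" "v \<le> 9 + as_count u + as_count u'"
      using lag_withinD(1)[OF assms(2)] assms(1) 1 by blast
    moreover have "upper_count z = upper_count k + as_count u + as_count u'"
      using U[of k] U[of "Suc k"] t2[OF u(1)] t3[OF u(2)] z by simp
    ultimately show ?thesis using 1 by simp
  next
    case 2
    then have "j = Suc k" using j z by simp
    moreover obtain u where u: "ts ! 3 = Some u" "3 + as_count u \<le> v" "v \<le> 8 + as_count u"
      using lag_withinD(2)[OF assms(2)] assms(1) 2 by blast
    moreover have "upper_count z = upper_count (Suc k) + as_count u"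
      using U[of "Suc k"] t3[OF u(1)] z by simp
    ultimately show ?thesis using 2 by simp
  next
    case 3
    then have "j = z" using j by simp
    moreover have "2 \<le> v" "v \<le> 7" using lag_withinD(3)[OF assms(2)] assms(1) 3 by blast+
    ultimately show ?thesis using 3 by simp
  next
    case 4
    then have "l = 0" and "\<exists>u. ts ! 4 = Some u \<and> 1 \<le> v + as_count u \<and> v + as_count u \<le> 6"
      using lag_withinD(4)[OF assms(2)] assms(1) by blast+
    then obtain u where u: "ts ! 4 = Some u" "1 \<le> v + as_count u" "v + as_count u \<le> 6" by blast
    moreover have "j = Suc z" using j 4 \<open>l = 0\<close> by simp
    moreover have "upper_count (Suc z) = upper_count z + as_count u"
      using U[of z] t4[OF u(1)] by simp
    ultimately show ?thesis using 4 \<open>l = 0\<close> by simp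
  qed
qed

text \<open>Let \<open>n = m + 1\<close>, with parent \<open>p\<close> and grandparent \<open>z\<close>. The boards of \<open>n\<close> and \<open>p\<close> give \<open>U m\<close> relative to \<open>p\<close> and
  \<open>U (p - 1)\<close> relative to \<open>z\<close>. Since \<open>n\<close> is \<open>p + U p\<close> or one less, and \<open>p\<close> is \<open>z + U z\<close> or one less, this locates \<open>L m\<close> at a
  bounded distance from \<open>z\<close>.\<close>

lemma lag_bounds_ge_19:
  assumes "19 \<le> m"
  shows "lag m \<in> {-3..2}"
proof -
  define n p z where "n = Suc m" and "p = parent n" and "z = parent p"
  note defs = n_def p_def z_def
  note n_p_sym = p_def[symmetric] and p_z_sym = z_def[symmetric]
  have n: "20 \<le> n" using assms by (simp add: defs)
  have p13: "13 \<le> p"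
    using parent_ge[of 12 n] n by (simp add: row_end_def upper_count_values defs(2))
  have z8: "8 \<le> z" and zp: "z + 5 \<le> p" using parent_13_le[OF p13] by (simp_all add: defs(3))
  have pn: "p + 5 \<le> n" using parent_13_le[of n] n by (simp add: defs(2))
  have tn: "upper_count (n - 1) + diags_used (letter n) = p + 4"
    using on_track_upper_count[of n] typed_and_on_track[of n] n p13 pn by (simp add: defs(2))
  have tp: "upper_count (p - 1) + diags_used (letter p) = z + 4"
    using on_track_upper_count[of p] typed_and_on_track[of p] p13 z8 zp by (simp add: defs(3))
  define early early' where "early \<longleftrightarrow> p \<noteq> row_end z" and "early' \<longleftrightarrow> n \<noteq> row_end p"
  have p1: "1 \<le> p" and n1: "1 \<le> n" and z1: "1 \<le> z" using p13 n z8 by simp_all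
  have two: "two_children (letter k) \<longleftrightarrow> queens k > k" if "1 \<le> k" for k
    using typedD[OF typed_all[of "Suc k"] that] by simp
  have A: "p = row_end z \<or> p + 1 = row_end z \<and> queens z > z" "upper_row p \<Longrightarrow> p = row_end z"
    "\<not> upper_row p \<Longrightarrow> letter p = first_child (letter z)"
    "p = row_end z \<Longrightarrow> letter p = last_child (letter z)"
    using row_end_parent[OF p1] upper_row_iff[OF p1] letter_first[OF p1]
      letter_row_end[OF typed_all[of p] p1] zp unfolding p_z_sym by linarith+
  have B: "n = row_end p \<or> n + 1 = row_end p \<and> queens p > p" "upper_row n \<Longrightarrow> n = row_end p"
    "\<not> upper_row n \<Longrightarrow> letter n = first_child (letter p)"
    "n = row_end p \<Longrightarrow> letter n = last_child (letter p)"
    using row_end_parent[OF n1] upper_row_iff[OF n1] letter_first[OF n1]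
      letter_row_end[OF typed_all[of n] n1] pn unfolding n_p_sym by linarith+
  have pe: "p + as_count early = row_end z" "early \<Longrightarrow> two_children (letter z)"
  proof -
    show "p + as_count early = row_end z"
      using A(1) unfolding early_def as_count_def by (cases "p = row_end z") simp_all
    show "two_children (letter z)" if early using A(1) two[OF z1] that unfolding early_def by blast
  qed
  have ne: "n + as_count early' = row_end p" "early' \<Longrightarrow> two_children (letter p)"
  proof -
    show "n + as_count early' = row_end p"
      using B(1) unfolding early'_def as_count_def by (cases "n = row_end p") simp_all
    show "two_children (letter p)" if early' using B(1) two[OF p1] that unfolding early'_def by blast
  qed
  have lp: "letter p = (if early then first_child (letter z) else last_child (letter z))"
    using A(2-4) unfolding early_def by (cases "p = row_end z") auto
  have ln: "letter n = (if early' then first_child (letter p) else last_child (letter p))"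
    using B(2-4) unfolding early'_def by (cases "n = row_end p") auto
  have lz: "7 \<le> letter z" "letter z < 1919"
    using letter_ge_7[OF typed_all[of z] z8] letter_less[OF typed_all[of z] z1] by simp_all
  have "lags_ok (letter z) early (letter p)"
    using steps_ok_letter[OF lz] pe(2) unfolding steps_ok_def lp last_child_def
    by (cases "two_children (letter z)"; cases early) simp_all
  then have lag_ok: "lag_ok (letter z) early (letter p) early' (letter n)"
    using ne(2) unfolding lags_ok_def ln last_child_def
    by (cases "two_children (letter p)"; cases early') simp_all
  define s where "s = Suc (diags_used (letter n) + as_count (two_children (letter p))) - (diags_used (letter p) + as_count early')"
  have s: "s + (diags_used (letter p) + as_count early') = Suc (diags_used (letter n) + as_count (two_children (letter p)))"
    using lag_ok unfolding lag_ok_def s_def by simp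
  have within: "lag_within s (diags_used (letter n) + as_count early) (types_of (letter z))"
    using lag_ok unfolding lag_ok_def s_def by simp
  have Up: "upper_count p = upper_count (p - 1) + as_count (two_children (letter p))"
    using upper_count_Suc[of "p - 1"] p1 two[OF p1] by (simp add: as_count_def)
  define j where "j = m - upper_count m"
  have jm: "j + upper_count m = m"
    using card_lower_diag[of m] by (simp add: j_def)
  have j: "j + 2 = z + s"
    using jm tn tp ne(1) pe(1) s Up by (simp add: row_end_def defs(1))
  have types: "(queens (z + i - 3) > z + i - 3) = u" if "i < 8" "types_of (letter z) ! i = Some u" for i u
    by (rule types_true[of "z + 8"]) (use that z8 typed_all[of "z + 8"] in simp_all)
  have len: "length (types_of (letter z)) = 8"
    by (rule consistentD(2)[OF consistent_letter[OF lz(2)]])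
  have "2 \<le> z" using z8 by simp
  then have "int (upper_count z) - int (upper_count j) + 6 - int s - int (diags_used (letter n) + as_count early) \<in> {-3..2}"
    by (rule lag_within_bounds[OF within len _ _ j]) (rule types)
  moreover have "lag m = int (upper_count z) - int (upper_count j) + 6 - int s - int (diags_used (letter n) + as_count early)"
  proof -
    have "lag m = int (upper_count m) - int j - int (upper_count j)"
      using jm unfolding lag_def j_def[symmetric] by linarith
    moreover have "int (upper_count m) = int p + 4 - int (diags_used (letter n))"
      using tn by (simp add: defs(1))
    moreover have "int p = int z + int (upper_count z) - int (as_count early)"
      using pe(1) by (simp add: row_end_def)
    ultimately show ?thesis using j by linarith
  qed
  ultimately show ?thesis by simp
qed

lemma lag_bounds: "lag n \<in> {-3..2}"
proof (cases "19 \<le> n")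
  case True
  then show ?thesis by (rule lag_bounds_ge_19)
next
  case False
  have "\<forall>k<19. lag k \<in> {-3..2}"
    by (simp add: all_less_numeral lag_def upper_count_1 upper_count_values)
  then show ?thesis using False by (metis not_le)
qed

section \<open>Contraction\<close>

lemma phi_gt_1: "1 < phi"
  by (simp add: phi_def)

lemma phi_square: "phi * phi = phi + 1"
  by (simp add: phi_def field_simps)

lemma inverse_phi: "1 / phi = phi - 1"
  using phi_gt_1 phi_square by (simp add: field_simps)

lemma upper_dev_phi: "upper_dev n = real (upper_count n) - real n * (phi - 1)"
  using inverse_phi by (simp add: upper_dev_def divide_inverse)

lemma upper_count_le: "upper_count n \<le> n"
  using card_lower_diag[of n] by simp

text \<open>Note that \<open>2 - phi = 1 / phi\<^sup>2\<close>.\<close>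

lemma upper_dev_contraction:
  "upper_dev n = (2 - phi) * (upper_dev (n - upper_count n) + real_of_int (lag n))"
proof -
  define j where "j = n - upper_count n"
  have n: "real n = real j + real (upper_count n)" using upper_count_le[of n] by (simp add: j_def)
  have l: "real_of_int (lag n) = real n - 2 * real j - real (upper_count j)"
    unfolding lag_def j_def by simp
  define x y w f where "x = real j" and "y = real (upper_count j)" and "w = real (upper_count n)" and "f = phi"
  have sq: "f * f = f + 1" using phi_square by (simp add: f_def)
  have "w - (x + w) * (f - 1) = (2 - f) * (y - x * (f - 1) + (x + w - 2 * x - y))"
    using sq by algebra
  then show ?thesis
    unfolding upper_dev_phi l n j_def[symmetric] unfolding x_def y_def w_def f_def by simp
qed

lemma upper_dev_bounds: "- 3 / phi < upper_dev n \<and> upper_dev n < 2 / phi"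
proof (induction n rule: less_induct)
  case (less n)
  have pos: "0 < 2 - phi"
  proof -
    have "sqrt 5 < 3" by (rule real_less_lsqrt) simp_all
    then show ?thesis by (simp add: phi_def)
  qed
  have eq: "(2 - phi) * (1 / phi + 1) = 1 / phi"
    using phi_square unfolding inverse_phi by algebra
  show ?case
  proof (cases "n = 0")
    case True
    then show ?thesis using phi_gt_1 by (simp add: upper_dev_def)
  next
    case False
    then have "1 \<le> upper_count n" using upper_count_mono[of 1 n] by (simp add: upper_count_1)
    then have "n - upper_count n < n" using False by simp
    note IH = less.IH[OF this]
    have lag: "-3 \<le> real_of_int (lag n)" "real_of_int (lag n) \<le> 2"
      using lag_bounds[of n] by simp_all
    \<comment> \<open>The end points are the fixed points of the contraction for the extreme lags.\<close>
    have "(2 - phi) * (- 3 / phi + - 3) < upper_dev n"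
      unfolding upper_dev_contraction[of n] using IH lag pos by (intro mult_strict_left_mono) auto
    moreover have "upper_dev n < (2 - phi) * (2 / phi + 2)"
      unfolding upper_dev_contraction[of n] using IH lag pos by (intro mult_strict_left_mono) auto
    moreover have "(2 - phi) * (2 / phi + 2) = 2 / phi" "(2 - phi) * (- 3 / phi + - 3) = - 3 / phi"
    proof -
      have r: "2 / phi = 2 * (1 / phi)" "- 3 / phi = - 3 * (1 / phi)" by simp_all
      show "(2 - phi) * (2 / phi + 2) = 2 / phi" "(2 - phi) * (- 3 / phi + - 3) = - 3 / phi"
        using eq unfolding r by algebra+
    qed
    ultimately show ?thesis by simp
  qed
qed

theorem proposition21:
  shows "(\<forall>n::nat. - 3 / phi < upper_dev n \<and> upper_dev n < 2 / phi) \<and>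
    (\<forall>n::nat. n \<ge> 1 \<longrightarrow>
      (queens n > n \<longrightarrow>
        1 - 4 / phi < real (queens n) - real n * phi \<and>
        real (queens n) - real n * phi < 2 / phi) \<and>
      (queens n < n \<longrightarrow>
        - 2 - 4 / phi < real (queens n) - real n / phi \<and>
        real (queens n) - real n / phi < 4 + 1 / phi))"
proof (intro conjI allI impI)
  fix n :: nat
  show "- 3 / phi < upper_dev n" "upper_dev n < 2 / phi" using upper_dev_bounds[of n] by simp_all
next
  fix n :: nat
  assume n: "1 \<le> n"
  have prev: "upper_dev n = upper_dev (n - 1) + (if queens n > n then 1 else 0) - 1 / phi"
    using upper_count_Suc[of "n - 1"] n by (simp add: upper_dev_def diff_divide_distrib)
  {
    assume up: "queens n > n"
    then have eq: "real (queens n) - real n * phi = upper_dev n"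
      using queens_upper[OF up] by (simp add: upper_dev_phi algebra_simps)
    show "real (queens n) - real n * phi < 2 / phi"
      unfolding eq using upper_dev_bounds[of n] by simp
    show "1 - 4 / phi < real (queens n) - real n * phi"
      unfolding eq prev using upper_dev_bounds[of "n - 1"] up by simp
  next
    assume low: "queens n < n"
    have eq: "real (queens n) - real n / phi = upper_dev n + (real (queens n) - real (upper_count n))"
      by (simp add: upper_dev_def)
    have "-2 \<le> real (queens n) - real (upper_count n)" "real (queens n) - real (upper_count n) \<le> 4"
      using lower_queen_near_upper_count[OF low] by linarith+
    moreover have "upper_dev n < 1 / phi" "- 4 / phi < upper_dev n"
      using upper_dev_bounds[of "n - 1"] low prev by simp_all
    ultimately show "- 2 - 4 / phi < real (queens n) - real n / phi"
      "real (queens n) - real n / phi < 4 + 1 / phi"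
      unfolding eq by simp_all
  }
qed

end
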